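(* Let $\pi:X\to Y$ be a factor code on an SFT $X$. Given an ergodic measure $\mu$ on $X$ and a continuous function $f:X\to\mathbb R$, let $S_{\mu,f}$ be the set of measures $\mu''\in S_\mu$ for which $$h(\mu'')+\int f\,d\mu''\ \ge\ h(\mu')+\int f\,d\mu'$$ for all $\mu'\in S_\mu$, where $S_\mu$ is the set of all (possibly non-ergodic) invariant measures on $X$ class parallel to $\mu$. Then $S_{\mu,f}$ is non-empty, convex and compact.
   Context: An SFT is a two-sided shift of finite type with finite alphabet; a factor code $\pi:X\to Y$ is a shift-commuting continuous surjection onto a shift space $Y$. "Measure" means Borel probability measure; invariant and ergodic are with respect to the shift; spaces of measures carry the weak-* topology; $h$ is measure-theoretic (Kolmogorov–Sinai) entropy. Transition classes: for $y\in Y$ and $x,x'\in\pi^{-1}(y)$, say there is a transition from $x$ to $x'$ if for every integer $n$ there is $z\in X$ with $\pi(z)=y$, $z_i=x_i$ for all $i\le n$, and $z_i=x'_i$ for all sufficiently large $i$ (for a 1-block code on a 1-step SFT: infinitely many times to the right one can pass from $x$ to $x'$ via finite $X$-words while keeping the same image $y$). Write $x\sim x'$ if there is a transition from $x$ to $x'$ and one from $x'$ to $x$; this is an equivalence relation on $\pi^{-1}(y)$. Let $C_\pi=\{(x,x')\in X^2:\pi(x)=\pi(x'),\ x\sim x'\}$. A (2-fold) relative joining of invariant measures $\mu,\mu'$ on $X$ is a measure $\lambda$ on $X^2$, invariant under the product shift, with margins $\mu$ and $\mu'$, such that $\pi(x)=\pi(x')$ for $\lambda$-a.e. $(x,x')$.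 An invariant measure $\mu'$ is class parallel to $\mu$ if there is a relative joining $\lambda$ of $\mu$ and $\mu'$ with $\lambda(C_\pi)=1$. *)

theory Defs
  imports "HOL-Probability.Probability"
begin

section \<open>Shift spaces and factor codes\<close>

text \<open>A finite alphabet with its discrete topology. Sequence spaces \<^typ>\<open>int \<Rightarrow> 'a\<close> then carry the
  product topology.\<close>

class alphabet = finite + discrete_topology
begin

subclass second_countable_topology
proof
  have "countable (UNIV :: 'a set set)"
    using finite_UNIV by (metis countable_finite finite_Pow_iff Pow_UNIV)
  moreover have "open = generate_topology (UNIV :: 'a set set)"
    using open_discrete by (auto intro!: ext generate_topology.Basis)
  ultimately show "\<exists>B::'a set set. countable B \<and> open = generate_topology B"
    by blast
qed

end

definition shift_map :: "(int \<Rightarrow> 'a) \<Rightarrow> (int \<Rightarrow> 'a)" where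
  "shift_map x = (\<lambda>i. x (i + 1))"

definition occurs_in :: "'a list \<Rightarrow> (int \<Rightarrow> 'a) \<Rightarrow> bool" where
  "occurs_in w x \<longleftrightarrow> (\<exists>i. \<forall>k < length w. x (i + int k) = w ! k)"

definition shift_space :: "(int \<Rightarrow> 'a::alphabet) set \<Rightarrow> bool" where
  "shift_space X \<longleftrightarrow> closed X \<and> shift_map ` X = X"

definition SFT :: "(int \<Rightarrow> 'a::alphabet) set \<Rightarrow> bool" where
  "SFT X \<longleftrightarrow> (\<exists>F. finite F \<and> X = {x. \<forall>w\<in>F. \<not> occurs_in w x})"

definition factor_code ::
  "(int \<Rightarrow> 'a::alphabet) set \<Rightarrow> (int \<Rightarrow> 'b::alphabet) set \<Rightarrow> ((int \<Rightarrow> 'a) \<Rightarrow> (int \<Rightarrow> 'b)) \<Rightarrow> bool" where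
  "factor_code X Y \<pi> \<longleftrightarrow>
     shift_space X \<and> shift_space Y \<and> continuous_on X \<pi> \<and> \<pi> ` X = Y \<and>
     (\<forall>x\<in>X. \<pi> (shift_map x) = shift_map (\<pi> x))"


section \<open>Measures on a topological subspace\<close>

abbreviation borel_on :: "'x::topological_space set \<Rightarrow> 'x measure" where
  "borel_on X \<equiv> restrict_space borel X"

definition prob_measures :: "'x::topological_space set \<Rightarrow> 'x measure set" where
  "prob_measures X = {\<mu>. prob_space \<mu> \<and> sets \<mu> = sets (borel_on X)}"

definition invariant_measures :: "(int \<Rightarrow> 'a::alphabet) set \<Rightarrow> (int \<Rightarrow> 'a) measure set" where
  "invariant_measures X = {\<mu> \<in> prob_measures X. distr \<mu> (borel_on X) shift_map = \<mu>}"

definition ergodic_measures :: "(int \<Rightarrow> 'a::alphabet) set \<Rightarrow> (int \<Rightarrow> 'a) measure set" where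
  "ergodic_measures X = {\<mu> \<in> invariant_measures X.
     \<forall>A \<in> sets \<mu>. shift_map -` A \<inter> X = A \<longrightarrow> measure \<mu> A = 0 \<or> measure \<mu> A = 1}"

text \<open>For compact \<^term>\<open>X\<close>, where every continuous function is bounded, this is the weak-* topology.\<close>

definition weak_star :: "'x::topological_space set \<Rightarrow> 'x measure topology" where
  "weak_star X = topology_generated_by
     {{\<mu> \<in> prob_measures X. (\<integral>x. g x \<partial>\<mu>) \<in> U} | g U.
        continuous_on X (g :: 'x \<Rightarrow> real) \<and> open U}"

text \<open>The type of measures is not a vector space, so convex combinations are formed setwise.\<close>

definition mixture :: "real \<Rightarrow> 'x measure \<Rightarrow> 'x measure \<Rightarrow> 'x measure" where
  "mixture t \<mu> \<nu> = measure_of (space \<mu>) (sets \<mu>)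
     (\<lambda>A. ennreal t * emeasure \<mu> A + ennreal (1 - t) * emeasure \<nu> A)"

lemma emeasure_mixture:
  assumes eq: "sets \<nu> = sets \<mu>" and A: "A \<in> sets \<mu>"
  shows "emeasure (mixture t \<mu> \<nu>) A = ennreal t * emeasure \<mu> A + ennreal (1 - t) * emeasure \<nu> A"
proof (rule emeasure_measure_of[OF mixture_def])
  show "sets \<mu> \<subseteq> Pow (space \<mu>)"
    by (rule sets.space_closed)
  show "A \<in> sets (mixture t \<mu> \<nu>)"
    using A by (simp add: mixture_def)
  show "positive (sets (mixture t \<mu> \<nu>))
      (\<lambda>A. ennreal t * emeasure \<mu> A + ennreal (1 - t) * emeasure \<nu> A)"
    by (simp add: positive_def)
  show "countably_additive (sets (mixture t \<mu> \<nu>))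
      (\<lambda>A. ennreal t * emeasure \<mu> A + ennreal (1 - t) * emeasure \<nu> A)"
  proof (rule countably_additiveI)
    fix B :: "nat \<Rightarrow> 'a set"
    assume "range B \<subseteq> sets (mixture t \<mu> \<nu>)" and d: "disjoint_family B"
    then have B: "range B \<subseteq> sets \<mu>" "range B \<subseteq> sets \<nu>"
      by (simp_all add: mixture_def eq)
    show "(\<Sum>i. ennreal t * emeasure \<mu> (B i) + ennreal (1 - t) * emeasure \<nu> (B i)) =
        ennreal t * emeasure \<mu> (\<Union> (range B)) + ennreal (1 - t) * emeasure \<nu> (\<Union> (range B))"
      using suminf_emeasure[OF B(1) d] suminf_emeasure[OF B(2) d]
      by (simp add: suminf_add[symmetric])
  qed
qed

definition convex_measures :: "'x measure set \<Rightarrow> bool" where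
  "convex_measures S \<longleftrightarrow> (\<forall>\<mu>\<in>S. \<forall>\<nu>\<in>S. \<forall>t\<in>{0..1}. mixture t \<mu> \<nu> \<in> S)"


section \<open>Kolmogorov--Sinai entropy\<close>

text \<open>A finite measurable partition is encoded by the function sending a point to the index of its
  cell, i.e. by a simple function \<^term>\<open>P\<close>; two functions with the same fibres encode the same
  partition. The join of the first \<^term>\<open>n\<close> preimages under \<^term>\<open>T\<close> is the partition into
  \<^term>\<open>P\<close>-names of length \<^term>\<open>n\<close>. Logarithms are natural.\<close>

definition partition_entropy :: "'x measure \<Rightarrow> ('x \<Rightarrow> 'k) \<Rightarrow> real" where
  "partition_entropy \<mu> P = prob_space.entropy \<mu> (exp 1) (count_space (P ` space \<mu>)) P"

lemma partition_entropy_eq: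
  assumes "prob_space \<mu>" "simple_function \<mu> P"
  shows "partition_entropy \<mu> P =
    - (\<Sum>k\<in>P ` space \<mu>. measure \<mu> (P -` {k} \<inter> space \<mu>) * ln (measure \<mu> (P -` {k} \<inter> space \<mu>)))"
proof -
  interpret prob_space \<mu> by fact
  interpret information_space \<mu> "exp 1" by unfold_locales simp
  have "simple_distributed \<mu> P (\<lambda>k. measure \<mu> (P -` {k} \<inter> space \<mu>))"
    using assms(2) by (intro simple_distributedI) auto
  from entropy_simple_distributed[OF this] show ?thesis
    by (simp add: partition_entropy_def log_def)
qed

definition itinerary :: "('x \<Rightarrow> 'x) \<Rightarrow> ('x \<Rightarrow> 'k) \<Rightarrow> nat \<Rightarrow> 'x \<Rightarrow> 'k list" where
  "itinerary T P n x = map (\<lambda>i. P ((T ^^ i) x)) [0..<n]"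

definition entropy_rate :: "'x measure \<Rightarrow> ('x \<Rightarrow> 'x) \<Rightarrow> ('x \<Rightarrow> 'k) \<Rightarrow> real" where
  "entropy_rate \<mu> T P = lim (\<lambda>n. partition_entropy \<mu> (itinerary T P n) / real n)"

definition ks_entropy :: "'x measure \<Rightarrow> ('x \<Rightarrow> 'x) \<Rightarrow> ereal" where
  "ks_entropy \<mu> T = (SUP P \<in> {P :: 'x \<Rightarrow> nat. simple_function \<mu> P}. ereal (entropy_rate \<mu> T P))"


section \<open>Transition classes and class parallel measures\<close>

definition transition ::
  "(int \<Rightarrow> 'a) set \<Rightarrow> ((int \<Rightarrow> 'a) \<Rightarrow> (int \<Rightarrow> 'b)) \<Rightarrow> (int \<Rightarrow> 'a) \<Rightarrow> (int \<Rightarrow> 'a) \<Rightarrow> bool" where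
  "transition X \<pi> x x' \<longleftrightarrow>
     (\<forall>n::int. \<exists>z\<in>X. \<pi> z = \<pi> x \<and> (\<forall>i\<le>n. z i = x i) \<and> (\<exists>N. \<forall>i\<ge>N. z i = x' i))"

definition class_pairs ::
  "(int \<Rightarrow> 'a) set \<Rightarrow> ((int \<Rightarrow> 'a) \<Rightarrow> (int \<Rightarrow> 'b)) \<Rightarrow> ((int \<Rightarrow> 'a) \<times> (int \<Rightarrow> 'a)) set" where
  "class_pairs X \<pi> = {(x, x'). x \<in> X \<and> x' \<in> X \<and> \<pi> x = \<pi> x' \<and>
     transition X \<pi> x x' \<and> transition X \<pi> x' x}"

definition relative_joinings ::
  "(int \<Rightarrow> 'a::alphabet) set \<Rightarrow> ((int \<Rightarrow> 'a) \<Rightarrow> (int \<Rightarrow> 'b)) \<Rightarrow> (int \<Rightarrow> 'a) measure \<Rightarrow>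
   (int \<Rightarrow> 'a) measure \<Rightarrow> ((int \<Rightarrow> 'a) \<times> (int \<Rightarrow> 'a)) measure set" where
  "relative_joinings X \<pi> \<mu> \<mu>' = {\<rho> \<in> prob_measures (X \<times> X).
     distr \<rho> (borel_on (X \<times> X)) (map_prod shift_map shift_map) = \<rho> \<and>
     distr \<rho> (borel_on X) fst = \<mu> \<and>
     distr \<rho> (borel_on X) snd = \<mu>' \<and>
     (AE p in \<rho>. \<pi> (fst p) = \<pi> (snd p))}"

definition class_parallel ::
  "(int \<Rightarrow> 'a::alphabet) set \<Rightarrow> ((int \<Rightarrow> 'a) \<Rightarrow> (int \<Rightarrow> 'b)) \<Rightarrow> (int \<Rightarrow> 'a) measure \<Rightarrow>
   (int \<Rightarrow> 'a) measure \<Rightarrow> bool" where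
  "class_parallel X \<pi> \<mu>' \<mu> \<longleftrightarrow>
     (\<exists>\<rho> \<in> relative_joinings X \<pi> \<mu> \<mu>'. emeasure \<rho> (class_pairs X \<pi>) = 1)"

definition class_parallel_measures ::
  "(int \<Rightarrow> 'a::alphabet) set \<Rightarrow> ((int \<Rightarrow> 'a) \<Rightarrow> (int \<Rightarrow> 'b)) \<Rightarrow> (int \<Rightarrow> 'a) measure \<Rightarrow>
   (int \<Rightarrow> 'a) measure set" where
  "class_parallel_measures X \<pi> \<mu> = {\<mu>' \<in> invariant_measures X. class_parallel X \<pi> \<mu>' \<mu>}"

definition pressure :: "((int \<Rightarrow> 'a) \<Rightarrow> real) \<Rightarrow> (int \<Rightarrow> 'a) measure \<Rightarrow> ereal" where
  "pressure f \<mu> = ks_entropy \<mu> shift_map + ereal (\<integral>x. f x \<partial>\<mu>)"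

definition class_equilibrium_measures ::
  "(int \<Rightarrow> 'a::alphabet) set \<Rightarrow> ((int \<Rightarrow> 'a) \<Rightarrow> (int \<Rightarrow> 'b)) \<Rightarrow> (int \<Rightarrow> 'a) measure \<Rightarrow>
   ((int \<Rightarrow> 'a) \<Rightarrow> real) \<Rightarrow> (int \<Rightarrow> 'a) measure set" where
  "class_equilibrium_measures X \<pi> \<mu> f =
     {\<mu>'' \<in> class_parallel_measures X \<pi> \<mu>.
        \<forall>\<mu>' \<in> class_parallel_measures X \<pi> \<mu>. pressure f \<mu>'' \<ge> pressure f \<mu>'}"

end

theory Submission
  imports Defs
begin

text \<open>The set of class parallel measures is not visibly closed, since the set of pairs of equivalent points is
  not. However, fix an open set \<open>G\<close> of positive measure over which every fibre can be rerouted, in a bounded time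
  window, through a set \<open>M\<close> of states that is as small as possible. Over a generic point there are then at least
  \<open>card M\<close> transition classes, and two points of a generic fibre that can infinitely often be rerouted through a
  common state are equivalent. By the pigeonhole principle and recurrence, an invariant relative joining is
  supported on equivalent pairs if and only if it does not charge the open set of pairs over \<open>G\<close> that have no
  common state. Hence the joinings supported on equivalent pairs form a weak-* compact convex set.

  The entropy of a shift is that of its coordinate partition, hence upper semicontinuous, and it is concave. So the
  pressure attains its maximum on this set, and the maximizers form a compact convex set, which the second
  margin maps continuously and affinely onto the measures in question.\<close>

section \<open>Zero-dimensional compact spaces\<close>

text \<open>Minimality of \<open>M\<close> bounds the number of classes from below for this reason.
  If a fibre has finitely many classes, representatives of them, read at one late time, give at most
  that many states through which all points of the fibre can be routed, within a time window made
  uniform by compactness of the fibre. So a point whose fibre has fewer than \<open>card M\<close>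
  classes lies in a funnel with fewer than \<open>card M\<close> states. There are only countably
  many funnels, and those with fewer states are null by the choice of \<open>M\<close>; a generic
  point avoids them all.

  Being equivalent is a condition on the whole future, whereas sharing a state within the window
  depends on finitely many coordinates. This is what makes the set of bad pairs relatively open, and
  vanishing on an open set is a weak-* closed condition that mixtures preserve.

  Sequence spaces and their squares are treated alike as compact spaces with a clopen base. Measures
  there correspond to contents on clopen sets, so weak-* compactness comes from Tychonoff's theorem,
  and continuity of integrals and of partition entropies is reduced to that of the measures of
  clopen sets.\<close>

definition clopen :: "'x::topological_space set \<Rightarrow> bool" where
  "clopen C \<longleftrightarrow> open C \<and> closed C"

lemma clopen_simps [simp]: "clopen {}" "clopen UNIV"
  by (auto simp: clopen_def)

lemma clopen_intros [intro]:
  "clopen C \<Longrightarrow> clopen D \<Longrightarrow> clopen (C \<union> D)"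
  "clopen C \<Longrightarrow> clopen D \<Longrightarrow> clopen (C \<inter> D)"
  "clopen C \<Longrightarrow> clopen D \<Longrightarrow> clopen (C - D)"
  "clopen C \<Longrightarrow> clopen (- C)"
  by (auto simp: clopen_def)

lemma clopen_UN: "finite I \<Longrightarrow> (\<And>i. i \<in> I \<Longrightarrow> clopen (C i)) \<Longrightarrow> clopen (\<Union>i\<in>I. C i)"
  by (auto simp: clopen_def)

lemma clopen_borel [measurable]: "clopen C \<Longrightarrow> C \<in> sets borel"
  by (simp add: clopen_def)

lemma clopen_vimage: "clopen C \<Longrightarrow> continuous_on UNIV h \<Longrightarrow> clopen (h -` C)"
  by (simp add: clopen_def open_vimage closed_vimage)

text \<open>Covers at once the sequence spaces, where the measures live, and their squares, where
  the joinings live.\<close>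

class stone_space = t2_space + second_countable_topology +
  assumes compact_stone_space: "compact (UNIV :: 'a set)"
    and clopen_neighborhood_aux:
      "open U \<Longrightarrow> x \<in> U \<Longrightarrow> \<exists>C. open C \<and> closed C \<and> x \<in> C \<and> C \<subseteq> U"

lemma clopen_neighborhood:
  fixes x :: "'x::stone_space"
  assumes "open U" "x \<in> U"
  obtains C where "clopen C" "x \<in> C" "C \<subseteq> U"
  using clopen_neighborhood_aux[OF assms] unfolding clopen_def by blast

instance alphabet \<subseteq> stone_space
proof
  show "compact (UNIV :: 'a set)"
    by (simp add: finite_imp_compact)
  show "\<exists>C. open C \<and> closed C \<and> x \<in> C \<and> C \<subseteq> U" if "open U" "x \<in> U" for U and x :: 'a
    using that discrete_topology_class.open_discrete[of "{x}"] by (intro exI[of _ "{x}"]) simp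
qed

section \<open>Products of zero-dimensional compact spaces\<close>

instance "fun" :: (type, t0_space) t0_space
proof
  fix x y :: "'a \<Rightarrow> 'b"
  assume "x \<noteq> y"
  then obtain i where "x i \<noteq> y i" by blast
  then obtain U where U: "open U" "(x i \<in> U) \<noteq> (y i \<in> U)"
    using t0_space_class.t0_space[of "x i" "y i"] by blast
  have "open ((\<lambda>x. x i) -` U :: ('a \<Rightarrow> 'b) set)"
    using U by (auto intro!: open_vimage)
  then show "\<exists>U. open U \<and> \<not> (x \<in> U) = (y \<in> U)"
    using U by (intro exI[of _ "(\<lambda>x. x i) -` U"]) auto
qed

instance "fun" :: (type, t1_space) t1_space
proof
  fix x y :: "'a \<Rightarrow> 'b"
  assume "x \<noteq> y"
  then obtain i where "x i \<noteq> y i" by blast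
  then obtain U where U: "open U" "x i \<in> U" "y i \<notin> U"
    using t1_space_class.t1_space[of "x i" "y i"] by blast
  have "open ((\<lambda>x. x i) -` U :: ('a \<Rightarrow> 'b) set)"
    using U by (auto intro!: open_vimage)
  then show "\<exists>U. open U \<and> x \<in> U \<and> y \<notin> U"
    using U by (intro exI[of _ "(\<lambda>x. x i) -` U"]) auto
qed

instance "fun" :: (type, t2_space) t2_space
proof
  fix x y :: "'a \<Rightarrow> 'b"
  assume "x \<noteq> y"
  then obtain i where "x i \<noteq> y i" by blast
  then obtain U V where UV: "open U" "open V" "x i \<in> U" "y i \<in> V" "U \<inter> V = {}"
    using hausdorff[of "x i" "y i"] by blast
  have "open ((\<lambda>x. x i) -` U :: ('a \<Rightarrow> 'b) set)" "open ((\<lambda>x. x i) -` V :: ('a \<Rightarrow> 'b) set)"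
    using UV by (auto intro!: open_vimage)
  then show "\<exists>U V. open U \<and> open V \<and> x \<in> U \<and> y \<in> V \<and> U \<inter> V = {}"
    using UV by (intro exI[of _ "(\<lambda>x. x i) -` U"] exI[of _ "(\<lambda>x. x i) -` V"]) auto
qed

instance "fun" :: (countable, stone_space) stone_space
proof
  show "compact (UNIV :: ('a \<Rightarrow> 'b) set)"
    using compactin_PiE[of "\<lambda>_. euclidean" UNIV "\<lambda>_. UNIV :: 'b set"]
    by (simp add: euclidean_product_topology compact_stone_space)
  fix U :: "('a \<Rightarrow> 'b) set" and x
  assume "open U" "x \<in> U"
  then obtain B where B: "x \<in> PiE UNIV B" "\<And>i. open (B i)" "finite {i. B i \<noteq> UNIV}" "PiE UNIV B \<subseteq> U"
    using product_topology_open_contains_basis[of "\<lambda>_. euclidean" UNIV U x]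
    by (auto simp: open_fun_def)
  have "\<exists>C. clopen C \<and> x i \<in> C \<and> C \<subseteq> B i" for i
  proof -
    have "x i \<in> B i" using B(1) by (simp add: PiE_iff)
    from clopen_neighborhood[OF B(2) this] show ?thesis by blast
  qed
  then obtain C where C: "\<And>i. clopen (C i)" "\<And>i. x i \<in> C i" "\<And>i. C i \<subseteq> B i"
    by metis
  \<comment> \<open>Only the finitely many restricted coordinates enter, so that the intersection is
    open as well as closed.\<close>
  define D where "D = (\<Inter>i\<in>{i. B i \<noteq> UNIV}. (\<lambda>x. x i) -` C i)"
  have "clopen ((\<lambda>x. x i) -` C i :: ('a \<Rightarrow> 'b) set)" for i
    using C by (intro clopen_vimage) auto
  then have "open D" "closed D"
    using B(3) by (auto simp: D_def clopen_def)
  moreover have "x \<in> D" "D \<subseteq> U"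
    using B C by (fastforce simp: D_def PiE_iff)+
  ultimately show "\<exists>C. open C \<and> closed C \<and> x \<in> C \<and> C \<subseteq> U"
    by blast
qed

instance prod :: (stone_space, stone_space) stone_space
proof
  show "compact (UNIV :: ('a \<times> 'b) set)"
    using compact_Times[OF compact_stone_space compact_stone_space] by simp
  fix U :: "('a \<times> 'b) set" and x
  assume "open U" "x \<in> U"
  then obtain A B where "open A" "open B" "fst x \<in> A" "snd x \<in> B" and AB: "A \<times> B \<subseteq> U"
    by (auto elim!: open_prod_elim)
  moreover from this obtain C D
    where "clopen C" "fst x \<in> C" "C \<subseteq> A" "clopen D" "snd x \<in> D" "D \<subseteq> B"
    by (meson clopen_neighborhood)
  moreover from this have "open (C \<times> D)" "closed (C \<times> D)"
    by (auto simp: clopen_def open_Times closed_Times)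
  ultimately show "\<exists>C. open C \<and> closed C \<and> x \<in> C \<and> C \<subseteq> U"
    by (intro exI[of _ "C \<times> D"]) (auto simp: mem_Times_iff)
qed

lemma closed_imp_compact:
  fixes Z :: "'x::stone_space set"
  shows "closed Z \<Longrightarrow> compact Z"
  using closed_Int_compact[OF _ compact_stone_space] by auto

lemma open_as_clopen_Union:
  fixes U :: "'x::stone_space set"
  assumes "open U"
  obtains C :: "nat \<Rightarrow> 'x set" where "\<And>i. clopen (C i)" "U = (\<Union>i. C i)"
proof -
  define F where "F = {C. clopen C \<and> C \<subseteq> U}"
  have "\<Union>F = U"
    using clopen_neighborhood[OF assms] unfolding F_def by blast
  moreover obtain F' where "F' \<subseteq> F" "countable F'" "\<Union>F' = \<Union>F"
    using Lindelof[of F] unfolding F_def clopen_def by blast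
  \<comment> \<open>The empty set is added because enumerating by \<open>from_nat_into\<close>
    requires a nonempty family.\<close>
  ultimately have F': "countable (insert {} F')" "\<Union>(insert {} F') = U" "\<forall>C\<in>insert {} F'. clopen C"
    by (auto simp: F_def)
  have "clopen (from_nat_into (insert {} F') i)" for i
    using F'(3) from_nat_into[of "insert {} F'" i] by blast
  moreover have "U = (\<Union>i. from_nat_into (insert {} F') i)"
    using F'(1,2) range_from_nat_into[of "insert {} F'"] by simp
  ultimately show thesis by (rule that)
qed

section \<open>Borel sets and measures generated by clopen sets\<close>

lemma borel_eq_sigma_clopen:
  "sets (borel :: 'x::stone_space measure) = sigma_sets UNIV {C. clopen C}"
proof -
  have "U \<in> sigma_sets UNIV {C. clopen C}" if U: "open U" for U :: "'x set"
  proof -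
    obtain C :: "nat \<Rightarrow> 'x set" where C: "\<And>i. clopen (C i)" "U = (\<Union>i. C i)"
      using open_as_clopen_Union[OF U] by blast
    show ?thesis
      unfolding C(2) using C(1) by (intro sigma_sets.Union sigma_sets.Basic) simp
  qed
  then have "sigma_sets UNIV {U :: 'x set. open U} \<subseteq> sigma_sets UNIV {C. clopen C}"
    by (intro sigma_sets_mono) auto
  moreover have "sigma_sets UNIV {C :: 'x set. clopen C} \<subseteq> sigma_sets UNIV {U. open U}"
    by (intro sigma_sets_mono') (auto simp: clopen_def)
  ultimately show ?thesis
    by (simp add: sets_borel)
qed

lemma sets_borel_on_eq_sigma_clopen:
  fixes Z :: "'x::stone_space set"
  shows "sets (borel_on Z) = sigma_sets Z {C \<inter> Z | C. clopen C}"
proof -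
  have "sets (borel_on Z) = {(\<lambda>x. x) -` A \<inter> Z | A. A \<in> sigma_sets UNIV {C. clopen C}}"
    by (auto simp: sets_restrict_space borel_eq_sigma_clopen)
  also have "\<dots> = sigma_sets Z {(\<lambda>x. x) -` A \<inter> Z | A. A \<in> {C. clopen C}}"
    by (rule sigma_sets_vimage_commute) simp
  finally show ?thesis by simp
qed

lemma clopen_decseq_empty:
  fixes A :: "nat \<Rightarrow> 'x::stone_space set"
  assumes "\<And>i. clopen (A i)" "decseq A" "(\<Inter>i. A i) = {}"
  obtains n where "A n = {}"
proof -
  have "UNIV \<subseteq> (\<Union>i\<in>UNIV. - A i)" "\<And>i. open (- A i)"
    using assms by (auto simp: clopen_def)
  then obtain I where I: "I \<subseteq> UNIV" "finite I" "UNIV \<subseteq> (\<Union>i\<in>I. - A i)"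
    using compactE_image[OF compact_stone_space] by metis
  obtain n where n: "\<forall>i\<in>I. i \<le> n"
    using I(2) finite_nat_set_iff_bounded_le by blast
  have "A n \<subseteq> A i" if "i \<in> I" for i
    using n that assms(2) by (auto dest: decseqD)
  then have "A n = {}" using I(3) by blast
  then show thesis by (rule that)
qed

text \<open>By compactness a decreasing sequence of clopen sets with empty intersection is
  eventually empty. Finite additivity therefore already implies continuity at the empty set, and
  Caratheodory's extension applies.\<close>

lemma clopen_content_extension:
  fixes v :: "'x::stone_space set \<Rightarrow> real"
  assumes nonneg: "\<And>C. clopen C \<Longrightarrow> 0 \<le> v C" and one: "v UNIV = 1"
    and add: "\<And>C D. clopen C \<Longrightarrow> clopen D \<Longrightarrow> C \<inter> D = {} \<Longrightarrow> v (C \<union> D) = v C + v D"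
  obtains m where "prob_space m" "sets m = sets borel" "\<And>C. clopen C \<Longrightarrow> measure m C = v C"
proof -
  interpret ring_of_sets UNIV "{C :: 'x set. clopen C}"
    by (auto simp: ring_of_sets_iff)
  have v0: "v {} = 0" using add[of "{}" "{}"] by simp
  have "\<exists>\<mu>. (\<forall>s\<in>{C. clopen C}. \<mu> s = ennreal (v s)) \<and>
      measure_space UNIV (sigma_sets UNIV {C. clopen C}) \<mu>"
  proof (rule caratheodory_empty_continuous)
    show "positive {C. clopen C} (\<lambda>C. ennreal (v C))"
      by (simp add: positive_def v0)
    show "additive {C. clopen C} (\<lambda>C. ennreal (v C))"
      using nonneg add by (auto simp: additive_def)
    fix A :: "nat \<Rightarrow> 'x set"
    assume A: "range A \<subseteq> {C. clopen C}" "decseq A" "(\<Inter>i. A i) = {}"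
    then obtain n where n: "A n = {}" using clopen_decseq_empty[of A] by blast
    have "A m = {}" if "m \<ge> n" for m
      using decseqD[OF A(2) that] n by blast
    then have "eventually (\<lambda>m. ennreal (v (A m)) = 0) sequentially"
      by (intro eventually_sequentiallyI[of n]) (simp add: v0)
    then show "(\<lambda>i. ennreal (v (A i))) \<longlonglongrightarrow> 0"
      by (rule tendsto_eventually)
  qed simp
  then obtain \<mu> where \<mu>: "\<And>C. clopen C \<Longrightarrow> \<mu> C = ennreal (v C)"
    and ms: "measure_space UNIV (sigma_sets UNIV {C. clopen C}) \<mu>"
    by auto
  define m where "m = measure_of UNIV {C. clopen C} \<mu>"
  have sets: "sets m = sets borel"
    by (simp add: m_def borel_eq_sigma_clopen)
  have em: "emeasure m C = ennreal (v C)" if "clopen C" for C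
    using ms that unfolding measure_space_def
    by (subst emeasure_measure_of[OF m_def]) (auto simp: \<mu> m_def)
  have "emeasure m (space m) = 1"
    using em[of UNIV] one sets_eq_imp_space_eq[OF sets] by simp
  then have "prob_space m" by (rule prob_spaceI)
  moreover have "measure m C = v C" if "clopen C" for C
    using em[OF that] nonneg[OF that] by (simp add: measure_def)
  ultimately show thesis using that[of m] sets by blast
qed

section \<open>The weak-* topology\<close>

lemma prob_measuresD:
  assumes "\<rho> \<in> prob_measures Z"
  shows "prob_space \<rho>" "sets \<rho> = sets (borel_on Z)" "space \<rho> = Z"
  using assms sets_eq_imp_space_eq[of \<rho> "borel_on Z"]
  by (auto simp: prob_measures_def space_restrict_space)

lemma sets_prob_measures:
  "\<rho> \<in> prob_measures Z \<Longrightarrow> sets \<rho> = {A \<inter> Z | A. A \<in> sets borel}"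
  by (auto simp: prob_measures_def sets_restrict_space)

lemma borel_Int_in_prob_measures:
  "\<rho> \<in> prob_measures Z \<Longrightarrow> A \<in> sets borel \<Longrightarrow> A \<inter> Z \<in> sets \<rho>"
  by (auto simp: sets_prob_measures)

lemma borel_measurable_prob_measures:
  assumes "\<rho> \<in> prob_measures Z" "continuous_on Z g"
  shows "g \<in> borel_measurable \<rho>"
  using borel_measurable_continuous_on_restrict[OF assms(2)] prob_measuresD(2)[OF assms(1)]
  by (simp cong: measurable_cong_sets)

lemma integrable_prob_measures:
  fixes g :: "'x::topological_space \<Rightarrow> real"
  assumes "\<rho> \<in> prob_measures Z" "continuous_on Z g" "compact Z"
  shows "integrable \<rho> g"
proof -
  interpret prob_space \<rho> by (rule prob_measuresD[OF assms(1)])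
  obtain B where "\<forall>x\<in>Z. \<bar>g x\<bar> \<le> B"
    using compact_imp_bounded[OF compact_continuous_image[OF assms(2,3)]] by (auto simp: bounded_iff)
  then show ?thesis
    using borel_measurable_prob_measures[OF assms(1,2)] prob_measuresD(3)[OF assms(1)]
    by (intro integrable_const_bound[where B=B]) auto
qed

lemma topspace_weak_star [simp]: "topspace (weak_star Z) = prob_measures Z"
proof
  have "continuous_on Z (\<lambda>_. 0 :: real) \<and> open (UNIV :: real set)" by simp
  then have "prob_measures Z \<in> {{\<mu> \<in> prob_measures Z. (\<integral>x. g x \<partial>\<mu>) \<in> U} | g U.
        continuous_on Z (g :: 'a \<Rightarrow> real) \<and> open U}"
    by blast
  then show "prob_measures Z \<subseteq> topspace (weak_star Z)"
    unfolding weak_star_def topology_generated_by_topspace by blast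
qed (auto simp: weak_star_def)

lemma continuous_map_weak_star_integral:
  fixes g :: "'x::topological_space \<Rightarrow> real"
  assumes "continuous_on Z g"
  shows "continuous_map (weak_star Z) euclideanreal (\<lambda>\<mu>. \<integral>x. g x \<partial>\<mu>)"
  unfolding continuous_map_def
proof safe
  fix U :: "real set" assume "openin euclideanreal U"
  then have "{\<mu> \<in> prob_measures Z. (\<integral>x. g x \<partial>\<mu>) \<in> U} \<in> {{\<mu> \<in> prob_measures Z. (\<integral>x. g x \<partial>\<mu>) \<in> U} | g U.
        continuous_on Z (g :: 'x \<Rightarrow> real) \<and> open U}"
    using assms by auto
  then show "openin (weak_star Z) {x \<in> topspace (weak_star Z). (LINT x|x. g x) \<in> U}"
    unfolding topspace_weak_star unfolding weak_star_def by (rule topology_generated_by_Basis)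
qed simp

lemma continuous_map_into_weak_star:
  assumes "\<And>t. t \<in> topspace T \<Longrightarrow> h t \<in> prob_measures Z"
    and "\<And>g :: 'x::topological_space \<Rightarrow> real. continuous_on Z g \<Longrightarrow>
      continuous_map T euclideanreal (\<lambda>t. \<integral>x. g x \<partial>h t)"
  shows "continuous_map T (weak_star Z) h"
  unfolding weak_star_def
proof (rule continuous_on_generated_topo)
  fix V assume "V \<in> {{\<mu> \<in> prob_measures Z. (\<integral>x. g x \<partial>\<mu>) \<in> U} | g U.
        continuous_on Z (g :: 'x \<Rightarrow> real) \<and> open U}"
  then obtain g U where V: "V = {\<mu> \<in> prob_measures Z. (\<integral>x. g x \<partial>\<mu>) \<in> U}"
    and g: "continuous_on Z (g :: 'x \<Rightarrow> real)" "open U"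
    by auto
  have "h -` V \<inter> topspace T = {t \<in> topspace T. (\<integral>x. g x \<partial>h t) \<in> U}"
    using assms(1) V by auto
  then show "openin T (h -` V \<inter> topspace T)"
    using assms(2)[OF g(1)] g(2) by (auto simp: continuous_map_def)
next
  show "h ` topspace T \<subseteq> \<Union> {{\<mu> \<in> prob_measures Z. (\<integral>x. g x \<partial>\<mu>) \<in> U} | g U.
        continuous_on Z (g :: 'x \<Rightarrow> real) \<and> open U}"
    using assms(1) topspace_weak_star[of Z]
    unfolding weak_star_def topology_generated_by_topspace by blast
qed

section \<open>Clopen sets as test functions\<close>

lemma continuous_on_indicator_clopen:
  "clopen C \<Longrightarrow> continuous_on Z (indicator C :: 'x::t2_space \<Rightarrow> real)"
proof -
  assume "clopen C"
  then have "frontier C = {}"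
    by (simp add: clopen_def frontier_def interior_open)
  then show ?thesis
    by (intro continuous_at_imp_continuous_on ballI) (simp add: isCont_indicator)
qed

lemma continuous_map_weak_star_measure_clopen:
  fixes C :: "'x::t2_space set"
  assumes "clopen C"
  shows "continuous_map (weak_star Z) euclideanreal (\<lambda>\<mu>. measure \<mu> (C \<inter> Z))"
proof (rule continuous_map_eq[OF continuous_map_weak_star_integral[OF continuous_on_indicator_clopen[OF assms]]])
  fix \<rho> assume "\<rho> \<in> topspace (weak_star Z)"
  then have \<rho>: "\<rho> \<in> prob_measures Z" by simp
  note * = prob_measuresD[OF \<rho>]
  interpret prob_space \<rho> by (rule *)
  have "C \<inter> space \<rho> \<in> sets \<rho>"
    using borel_Int_in_prob_measures[OF \<rho> clopen_borel[OF assms]] * by simp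
  then show "(LINT x|\<rho>. indicat_real C x) = measure \<rho> (C \<inter> Z)"
    using * by (simp add: integral_indicator)
qed

lemma clopen_step_approximation:
  fixes g :: "'x::stone_space \<Rightarrow> real"
  assumes "closed Z" "continuous_on Z g" "e > 0"
  obtains n :: nat and c C where "\<And>i. clopen (C i)"
    "\<And>z. z \<in> Z \<Longrightarrow> \<bar>g z - (\<Sum>i<n. c i * indicator (C i) z)\<bar> < e"
proof -
  have "\<exists>C. clopen C \<and> z \<in> C \<and> (\<forall>y\<in>C \<inter> Z. \<bar>g y - g z\<bar> < e)" if z: "z \<in> Z" for z
  proof -
    obtain A where A: "open A" "A \<inter> Z = g -` ball (g z) e \<inter> Z"
      using continuous_on_open_invariant[of Z g] assms(2) by (metis open_ball)
    then have "z \<in> A" using z assms(3) by auto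
    then obtain C where "clopen C" "z \<in> C" "C \<subseteq> A"
      using A clopen_neighborhood by metis
    moreover from this have "\<forall>y\<in>C \<inter> Z. y \<in> g -` ball (g z) e"
      using A(2) by blast
    ultimately show ?thesis
      by (auto simp: dist_real_def abs_minus_commute)
  qed
  then obtain C where C: "\<And>z. z \<in> Z \<Longrightarrow> clopen (C z)" "\<And>z. z \<in> Z \<Longrightarrow> z \<in> C z"
      "\<And>z y. z \<in> Z \<Longrightarrow> y \<in> C z \<Longrightarrow> y \<in> Z \<Longrightarrow> \<bar>g y - g z\<bar> < e"
    by (metis IntI)
  have "\<And>z. z \<in> Z \<Longrightarrow> open (C z)" "Z \<subseteq> (\<Union>z\<in>Z. C z)"
    using C by (auto simp: clopen_def)
  then obtain F where F: "F \<subseteq> Z" "finite F" "Z \<subseteq> (\<Union>z\<in>F. C z)"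
    using compactE_image[OF closed_imp_compact[OF assms(1)]] by metis
  obtain w and n :: nat where w: "F = w ` {i. i < n}"
    using finite_imp_nat_seg_image_inj_on[OF F(2)] by auto
  \<comment> \<open>Subtracting the earlier sets makes the pieces disjoint: the only piece
    containing \<open>z\<close> is the first one, with index \<open>k\<close> below.\<close>
  define D where "D i = (if i < n then C (w i) - (\<Union>j<i. C (w j)) else {})" for i
  have wZ: "w i \<in> Z" if "i < n" for i
    using F(1) w that by auto
  have "clopen (D i)" for i
    using C(1) wZ unfolding D_def by (auto intro!: clopen_intros(3) clopen_UN)
  moreover have "\<bar>g z - (\<Sum>i<n. g (w i) * indicator (D i) z)\<bar> < e" if z: "z \<in> Z" for z
  proof -
    define k where "k = (LEAST i. i < n \<and> z \<in> C (w i))"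
    have "\<exists>i. i < n \<and> z \<in> C (w i)"
      using z F(3) w by auto
    then have k: "k < n" "z \<in> C (w k)"
      unfolding k_def by (auto dest!: LeastI_ex)
    have less: "z \<notin> C (w j)" if "j < k" for j
      using not_less_Least[OF that[unfolded k_def]] that k by auto
    have "indicator (D i) z = (if i = k then 1 else 0 :: real)" if "i < n" for i
      using k less that by (cases i k rule: linorder_cases) (auto simp: D_def indicator_def)
    then have "(\<Sum>i<n. g (w i) * indicator (D i) z) = (\<Sum>i<n. if i = k then g (w i) else 0)"
      by (intro sum.cong) auto
    also have "\<dots> = g (w k)"
      using k by simp
    finally show ?thesis
      using C(3)[OF wZ[OF k(1)] k(2) z] by simp
  qed
  ultimately show thesis by (rule that)
qed

lemma prob_measures_eqI:
  fixes Z :: "'x::stone_space set"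
  assumes "\<rho> \<in> prob_measures Z" "\<rho>' \<in> prob_measures Z"
    and eq: "\<And>C. clopen C \<Longrightarrow> measure \<rho> (C \<inter> Z) = measure \<rho>' (C \<inter> Z)"
  shows "\<rho> = \<rho>'"
proof -
  note \<rho> = prob_measuresD[OF assms(1)] and \<rho>' = prob_measuresD[OF assms(2)]
  interpret \<rho>: prob_space \<rho> by (rule \<rho>)
  interpret \<rho>': prob_space \<rho>' by (rule \<rho>')
  define G where "G = {C \<inter> Z | C. clopen C}"
  have sets: "sets (borel_on Z) = sigma_sets Z G"
    by (simp add: sets_borel_on_eq_sigma_clopen G_def)
  show ?thesis
  proof (rule measure_eqI_generator_eq[where E=G and \<Omega>=Z and A="\<lambda>_. Z"])
    show "Int_stable G"
    proof (rule Int_stableI)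
      fix A B assume "A \<in> G" "B \<in> G"
      then obtain C D where "A = C \<inter> Z" "B = D \<inter> Z" "clopen C" "clopen D"
        by (auto simp: G_def)
      then have "A \<inter> B = (C \<inter> D) \<inter> Z" "clopen (C \<inter> D)" by auto
      then show "A \<inter> B \<in> G" by (auto simp: G_def)
    qed
    show "emeasure \<rho> A = emeasure \<rho>' A" if "A \<in> G" for A
      using that eq by (auto simp: \<rho>.emeasure_eq_measure \<rho>'.emeasure_eq_measure G_def)
    show "range (\<lambda>_. Z) \<subseteq> G"
      by (auto simp: G_def intro!: exI[of _ UNIV])
  qed (use \<rho> \<rho>' sets in \<open>auto simp: G_def\<close>)
qed

lemma continuous_on_uniform_approximation:
  fixes g :: "'x::topological_space \<Rightarrow> real"
  assumes "\<And>e. e > 0 \<Longrightarrow> \<exists>h. continuous_on S h \<and> (\<forall>x\<in>S. \<bar>g x - h x\<bar> \<le> e)"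
  shows "continuous_on S g"
proof -
  have "\<exists>h. continuous_on S h \<and> (\<forall>x\<in>S. \<bar>g x - h x\<bar> \<le> 1 / real (Suc n))" for n
    using assms by simp
  then obtain h where h: "\<And>n. continuous_on S (h n)"
      "\<And>n x. x \<in> S \<Longrightarrow> \<bar>g x - h n x\<bar> \<le> 1 / real (Suc n)"
    by metis
  have "uniform_limit S h g sequentially"
  proof (rule uniform_limitI)
    fix e :: real assume "e > 0"
    then obtain N where N: "1 / real (Suc N) < e"
      using nat_approx_posE by blast
    have "dist (h n x) (g x) < e" if "n \<ge> N" "x \<in> S" for n x
    proof -
      have "1 / real (Suc n) \<le> 1 / real (Suc N)"
        using that by (intro divide_left_mono) auto
      then show ?thesis
        using h(2)[OF that(2), of n] N by (auto simp: dist_real_def)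
    qed
    then show "\<forall>\<^sub>F n in sequentially. \<forall>x\<in>S. dist (h n x) (g x) < e"
      by (auto simp: eventually_sequentially)
  qed
  then show ?thesis
    using h(1) by (intro uniform_limit_theorem[where F=sequentially and f=h]) auto
qed

text \<open>The point is uniformity in \<rho>: one finite combination of clopen measures serves all
  probability measures on \<open>Z\<close>, so continuity and affinity of integrals follow from
  those of the measures of clopen sets.\<close>

lemma integral_clopen_approximation:
  fixes g :: "'x::stone_space \<Rightarrow> real"
  assumes Z: "closed Z" and g: "continuous_on Z g" and "e > 0"
  obtains n :: nat and c C where "\<And>i. clopen (C i)"
    "\<And>\<rho>. \<rho> \<in> prob_measures Z \<Longrightarrow> \<bar>(\<integral>x. g x \<partial>\<rho>) - (\<Sum>i<n. c i * measure \<rho> (C i \<inter> Z))\<bar> \<le> e"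
proof -
  obtain n :: nat and c C where C: "\<And>i. clopen (C i)"
    and cC: "\<And>z. z \<in> Z \<Longrightarrow> \<bar>g z - (\<Sum>i<n. c i * indicator (C i) z)\<bar> < e"
    using clopen_step_approximation[OF assms] by metis
  have "\<bar>(\<integral>x. g x \<partial>\<rho>) - (\<Sum>i<n. c i * measure \<rho> (C i \<inter> Z))\<bar> \<le> e" if \<rho>: "\<rho> \<in> prob_measures Z" for \<rho>
  proof -
    note * = prob_measuresD[OF \<rho>]
    interpret prob_space \<rho> by (rule *)
    have int: "integrable \<rho> (\<lambda>x. c i * indicator (C i) x)" for i
      using C by (intro integrable_mult_right integrable_prob_measures[OF \<rho>]
          continuous_on_indicator_clopen closed_imp_compact Z)
    have "(\<Sum>i<n. c i * measure \<rho> (C i \<inter> Z)) = (\<Sum>i<n. \<integral>x. c i * indicator (C i) x \<partial>\<rho>)"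
      using * by (simp add: integral_indicator)
    also have "\<dots> = (\<integral>x. (\<Sum>i<n. c i * indicator (C i) x) \<partial>\<rho>)"
      by (rule Bochner_Integration.integral_sum[OF int, symmetric])
    finally have sum_eq: "(\<Sum>i<n. c i * measure \<rho> (C i \<inter> Z)) = (\<integral>x. (\<Sum>i<n. c i * indicator (C i) x) \<partial>\<rho>)" .
    have ints: "integrable \<rho> (\<lambda>x. \<Sum>i<n. c i * indicator (C i) x)"
      by (rule Bochner_Integration.integrable_sum[OF int])
    note intg = integrable_prob_measures[OF \<rho> g closed_imp_compact[OF Z]]
    have "\<bar>(\<integral>x. g x \<partial>\<rho>) - (\<Sum>i<n. c i * measure \<rho> (C i \<inter> Z))\<bar> =
        \<bar>\<integral>x. g x - (\<Sum>i<n. c i * indicator (C i) x) \<partial>\<rho>\<bar>"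
      unfolding sum_eq by (subst Bochner_Integration.integral_diff[OF intg ints]) (rule refl)
    also have "\<dots> \<le> (\<integral>x. e \<partial>\<rho>)"
    proof (rule order_trans[OF integral_abs_bound integral_mono])
      show "integrable \<rho> (\<lambda>x. \<bar>g x - (\<Sum>i<n. c i * indicator (C i) x)\<bar>)"
        by (rule integrable_abs[OF Bochner_Integration.integrable_diff[OF intg ints]])
      fix x assume "x \<in> space \<rho>"
      then show "\<bar>g x - (\<Sum>i<n. c i * indicator (C i) x)\<bar> \<le> e"
        using cC[of x] * by simp
    qed simp
    finally show ?thesis by (simp add: prob_space)
  qed
  with C show thesis by (rule that)
qed

text \<open>The contents on clopen sets form a closed subset of a cube, compact by Tychonoff's
  theorem. Extending contents to measures is a continuous map from this set onto the space of
  measures.\<close>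

theorem compactin_prob_measures:
  fixes Z :: "'x::stone_space set"
  assumes Z: "closed Z"
  shows "compactin (weak_star Z) (prob_measures Z)"
proof -
  \<comment> \<open>The last condition says that the extension is carried by \<open>Z\<close>, since
    the complement of \<open>Z\<close> is a countable union of clopen sets.\<close>
  define P :: "('x set \<Rightarrow> real) set" where
    "P = {v. (\<forall>C. 0 \<le> v C \<and> v C \<le> 1) \<and> v UNIV = 1 \<and>
      (\<forall>C D. clopen C \<longrightarrow> clopen D \<longrightarrow> C \<inter> D = {} \<longrightarrow> v (C \<union> D) = v C + v D) \<and>
      (\<forall>C. clopen C \<longrightarrow> C \<inter> Z = {} \<longrightarrow> v C = 0)}"
  have "compact (PiE UNIV (\<lambda>_. {0..1}) :: ('x set \<Rightarrow> real) set)"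
    using compactin_PiE[of "\<lambda>_. euclidean" UNIV "\<lambda>_. {0..1} :: real set"]
    by (simp add: euclidean_product_topology)
  moreover have "closed P"
    unfolding P_def
    by (intro closed_Collect_conj closed_Collect_all closed_Collect_imp closed_Collect_le
        closed_Collect_eq continuous_intros open_Collect_const continuous_on_product_coordinates)
  moreover have "P \<subseteq> PiE UNIV (\<lambda>_. {0..1})"
    by (auto simp: P_def PiE_iff)
  ultimately have cP: "compact P"
    using compact_Int_closed[of "PiE UNIV (\<lambda>_. {0..1})" P] by (simp add: Int_absorb1)
  have "\<exists>\<rho>\<in>prob_measures Z. \<forall>C. clopen C \<longrightarrow> measure \<rho> (C \<inter> Z) = v C" if v: "v \<in> P" for v
  proof -
    obtain m where m: "prob_space m" "sets m = sets borel" "\<And>C. clopen C \<Longrightarrow> measure m C = v C"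
    proof (rule clopen_content_extension[of v])
    qed (use v in \<open>auto simp: P_def\<close>)
    interpret m: prob_space m by fact
    have spm: "space m = UNIV" using sets_eq_imp_space_eq[OF m(2)] by simp
    have Zm: "Z \<in> sets m" using Z m(2) by simp
    obtain C :: "nat \<Rightarrow> 'x set" where C: "\<And>i. clopen (C i)" "- Z = (\<Union>i. C i)"
      using open_as_clopen_Union[of "- Z"] Z by auto
    have "C i \<in> null_sets m" for i
    proof -
      have "C i \<inter> Z = {}" using C(2) by blast
      then have "v (C i) = 0" using v C(1) by (auto simp: P_def)
      then show ?thesis
        using m C(1) by (auto simp: null_sets_def m.emeasure_eq_measure)
    qed
    then have nZ: "- Z \<in> null_sets m"
      unfolding C(2) by (rule null_sets_UN)
    have eq: "measure m (A \<inter> Z) = measure m A" if "A \<in> sets m" for A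
    proof -
      have "measure m (A - - Z) = measure m A"
        using that nZ by (rule measure_Diff_null_set)
      moreover have "A - - Z = A \<inter> Z" by blast
      ultimately show ?thesis by simp
    qed
    define \<rho> where "\<rho> = restrict_space m Z"
    have sets: "sets \<rho> = sets (borel_on Z)"
      using m(2) by (simp add: \<rho>_def sets_restrict_space)
    have meas: "measure \<rho> (A \<inter> Z) = measure m A" if "A \<in> sets m" for A
      unfolding \<rho>_def using Zm that spm eq by (subst measure_restrict_space) auto
    have "prob_space \<rho>"
    proof
      have "emeasure \<rho> (space \<rho>) = emeasure m (UNIV \<inter> Z)"
        unfolding \<rho>_def using Zm spm by (subst emeasure_restrict_space) (auto simp: space_restrict_space)
      then show "emeasure \<rho> (space \<rho>) = 1"
        using eq[of UNIV] m.prob_space spm m(2) by (simp add: m.emeasure_eq_measure)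
    qed
    then show ?thesis
      using sets meas m by (intro bexI[of _ \<rho>]) (auto simp: prob_measures_def)
  qed
  then obtain \<Psi> where \<Psi>: "\<And>v. v \<in> P \<Longrightarrow> \<Psi> v \<in> prob_measures Z"
      "\<And>v C. v \<in> P \<Longrightarrow> clopen C \<Longrightarrow> measure (\<Psi> v) (C \<inter> Z) = v C"
    by metis
  have "prob_measures Z \<subseteq> \<Psi> ` P"
  proof
    fix \<rho> assume \<rho>: "\<rho> \<in> prob_measures Z"
    note * = prob_measuresD[OF \<rho>]
    interpret prob_space \<rho> by (rule *)
    have sets: "C \<inter> Z \<in> sets \<rho>" if "clopen C" for C
      using borel_Int_in_prob_measures[OF \<rho> clopen_borel[OF that]] .
    \<comment> \<open>The extension ignores the values off the clopen sets; \<open>0\<close> merely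
      keeps \<open>v\<close> inside the cube.\<close>
    define v where "v C = (if clopen C then measure \<rho> (C \<inter> Z) else 0)" for C
    have "v \<in> P"
      unfolding P_def
    proof safe
      fix C D :: "'x set" assume CD: "clopen C" "clopen D" "C \<inter> D = {}"
      have "measure \<rho> ((C \<inter> Z) \<union> (D \<inter> Z)) = measure \<rho> (C \<inter> Z) + measure \<rho> (D \<inter> Z)"
        using CD sets by (intro finite_measure_Union) auto
      then show "v (C \<union> D) = v C + v D"
        using CD by (simp add: v_def clopen_intros Int_Un_distrib2)
    qed (use prob_space *(3) in \<open>auto simp: v_def\<close>)
    moreover have "\<Psi> v = \<rho>"
      using \<open>v \<in> P\<close> \<rho> by (intro prob_measures_eqI[OF \<Psi>(1)]) (auto simp: \<Psi>(2), simp add: v_def)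
    ultimately show "\<rho> \<in> \<Psi> ` P" by blast
  qed
  moreover have "continuous_map (top_of_set P) (weak_star Z) \<Psi>"
  proof (rule continuous_map_into_weak_star)
    fix g :: "'x \<Rightarrow> real" assume g: "continuous_on Z g"
    have "continuous_on P (\<lambda>v. \<integral>x. g x \<partial>\<Psi> v)"
    proof (rule continuous_on_uniform_approximation)
      fix e :: real assume "e > 0"
      then obtain n :: nat and c C where C: "\<And>i. clopen (C i)"
        and cC: "\<And>\<rho>. \<rho> \<in> prob_measures Z \<Longrightarrow> \<bar>(\<integral>x. g x \<partial>\<rho>) - (\<Sum>i<n. c i * measure \<rho> (C i \<inter> Z))\<bar> \<le> e"
        using integral_clopen_approximation[OF Z g] by metis
      have "\<bar>(\<integral>x. g x \<partial>\<Psi> v) - (\<Sum>i<n. c i * v (C i))\<bar> \<le> e" if "v \<in> P" for v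
        using cC[OF \<Psi>(1)[OF that]] \<Psi>(2)[OF that C] by simp
      moreover have "continuous_on P (\<lambda>v. \<Sum>i<n. c i * v (C i))"
        by (intro continuous_intros continuous_on_subset[OF continuous_on_product_coordinates]) auto
      ultimately show "\<exists>h. continuous_on P h \<and> (\<forall>v\<in>P. \<bar>(\<integral>x. g x \<partial>\<Psi> v) - h v\<bar> \<le> e)"
        by blast
    qed
    then show "continuous_map (top_of_set P) euclideanreal (\<lambda>v. \<integral>x. g x \<partial>\<Psi> v)"
      by simp
  qed (use \<Psi> in auto)
  then have "compactin (weak_star Z) (\<Psi> ` P)"
    using cP by (intro image_compactin[of "top_of_set P"]) (auto simp: compactin_subtopology)
  moreover have "\<Psi> ` P \<subseteq> prob_measures Z"
    using \<Psi>(1) by blast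
  ultimately show ?thesis
    by (simp add: subset_antisym)
qed

text \<open>An open set is null if and only if each of the countably many clopen sets that exhaust
  it is null, and each of these conditions is closed.\<close>

lemma closedin_weak_star_null_open:
  fixes Z :: "'x::stone_space set"
  assumes "open U"
  shows "closedin (weak_star Z) {\<rho> \<in> prob_measures Z. measure \<rho> (U \<inter> Z) = 0}"
proof -
  obtain C :: "nat \<Rightarrow> 'x set" where C: "\<And>i. clopen (C i)" "U = (\<Union>i. C i)"
    using open_as_clopen_Union[OF assms] by blast
  have "measure \<rho> (U \<inter> Z) = 0 \<longleftrightarrow> (\<forall>i. measure \<rho> (C i \<inter> Z) = 0)" if "\<rho> \<in> prob_measures Z" for \<rho>
  proof -
    note * = prob_measuresD[OF that]
    interpret prob_space \<rho> by (rule *)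
    have Cs: "C i \<inter> Z \<in> sets \<rho>" for i
      using that C(1) by (rule borel_Int_in_prob_measures[OF _ clopen_borel])
    have "measure \<rho> (U \<inter> Z) = 0" if "\<forall>i. measure \<rho> (C i \<inter> Z) = 0"
    proof -
      have "(\<Union>i. C i \<inter> Z) \<in> null_sets \<rho>"
        using that by (intro null_sets_UN) (auto simp: null_sets_def emeasure_eq_measure Cs)
      moreover have "(\<Union>i. C i \<inter> Z) = U \<inter> Z" using C(2) by blast
      ultimately show ?thesis by (simp add: measure_eq_0_null_sets)
    qed
    moreover have "measure \<rho> (C i \<inter> Z) \<le> measure \<rho> (U \<inter> Z)" for i
      using C(2) that assms by (intro finite_measure_mono borel_Int_in_prob_measures) auto
    ultimately show ?thesis
      by (metis measure_nonneg order_antisym)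
  qed
  then have "{\<rho> \<in> prob_measures Z. measure \<rho> (U \<inter> Z) = 0} =
      (\<Inter>i. {\<rho> \<in> topspace (weak_star Z). measure \<rho> (C i \<inter> Z) \<in> {0}})"
    by auto
  also have "closedin (weak_star Z) \<dots>"
    using closedin_continuous_map_preimage[OF continuous_map_weak_star_measure_clopen[OF C(1)], of "{0}" Z]
    by (intro closedin_Inter) auto
  finally show ?thesis .
qed

text \<open>The sets that can be approximated form a sigma-algebra. For a countable union, a finite
  part misses at most \<open>e / 2\<close>, and the other \<open>e / 2\<close> is divided among the
  members of that part.\<close>

lemma clopen_approximation:
  fixes Z :: "'x::stone_space set"
  assumes "\<rho> \<in> prob_measures Z" "A \<in> sets \<rho>" "e > 0"
  obtains C where "clopen C" "measure \<rho> (sym_diff A (C \<inter> Z)) < e"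
proof -
  note * = prob_measuresD[OF assms(1)]
  interpret prob_space \<rho> by (rule *)
  note cl = borel_Int_in_prob_measures[OF assms(1) clopen_borel]
  define G where "G = {C \<inter> Z | C. clopen C}"
  have sets: "sets \<rho> = sigma_sets Z G"
    unfolding *(2) G_def by (rule sets_borel_on_eq_sigma_clopen)
  have "A \<in> sigma_sets Z G \<Longrightarrow> \<forall>e>0. \<exists>C. clopen C \<and> measure \<rho> (sym_diff A (C \<inter> Z)) < e"
  proof (induction A rule: sigma_sets.induct)
    case (Basic A)
    then show ?case by (auto simp: G_def)
  next
    case Empty
    then show ?case by (auto intro!: exI[of _ "{}"])
  next
    case (Compl A)
    have "sym_diff (Z - A) (- C \<inter> Z) = sym_diff A (C \<inter> Z)" for C
      using Compl(1) *(3) sets sets.sets_into_space by blast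
    then show ?case
      using Compl(2) by (metis clopen_intros(4))
  next
    case (Union A)
    have As [measurable]: "A i \<in> sets \<rho>" for i
      using Union(1) sets by auto
    show ?case
    proof (intro allI impI)
      fix e :: real assume "e > 0"
      have "(\<lambda>n. measure \<rho> (\<Union>i<n. A i)) \<longlonglongrightarrow> measure \<rho> (\<Union>n. \<Union>i<n. A i)"
        by (intro finite_Lim_measure_incseq) (auto simp: incseq_def intro: less_le_trans)
      moreover have "(\<Union>n. \<Union>i<n. A i) = (\<Union>i. A i)" by blast
      ultimately have "eventually (\<lambda>n. measure \<rho> (\<Union>i. A i) - e / 2 < measure \<rho> (\<Union>i<n. A i)) sequentially"
        using \<open>e > 0\<close> by (intro order_tendstoD(1)) auto
      then obtain n where n: "measure \<rho> (\<Union>i. A i) - e / 2 < measure \<rho> (\<Union>i<n. A i)"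
        by (auto simp: eventually_sequentially)
      \<comment> \<open>\<open>Suc n\<close> instead of \<open>n\<close>, since \<open>n\<close> may
        be \<open>0\<close>.\<close>
      have "\<exists>C. clopen C \<and> measure \<rho> (sym_diff (A i) (C \<inter> Z)) < e / (2 * real (Suc n))" for i
        using Union(2)[of i] \<open>e > 0\<close> by simp
      then obtain C where C: "\<And>i. clopen (C i)"
          "\<And>i. measure \<rho> (sym_diff (A i) (C i \<inter> Z)) < e / (2 * real (Suc n))"
        by metis
      have U1: "(\<Union>i. A i) \<in> sets \<rho>" "(\<Union>i<n. A i) \<in> sets \<rho>"
        using As by auto
      have U2: "(\<Union>i<n. sym_diff (A i) (C i \<inter> Z)) \<in> sets \<rho>"
        using As cl[OF C(1)] by (intro sets.finite_UN) auto
      let ?D = "\<Union>i<n. C i"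
      have D: "clopen ?D" using C(1) by (intro clopen_UN) auto
      have "measure \<rho> (sym_diff (\<Union>i. A i) (?D \<inter> Z)) \<le>
          measure \<rho> (((\<Union>i. A i) - (\<Union>i<n. A i)) \<union> (\<Union>i<n. sym_diff (A i) (C i \<inter> Z)))"
        using U1 U2 by (intro finite_measure_mono) auto
      also have "\<dots> \<le> measure \<rho> ((\<Union>i. A i) - (\<Union>i<n. A i)) + measure \<rho> (\<Union>i<n. sym_diff (A i) (C i \<inter> Z))"
        using U1 U2 by (intro measure_Un_le) auto
      also have "measure \<rho> ((\<Union>i. A i) - (\<Union>i<n. A i)) = measure \<rho> (\<Union>i. A i) - measure \<rho> (\<Union>i<n. A i)"
        by (intro finite_measure_Diff) auto
      also have "measure \<rho> (\<Union>i<n. sym_diff (A i) (C i \<inter> Z)) \<le> (\<Sum>i<n. measure \<rho> (sym_diff (A i) (C i \<inter> Z)))"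
        using As cl[OF C(1)] by (intro measure_UNION_le) auto
      also have "\<dots> \<le> (\<Sum>i<n. e / (2 * real (Suc n)))"
        using C(2) by (intro sum_mono less_imp_le)
      also have "\<dots> \<le> e / 2"
        using \<open>e > 0\<close> by (simp add: field_simps)
      finally have "measure \<rho> (sym_diff (\<Union>i. A i) (?D \<inter> Z)) < e"
        using n by simp
      then show "\<exists>C. clopen C \<and> measure \<rho> (sym_diff (\<Union> (range A)) (C \<inter> Z)) < e"
        using D by blast
    qed
  qed
  then show thesis
    using assms(2,3) sets that by auto
qed

section \<open>Entropy of measure preserving maps\<close>

text \<open>Empty cells contribute \<open>0 * ln 0 = 0\<close>. A fixed index set \<open>K\<close>
  allows the entropies for different measures to be compared term by term.\<close>

lemma partition_entropy_eq_superset: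
  assumes "prob_space M" "simple_function M P" "finite K" "P ` space M \<subseteq> K"
  shows "partition_entropy M P =
    (\<Sum>k\<in>K. - (measure M (P -` {k} \<inter> space M) * ln (measure M (P -` {k} \<inter> space M))))"
proof -
  have "P -` {k} \<inter> space M = {}" if "k \<in> K - P ` space M" for k
    using that by auto
  then have "(\<Sum>k\<in>K. - (measure M (P -` {k} \<inter> space M) * ln (measure M (P -` {k} \<inter> space M)))) =
    (\<Sum>k\<in>P ` space M. - (measure M (P -` {k} \<inter> space M) * ln (measure M (P -` {k} \<inter> space M))))"
    using assms(3,4) by (intro sum.mono_neutral_right) auto
  then show ?thesis
    by (simp add: partition_entropy_eq[OF assms(1,2)] sum_negf)
qed

lemma neg_x_ln_x_le_1_minus:
  fixes p :: real
  assumes "0 \<le> p"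
  shows "- (p * ln p) \<le> 1 - p"
proof (cases "p = 0")
  case False
  then have "ln (1 / p) \<le> 1 / p - 1"
    using assms by (intro ln_le_minus_one) simp
  then have "p * ln (1 / p) \<le> p * (1 / p - 1)"
    using assms by (rule mult_left_mono)
  then show ?thesis
    using False assms by (simp add: ln_div algebra_simps)
qed simp

text \<open>The linear bound applied to \<open>sqrt p\<close> yields a bound that vanishes as
  \<open>p\<close> tends to \<open>0\<close>.\<close>

lemma neg_x_ln_x_le_sqrt:
  fixes p :: real
  assumes "0 \<le> p"
  shows "- (p * ln p) \<le> 2 * sqrt p"
proof (cases "p = 0")
  case False
  have "- (sqrt p * ln (sqrt p)) \<le> 1"
    using neg_x_ln_x_le_1_minus[of "sqrt p"] assms real_sqrt_ge_zero[OF assms] by linarith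
  then have "2 * sqrt p * - (sqrt p * ln (sqrt p)) \<le> 2 * sqrt p * 1"
    using assms by (intro mult_left_mono) auto
  moreover have "2 * sqrt p * - (sqrt p * ln (sqrt p)) = - ((sqrt p * sqrt p) * (2 * ln (sqrt p)))"
    by (simp add: algebra_simps)
  moreover have "sqrt p * sqrt p = p" "2 * ln (sqrt p) = ln p"
    using False assms by (auto simp: ln_sqrt)
  ultimately show ?thesis
    by (simp only: mult_1_right)
qed simp

text \<open>Both terms are compared with \<open>ln r\<close> by
  \<open>x * (ln r - ln x) \<le> r - x\<close>; the weighted errors on the right cancel by the
  choice of \<open>r\<close>.\<close>

lemma neg_x_ln_x_concave:
  fixes p q t :: real
  assumes "0 \<le> p" "0 \<le> q" "0 \<le> t" "t \<le> 1"
  defines "r \<equiv> t * p + (1 - t) * q"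
  shows "t * - (p * ln p) + (1 - t) * - (q * ln q) \<le> - (r * ln r)"
proof -
  have *: "x * (ln r - ln x) \<le> r - x" if "0 \<le> x" "0 < r" for x
  proof (cases "x = 0")
    case False
    then have "ln (r / x) \<le> r / x - 1"
      using that by (intro ln_le_minus_one) simp
    then have "x * ln (r / x) \<le> x * (r / x - 1)"
      using that by (intro mult_left_mono)
    then show ?thesis
      using False that by (simp add: ln_div algebra_simps)
  qed (use that in simp)
  have r: "0 \<le> t * p" "0 \<le> (1 - t) * q"
    using assms by auto
  show ?thesis
  proof (cases "r = 0")
    case True
    then have "t * p = 0" "(1 - t) * q = 0"
      using r by (auto simp: r_def add_nonneg_eq_0_iff)
    then have "t * - (p * ln p) = 0" "(1 - t) * - (q * ln q) = 0"
      by auto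
    moreover have "r * ln r = 0" using True by simp
    ultimately show ?thesis by linarith
  next
    case False
    then have "0 < r" using r by (simp add: r_def)
    then have "t * (p * (ln r - ln p)) \<le> t * (r - p)"
        "(1 - t) * (q * (ln r - ln q)) \<le> (1 - t) * (r - q)"
      using mult_left_mono[OF *[OF assms(1)] assms(3)] mult_left_mono[OF *[OF assms(2)], of "1 - t"] assms(4)
      by auto
    moreover have "t * (r - p) + (1 - t) * (r - q) = 0"
      by (simp add: r_def algebra_simps)
    moreover have "r * ln r = t * (p * ln r) + (1 - t) * (q * ln r)"
      by (simp add: r_def algebra_simps)
    ultimately show ?thesis
      by (simp add: algebra_simps)
  qed
qed

context prob_space
begin

lemma partition_entropy_nonneg:
  assumes "simple_function M P"
  shows "0 \<le> partition_entropy M P"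
proof -
  have "0 \<le> - (p * ln p)" if "0 \<le> p" "p \<le> 1" for p :: real
    using that by (cases "p = 0") (auto simp: mult_nonneg_nonpos)
  then show ?thesis
    unfolding partition_entropy_eq_superset[OF prob_space_axioms assms simple_functionD(1)[OF assms] order_refl]
    by (intro sum_nonneg) auto
qed

lemma information_space_exp: "information_space M (exp 1)"
  by unfold_locales simp

lemma partition_entropy_compose_le:
  assumes "simple_function M P"
  shows "partition_entropy M (\<lambda>x. g (P x)) \<le> partition_entropy M P"
  using information_space.entropy_data_processing[OF information_space_exp assms, of g]
  by (simp add: partition_entropy_def comp_def)

lemma partition_entropy_Pair_le:
  assumes "simple_function M P" "simple_function M Q"
  shows "partition_entropy M (\<lambda>x. (P x, Q x)) \<le> partition_entropy M P + partition_entropy M Q"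
  using information_space.entropy_chain_rule[OF information_space_exp assms]
    information_space.conditional_entropy_less_eq_entropy[OF information_space_exp assms(2,1)]
  by (simp add: partition_entropy_def)

lemma partition_entropy_cong:
  assumes "\<And>x. x \<in> space M \<Longrightarrow> P x = Q x" "simple_function M P"
  shows "partition_entropy M P = partition_entropy M Q"
proof -
  have "simple_function M Q"
    using assms simple_function_cong by metis
  moreover have "P ` space M = Q ` space M" "\<And>k. P -` {k} \<inter> space M = Q -` {k} \<inter> space M"
    using assms(1) by auto
  ultimately show ?thesis
    using assms(2) by (simp add: partition_entropy_eq[OF prob_space_axioms])
qed

text \<open>The large cell \<open>d\<close> contributes at most the mass that it misses, and every
  other cell has mass at most \<open>e\<close>.\<close>

lemma partition_entropy_small:
  assumes D: "simple_function M D" "D ` space M \<subseteq> insert d K" "finite K" "d \<notin> K"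
    and small: "measure M {x \<in> space M. D x \<noteq> d} \<le> e"
  shows "partition_entropy M D \<le> e + real (card K) * (2 * sqrt e)"
proof -
  let ?m = "\<lambda>k. measure M (D -` {k} \<inter> space M)"
  have [measurable]: "D -` A \<inter> space M \<in> sets M" for A
    using D(1) by (rule simple_functionD)
  have "?m d = 1 - measure M (space M - (D -` {d} \<inter> space M))"
    by (subst prob_compl) auto
  also have "space M - (D -` {d} \<inter> space M) = {x \<in> space M. D x \<noteq> d}" by auto
  finally have "1 - ?m d \<le> e" using small by simp
  then have d: "- (?m d * ln (?m d)) \<le> e"
    using neg_x_ln_x_le_1_minus[of "?m d"] by simp
  have k: "- (?m k * ln (?m k)) \<le> 2 * sqrt e" if "k \<in> K" for k
  proof -
    have "{x \<in> space M. D x \<noteq> d} = D -` (- {d}) \<inter> space M" by auto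
    then have "?m k \<le> measure M {x \<in> space M. D x \<noteq> d}"
      using that D(4) by (intro finite_measure_mono) auto
    then have "sqrt (?m k) \<le> sqrt e" using small by simp
    then show ?thesis
      using neg_x_ln_x_le_sqrt[of "?m k"] measure_nonneg[of M "D -` {k} \<inter> space M"] by linarith
  qed
  have "partition_entropy M D = - (?m d * ln (?m d)) + (\<Sum>k\<in>K. - (?m k * ln (?m k)))"
    using D by (subst partition_entropy_eq_superset[OF prob_space_axioms D(1), of "insert d K"]) auto
  also have "\<dots> \<le> e + (\<Sum>k\<in>K. 2 * sqrt e)"
    using d k by (intro add_mono sum_mono)
  finally show ?thesis by simp
qed

end

text \<open>Fekete's lemma. The infimum is as important as the convergence: it later shows the
  entropy rate to be an infimum of continuous functions of the measure.\<close>

lemma subadditive_limit: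
  fixes a :: "nat \<Rightarrow> real"
  assumes sub: "\<And>m n. a (m + n) \<le> a m + a n" and nonneg: "\<And>n. 0 \<le> a n"
  shows "(\<lambda>n. a n / real n) \<longlonglongrightarrow> (INF n\<in>{1..}. a n / real n)"
proof (rule LIMSEQ_I)
  let ?L = "INF n\<in>{1..}. a n / real n"
  have bdd: "bdd_below ((\<lambda>n. a n / real n) ` {1..})"
    using nonneg by (intro bdd_belowI[of _ 0]) auto
  have lower: "?L \<le> a n / real n" if "n \<ge> 1" for n
    using bdd that by (intro cINF_lower) auto
  have mult: "a (q * m + r) \<le> real q * a m + a r" for q m r
  proof (induction q)
    case (Suc q)
    have "a (Suc q * m + r) \<le> a m + a (q * m + r)"
      using sub[of m "q * m + r"] by (simp add: add.assoc)
    then show ?case using Suc by (simp add: algebra_simps)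
  qed simp
  fix e :: real assume e: "e > 0"
  then obtain m where m: "m \<ge> 1" "a m / real m < ?L + e / 2"
    using cINF_less_iff[OF _ bdd, of "?L + e / 2"] by auto
  \<comment> \<open>One bound for all the remainders \<open>a (n mod m)\<close>.\<close>
  define B where "B = (\<Sum>r<m. a r)"
  have B: "a r \<le> B" if "r < m" for r
    unfolding B_def using that nonneg by (intro member_le_sum) auto
  have B0: "0 \<le> B" unfolding B_def using nonneg by (intro sum_nonneg)
  obtain N :: nat where N: "B / (e / 2) < real N"
    using reals_Archimedean2 by blast
  have "norm (a n / real n - ?L) < e" if n: "n \<ge> Suc N" for n
  proof -
    have n0: "real n > 0" using n by simp
    have "a n \<le> real (n div m) * a m + a (n mod m)"
      using mult[of "n div m" m "n mod m"] by simp
    also have "\<dots> \<le> real n / real m * a m + B"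
    proof (intro add_mono mult_right_mono)
      show "real (n div m) \<le> real n / real m"
        by (rule of_nat_div_le_of_nat)
    qed (use m nonneg B in auto)
    finally have "a n / real n \<le> (real n / real m * a m + B) / real n"
      using n0 by (intro divide_right_mono) auto
    also have "\<dots> = a m / real m + B / real n"
      using n0 m(1) by (simp add: field_simps)
    also have "B / real n < e / 2"
    proof -
      have "B < real N * (e / 2)" using N e by (simp add: field_simps)
      also have "\<dots> \<le> real n * (e / 2)" using n e by (intro mult_right_mono) auto
      finally show ?thesis using n0 by (simp add: field_simps)
    qed
    finally have "a n / real n < ?L + e" using m(2) by linarith
    then show ?thesis using lower[of n] n by simp
  qed
  then show "\<exists>N. \<forall>n\<ge>N. norm (a n / real n - ?L) < e" by blast
qed

section \<open>Measure preserving maps and entropy rates\<close>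

locale measure_preserving = prob_space +
  fixes T
  assumes T_measurable [measurable]: "T \<in> measurable M M"
    and distr_T: "distr M M T = M"
begin

lemma T_space: "x \<in> space M \<Longrightarrow> T x \<in> space M"
  using measurable_space[OF T_measurable] .

lemma T_power_measurable [measurable]: "T ^^ n \<in> measurable M M"
  by (induction n) (auto simp: id_def)

lemma T_power_space: "x \<in> space M \<Longrightarrow> (T ^^ n) x \<in> space M"
  using measurable_space[OF T_power_measurable] .

lemma measure_vimage_T:
  assumes "A \<in> sets M"
  shows "measure M (T -` A \<inter> space M) = measure M A"
  using measure_distr[OF T_measurable, of A] assms distr_T by simp

lemma measure_vimage_T_power:
  assumes "A \<in> sets M"
  shows "measure M ((T ^^ n) -` A \<inter> space M) = measure M A"
proof (induction n)
  case 0
  then show ?case using assms by (simp add: sets.sets_into_space)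
next
  case (Suc n)
  have "(T ^^ Suc n) -` A \<inter> space M = T -` ((T ^^ n) -` A \<inter> space M) \<inter> space M"
    by (auto simp: funpow_swap1 T_space)
  then show ?case
    using trans[OF measure_vimage_T[OF measurable_sets[OF T_power_measurable assms]] Suc] by (simp only:)
qed

lemma simple_function_power:
  assumes "simple_function M P"
  shows "simple_function M (\<lambda>x. P ((T ^^ n) x))"
  unfolding simple_function_def
proof safe
  show "finite ((\<lambda>x. P ((T ^^ n) x)) ` space M)"
    using simple_functionD(1)[OF assms] T_power_space by (elim finite_subset[rotated]) auto
  fix x
  have "(\<lambda>x. P ((T ^^ n) x)) -` {P ((T ^^ n) x)} \<inter> space M =
      (T ^^ n) -` (P -` {P ((T ^^ n) x)} \<inter> space M) \<inter> space M"
    using T_power_space by auto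
  then show "(\<lambda>x. P ((T ^^ n) x)) -` {P ((T ^^ n) x)} \<inter> space M \<in> sets M"
    using measurable_sets[OF T_power_measurable simple_functionD(2)[OF assms]] by (simp only:)
qed

lemma partition_entropy_power:
  assumes P: "simple_function M P"
  shows "partition_entropy M (\<lambda>x. P ((T ^^ n) x)) = partition_entropy M P"
proof -
  have "(\<lambda>x. P ((T ^^ n) x)) -` {k} \<inter> space M = (T ^^ n) -` (P -` {k} \<inter> space M) \<inter> space M" for k
    using T_power_space by auto
  then have "measure M ((\<lambda>x. P ((T ^^ n) x)) -` {k} \<inter> space M) = measure M (P -` {k} \<inter> space M)" for k
    using measure_vimage_T_power[OF simple_functionD(2)[OF P]] by simp
  moreover have "(\<lambda>x. P ((T ^^ n) x)) ` space M \<subseteq> P ` space M"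
    using T_power_space by auto
  ultimately show ?thesis
    using partition_entropy_eq_superset[OF prob_space_axioms P, of "P ` space M"]
      partition_entropy_eq_superset[OF prob_space_axioms simple_function_power[OF P], of "P ` space M" n]
      simple_functionD(1)[OF P] by simp
qed

lemma itinerary_add: "itinerary T P (m + n) x = itinerary T P m x @ itinerary T P n ((T ^^ m) x)"
proof -
  have "(T ^^ i) ((T ^^ m) x) = (T ^^ (m + i)) x" for i
    by (metis add.commute comp_apply funpow_add)
  moreover have "[0..<m + n] = [0..<m] @ map (\<lambda>i. m + i) [0..<n]"
    using upt_add_eq_append[of 0 m n] map_add_upt[of m n] by (simp add: add.commute)
  ultimately show ?thesis
    by (simp add: itinerary_def comp_def)
qed

lemma simple_function_itinerary:
  assumes "simple_function M P"
  shows "simple_function M (itinerary T P n)"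
proof (induction n)
  case 0
  then show ?case by (simp add: itinerary_def)
next
  case (Suc n)
  have "simple_function M (\<lambda>x. (\<lambda>u k. u @ [k]) (itinerary T P n x) (P ((T ^^ n) x)))"
    by (intro simple_function_compose2[OF Suc simple_function_power[OF assms]])
  then show ?case by (simp add: itinerary_def)
qed

lemma partition_entropy_itinerary_add_le:
  assumes P: "simple_function M P"
  shows "partition_entropy M (itinerary T P (m + n)) \<le>
    partition_entropy M (itinerary T P m) + partition_entropy M (itinerary T P n)"
proof -
  note s = simple_function_itinerary[OF P]
  have eq: "itinerary T P (m + n) = (\<lambda>x. (\<lambda>(u, v). u @ v) (itinerary T P m x, itinerary T P n ((T ^^ m) x)))"
    by (simp add: itinerary_add fun_eq_iff)
  have "partition_entropy M (itinerary T P (m + n)) \<le>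
      partition_entropy M (\<lambda>x. (itinerary T P m x, itinerary T P n ((T ^^ m) x)))"
    unfolding eq by (rule partition_entropy_compose_le[OF simple_function_Pair[OF s simple_function_power[OF s]]])
  also have "\<dots> \<le> partition_entropy M (itinerary T P m) +
      partition_entropy M (\<lambda>x. itinerary T P n ((T ^^ m) x))"
    by (intro partition_entropy_Pair_le s simple_function_power)
  finally show ?thesis
    by (simp add: partition_entropy_power[OF s])
qed

lemma entropy_rate_limit:
  assumes P: "simple_function M P"
  shows "(\<lambda>n. partition_entropy M (itinerary T P n) / real n) \<longlonglongrightarrow> entropy_rate M T P"
    and "entropy_rate M T P = (INF n\<in>{1..}. partition_entropy M (itinerary T P n) / real n)"
proof -
  have "(\<lambda>n. partition_entropy M (itinerary T P n) / real n) \<longlonglongrightarrow>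
      (INF n\<in>{1..}. partition_entropy M (itinerary T P n) / real n)"
    by (intro subadditive_limit partition_entropy_itinerary_add_le partition_entropy_nonneg
        simple_function_itinerary P)
  moreover from this have
    "entropy_rate M T P = (INF n\<in>{1..}. partition_entropy M (itinerary T P n) / real n)"
    unfolding entropy_rate_def by (rule limI)
  ultimately show "entropy_rate M T P = (INF n\<in>{1..}. partition_entropy M (itinerary T P n) / real n)"
    "(\<lambda>n. partition_entropy M (itinerary T P n) / real n) \<longlonglongrightarrow> entropy_rate M T P"
    by simp_all
qed

lemma partition_entropy_itinerary_le:
  assumes P: "simple_function M P"
  shows "partition_entropy M (itinerary T P n) \<le> real n * partition_entropy M P"
proof (induction n)
  case 0
  have "itinerary T P 0 = (\<lambda>_. [])" by (simp add: itinerary_def fun_eq_iff)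
  then have "partition_entropy M (itinerary T P 0) = 0"
    by (subst partition_entropy_eq_superset[OF prob_space_axioms simple_function_itinerary[OF P], of "{[]}"])
      (auto simp: prob_space)
  then show ?case by simp
next
  case (Suc n)
  have "itinerary T P 1 = (\<lambda>x. [P x])" by (simp add: itinerary_def fun_eq_iff)
  then have "partition_entropy M (itinerary T P 1) \<le> partition_entropy M P"
    using partition_entropy_compose_le[OF P, of "\<lambda>k. [k]"] by simp
  then show ?case
    using partition_entropy_itinerary_add_le[OF P, of n 1] Suc by (simp add: algebra_simps)
qed

lemma partition_entropy_itinerary_Pair_le:
  assumes P: "simple_function M P" and Q: "simple_function M Q"
  shows "partition_entropy M (itinerary T (\<lambda>x. (P x, Q x)) n) \<le>
    partition_entropy M (itinerary T P n) + partition_entropy M (itinerary T Q n)"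
proof -
  note s = simple_function_itinerary[OF P] simple_function_itinerary[OF Q]
  have eq: "itinerary T (\<lambda>x. (P x, Q x)) n =
      (\<lambda>x. (\<lambda>(u, v). zip u v) (itinerary T P n x, itinerary T Q n x))"
    by (simp add: itinerary_def zip_map_map zip_same_conv_map comp_def fun_eq_iff)
  have "partition_entropy M (itinerary T (\<lambda>x. (P x, Q x)) n) \<le>
      partition_entropy M (\<lambda>x. (itinerary T P n x, itinerary T Q n x))"
    unfolding eq by (rule partition_entropy_compose_le[OF simple_function_Pair[OF s]])
  also have "\<dots> \<le> partition_entropy M (itinerary T P n) + partition_entropy M (itinerary T Q n)"
    by (intro partition_entropy_Pair_le s)
  finally show ?thesis .
qed

text \<open>The name of length \<open>n\<close> under \<open>P\<close> is determined by those under
  \<open>P'\<close> and \<open>D\<close>, and the latter costs at most \<open>n\<close> times the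
  entropy of \<open>D\<close>. The extra length \<open>c\<close> disappears after division by
  \<open>n\<close>.\<close>

lemma entropy_rate_le_approximation:
  assumes P: "simple_function M P" and P': "simple_function M P'" and D: "simple_function M D"
    and Q: "simple_function M Q"
    and dec: "\<And>x. x \<in> space M \<Longrightarrow> P x = g (P' x, D x)"
    and le: "\<And>n. partition_entropy M (itinerary T P' n) \<le> partition_entropy M (itinerary T Q (n + c))"
  shows "entropy_rate M T P \<le> entropy_rate M T Q + partition_entropy M D"
proof -
  have PD: "simple_function M (\<lambda>x. (P' x, D x))"
    using P' D by (rule simple_function_Pair)
  let ?q = "\<lambda>n. partition_entropy M (itinerary T Q n) / real n"
  have bound: "partition_entropy M (itinerary T P n) / real n \<le>
      ?q (n + c) * (1 + real c / real n) + partition_entropy M D" if "n \<ge> 1" for n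
  proof -
    have "itinerary T P n x = map g (itinerary T (\<lambda>x. (P' x, D x)) n x)" if "x \<in> space M" for x
      using dec T_power_space[OF that] by (simp add: itinerary_def)
    then have "partition_entropy M (itinerary T P n) =
        partition_entropy M (\<lambda>x. map g (itinerary T (\<lambda>x. (P' x, D x)) n x))"
      using simple_function_itinerary[OF P] by (rule partition_entropy_cong)
    also have "\<dots> \<le> partition_entropy M (itinerary T (\<lambda>x. (P' x, D x)) n)"
      by (rule partition_entropy_compose_le[OF simple_function_itinerary[OF PD]])
    also have "\<dots> \<le> partition_entropy M (itinerary T Q (n + c)) + real n * partition_entropy M D"
      using partition_entropy_itinerary_Pair_le[OF P' D, of n] le[of n]
        partition_entropy_itinerary_le[OF D, of n] by linarith
    finally have "partition_entropy M (itinerary T P n) / real n \<le>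
        (partition_entropy M (itinerary T Q (n + c)) + real n * partition_entropy M D) / real n"
      by (intro divide_right_mono) auto
    also have "\<dots> = ?q (n + c) * (1 + real c / real n) + partition_entropy M D"
    proof -
      have "1 + real c / real n = real (n + c) / real n"
        using that by (simp add: field_simps)
      moreover have "real (n + c) \<noteq> 0" using that by simp
      ultimately show ?thesis
        using that by (simp add: add_divide_distrib del: of_nat_add)
    qed
    finally show ?thesis .
  qed
  have "(\<lambda>n. ?q (n + c) * (1 + real c / real n) + partition_entropy M D)
      \<longlonglongrightarrow> entropy_rate M T Q * (1 + 0) + partition_entropy M D"
    using LIMSEQ_ignore_initial_segment[OF entropy_rate_limit(1)[OF Q], of c]
    by (intro tendsto_intros lim_const_over_n) auto
  moreover have "eventually (\<lambda>n. partition_entropy M (itinerary T P n) / real n \<le>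
      ?q (n + c) * (1 + real c / real n) + partition_entropy M D) sequentially"
    using bound by (intro eventually_sequentiallyI[of 1])
  ultimately show ?thesis
    using tendsto_le[OF trivial_limit_sequentially _ entropy_rate_limit(1)[OF P]] by fastforce
qed

end

section \<open>Recurrence\<close>

lemma (in measure_preserving) infinitely_often_sets [measurable]:
  assumes B: "B \<in> sets M"
  shows "{x \<in> space M. \<forall>m. \<exists>n\<ge>m. (T ^^ n) x \<in> B} \<in> sets M"
proof -
  have "{x \<in> space M. \<forall>m. \<exists>n\<ge>m. (T ^^ n) x \<in> B} = space M \<inter> (\<Inter>m. \<Union>n\<in>{m..}. (T ^^ n) -` B \<inter> space M)"
    by (auto simp: Bex_def)
  also have "(\<Union>n\<in>{m..}. (T ^^ n) -` B \<inter> space M) \<in> sets M" for m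
    using measurable_sets[OF T_power_measurable B] by (intro sets.countable_UN') auto
  then have "space M \<inter> (\<Inter>m. \<Union>n\<in>{m..}. (T ^^ n) -` B \<inter> space M) \<in> sets M"
    by (intro sets.Int sets.top sets.countable_INT) auto
  finally show ?thesis .
qed

text \<open>Poincare recurrence in the form of a measure inequality: the set of points that visit
  \<open>B\<close> at time \<open>m\<close> or later contains a preimage of \<open>B\<close>, of the
  same measure, and these sets decrease to the points with infinitely many visits.\<close>

lemma (in measure_preserving) measure_infinitely_often_ge:
  assumes B: "B \<in> sets M"
  shows "measure M B \<le> measure M {x \<in> space M. \<forall>m. \<exists>n\<ge>m. (T ^^ n) x \<in> B}"
proof (rule LIMSEQ_le_const)
  define U where "U m = (\<Union>n\<in>{m..}. (T ^^ n) -` B \<inter> space M)" for m :: nat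
  note Bn = measurable_sets[OF T_power_measurable B]
  have U: "U m \<in> sets M" for m
    unfolding U_def using Bn by (intro sets.countable_UN') auto
  have "(\<lambda>m. measure M (U m)) \<longlonglongrightarrow> measure M (\<Inter>m. U m)"
    using U by (intro finite_Lim_measure_decseq) (auto simp: U_def decseq_def Bex_def intro: order_trans)
  moreover have "(\<Inter>m. U m) = {x \<in> space M. \<forall>m. \<exists>n\<ge>m. (T ^^ n) x \<in> B}"
    by (auto simp: U_def Bex_def)
  ultimately show "(\<lambda>m. measure M (U m)) \<longlonglongrightarrow> measure M {x \<in> space M. \<forall>m. \<exists>n\<ge>m. (T ^^ n) x \<in> B}"
    by simp
  have "measure M B \<le> measure M (U m)" for m
  proof -
    have "measure M ((T ^^ m) -` B \<inter> space M) \<le> measure M (U m)"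
      using U by (intro finite_measure_mono) (auto simp: U_def)
    then show ?thesis by (simp add: measure_vimage_T_power[OF B])
  qed
  then show "\<exists>N. \<forall>m\<ge>N. measure M B \<le> measure M (U m)" by blast
qed

section \<open>Entropy of the shift\<close>

lemma shift_map_power: "(shift_map ^^ n) x = (\<lambda>i. x (i + int n))"
  by (induction n) (auto simp: shift_map_def fun_eq_iff algebra_simps)

lemma continuous_on_shift_map: "continuous_on S (shift_map :: (int \<Rightarrow> 'a::topological_space) \<Rightarrow> _)"
  unfolding shift_map_def
  by (intro continuous_on_coordinatewise_then_product continuous_on_subset[OF continuous_on_product_coordinates]) simp

lemma clopen_finite_coordinates:
  fixes A :: "('i::countable \<Rightarrow> 'a::alphabet) set"
  assumes "finite I" "\<And>x y. \<forall>i\<in>I. x i = y i \<Longrightarrow> x \<in> A \<longleftrightarrow> y \<in> A"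
  shows "clopen A"
proof -
  have op: "open B" if B: "\<And>x y. \<forall>i\<in>I. x i = y i \<Longrightarrow> x \<in> B \<longleftrightarrow> y \<in> B" for B :: "('i \<Rightarrow> 'a) set"
  proof (subst open_subopen, intro ballI exI conjI)
    fix x assume x: "x \<in> B"
    have "open {y. \<forall>i\<in>I. y (id i) \<in> {x i}}"
      using assms(1) by (intro product_topology_basis') (auto simp: discrete_topology_class.open_discrete)
    then show "open {y. \<forall>i\<in>I. y i = x i}" by simp
    show "{y. \<forall>i\<in>I. y i = x i} \<subseteq> B"
      using x B by blast
  qed simp
  have "open A" "open (- A)"
    using assms(2) by (auto intro!: op)
  then show ?thesis
    by (simp add: clopen_def closed_def)
qed

section \<open>Finite windows of coordinates\<close>

definition agree :: "nat \<Rightarrow> (int \<Rightarrow> 'a) \<Rightarrow> (int \<Rightarrow> 'a) \<Rightarrow> bool" where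
  "agree N x y \<longleftrightarrow> (\<forall>i. \<bar>i\<bar> \<le> int N \<longrightarrow> x i = y i)"

lemma agree_refl [simp]: "agree N x x"
  by (simp add: agree_def)

lemma agree_mono: "agree N x y \<Longrightarrow> M \<le> N \<Longrightarrow> agree M x y"
  by (auto simp: agree_def)

lemma agree_sym: "agree N x y \<Longrightarrow> agree N y x"
  by (auto simp: agree_def)

lemma agree_trans: "agree N x y \<Longrightarrow> agree N y z \<Longrightarrow> agree N x z"
  by (auto simp: agree_def)

lemma clopen_agree:
  fixes A :: "(int \<Rightarrow> 'a::alphabet) set"
  assumes "\<And>x y. agree N x y \<Longrightarrow> x \<in> A \<longleftrightarrow> y \<in> A"
  shows "clopen A"
proof (rule clopen_finite_coordinates[of "{- int N..int N}"])
  fix x y :: "int \<Rightarrow> 'a" assume "\<forall>i\<in>{- int N..int N}. x i = y i"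
  then have "agree N x y" by (auto simp: agree_def abs_le_iff)
  then show "x \<in> A \<longleftrightarrow> y \<in> A" by (rule assms)
qed simp

lemma open_contains_window:
  fixes U :: "(int \<Rightarrow> 'a::alphabet) set"
  assumes "open U" "x \<in> U"
  obtains N where "\<And>y. agree N x y \<Longrightarrow> y \<in> U"
proof -
  obtain B where B: "x \<in> PiE UNIV B" "finite {i. B i \<noteq> UNIV}" "PiE UNIV B \<subseteq> U"
    using product_topology_open_contains_basis[of "\<lambda>_. euclidean" UNIV U x] assms
    by (auto simp: open_fun_def)
  define N where "N = (\<Sum>i\<in>{i. B i \<noteq> UNIV}. nat \<bar>i\<bar>)"
  have N: "\<bar>i\<bar> \<le> int N" if "B i \<noteq> UNIV" for i
  proof -
    have "nat \<bar>i\<bar> \<le> N"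
      unfolding N_def using that B(2) by (intro member_le_sum) auto
    then show ?thesis by linarith
  qed
  have "y \<in> U" if "agree N x y" for y
  proof -
    have "y i \<in> B i" for i
    proof (cases "B i = UNIV")
      case False
      then have "y i = x i" using N that by (simp add: agree_def)
      then show ?thesis using B(1) by (simp add: PiE_iff)
    qed simp
    then show ?thesis
      using B(3) by (auto simp: PiE_iff)
  qed
  then show thesis by (rule that)
qed

text \<open>One parameter serves both as window size and as the quantity to be made uniform. By
  monotonicity the sum over a finite subcover dominates all local values.\<close>

lemma compact_uniform_window:
  fixes K :: "(int \<Rightarrow> 'a::alphabet) set"
  assumes K: "compact K" and ex: "\<And>x. x \<in> K \<Longrightarrow> \<exists>N. \<forall>y\<in>K. agree N x y \<longrightarrow> P N y"
    and mono: "\<And>M N y. y \<in> K \<Longrightarrow> M \<le> N \<Longrightarrow> P M y \<Longrightarrow> P N y"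
  obtains N where "\<And>y. y \<in> K \<Longrightarrow> P N y"
proof -
  obtain N where N: "\<And>x y. x \<in> K \<Longrightarrow> y \<in> K \<Longrightarrow> agree (N x) x y \<Longrightarrow> P (N x) y"
    using ex by metis
  have "clopen {y. agree (N x) x y}" for x
  proof (rule clopen_agree)
    show "y \<in> {y. agree (N x) x y} \<longleftrightarrow> z \<in> {y. agree (N x) x y}" if "agree (N x) y z" for y z
      using that agree_trans agree_sym by blast
  qed
  then have op: "open {y. agree (N x) x y}" for x
    by (simp add: clopen_def)
  have cov: "K \<subseteq> (\<Union>x\<in>K. {y. agree (N x) x y})" by auto
  obtain F where F: "F \<subseteq> K" "finite F" "K \<subseteq> (\<Union>x\<in>F. {y. agree (N x) x y})"
    using compactE_image[OF K op cov] by blast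
  have "P (\<Sum>x\<in>F. N x) y" if y: "y \<in> K" for y
  proof -
    obtain x where x: "x \<in> F" "agree (N x) x y"
      using F(3) y by blast
    then have "P (N x) y"
      using N[of x y] F(1) y by blast
    moreover have "N x \<le> (\<Sum>x\<in>F. N x)"
      by (rule member_le_sum[OF x(1) _ F(2)]) simp
    ultimately show ?thesis by (rule mono[OF y, rotated])
  qed
  then show thesis by (rule that)
qed

lemma clopen_window:
  fixes C :: "(int \<Rightarrow> 'a::alphabet) set"
  assumes "clopen C"
  obtains N where "\<And>x y. agree N x y \<Longrightarrow> x \<in> C \<longleftrightarrow> y \<in> C"
proof -
  have "\<exists>N. \<forall>y\<in>UNIV. agree N x y \<longrightarrow> (\<forall>z. agree N y z \<longrightarrow> (y \<in> C \<longleftrightarrow> z \<in> C))" for x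
  proof -
    have "open (if x \<in> C then C else - C)" "x \<in> (if x \<in> C then C else - C)"
      using assms by (auto simp: clopen_def)
    then obtain N where "\<And>y. agree N x y \<Longrightarrow> y \<in> (if x \<in> C then C else - C)"
      by (rule open_contains_window) blast
    then show ?thesis
      by (intro exI[of _ N]) (metis Compl_iff agree_trans)
  qed
  then obtain N where "\<And>y. y \<in> UNIV \<Longrightarrow> \<forall>z. agree N y z \<longrightarrow> (y \<in> C \<longleftrightarrow> z \<in> C)"
    by (rule compact_uniform_window[OF compact_stone_space]) (use agree_mono in blast)+
  then show thesis
    by (intro that[of N]) blast
qed

lemma simple_function_agree:
  fixes g :: "(int \<Rightarrow> 'a::alphabet) \<Rightarrow> 'c"
  assumes \<mu>: "\<mu> \<in> prob_measures X" and g: "\<And>x y. agree N x y \<Longrightarrow> g x = g y"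
  shows "simple_function \<mu> g"
  unfolding simple_function_def
proof safe
  let ?F = "PiE {- int N..int N} (\<lambda>_. UNIV :: 'a set)"
  have "g x \<in> g ` ?F" for x
  proof (rule image_eqI)
    show "g x = g (restrict x {- int N..int N})"
      by (rule g) (auto simp: agree_def)
  qed simp
  then have "range g \<subseteq> g ` ?F" by blast
  moreover have "finite ?F" by (intro finite_PiE) auto
  ultimately have "finite (range g)" using finite_surj by blast
  then show "finite (g ` space \<mu>)" by (rule finite_subset[rotated]) auto
  fix x
  have "clopen (g -` {g x})"
    using g by (intro clopen_agree[of N]) auto
  then show "g -` {g x} \<inter> space \<mu> \<in> sets \<mu>"
    using borel_Int_in_prob_measures[OF \<mu> clopen_borel] prob_measuresD(3)[OF \<mu>] by simp
qed

lemma shift_space_shift: "shift_space X \<Longrightarrow> x \<in> X \<Longrightarrow> shift_map x \<in> X"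
  by (auto simp: shift_space_def)

lemma shift_measurable:
  "shift_space X \<Longrightarrow> shift_map \<in> measurable (borel_on X) (borel_on X)"
  by (intro measurable_restrict_space3 borel_measurable_continuous_onI continuous_on_shift_map)
    (auto dest: shift_space_shift)

lemma invariant_measuresD:
  assumes "\<mu> \<in> invariant_measures X"
  shows "\<mu> \<in> prob_measures X" "sets \<mu> = sets (borel_on X)" "space \<mu> = X"
  using assms prob_measuresD[of \<mu> X] by (auto simp: invariant_measures_def)

lemma invariant_imp_measure_preserving:
  assumes X: "shift_space X" and \<mu>: "\<mu> \<in> invariant_measures X"
  shows "measure_preserving \<mu> shift_map"
proof -
  interpret prob_space \<mu>
    using prob_measuresD(1)[OF invariant_measuresD(1)[OF \<mu>]] .
  have "shift_map \<in> measurable \<mu> \<mu>"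
    using shift_measurable[OF X] invariant_measuresD(2)[OF \<mu>] by (simp cong: measurable_cong_sets)
  moreover have "distr \<mu> \<mu> shift_map = distr \<mu> (borel_on X) shift_map"
    using invariant_measuresD(2)[OF \<mu>] by (intro distr_cong) auto
  ultimately show ?thesis
    using \<mu> by unfold_locales (auto simp: invariant_measures_def)
qed

lemma (in measure_preserving) entropy_rate_compose_le:
  assumes P: "simple_function M P"
  shows "entropy_rate M T (\<lambda>x. g (P x)) \<le> entropy_rate M T P"
proof (rule tendsto_le[OF trivial_limit_sequentially entropy_rate_limit(1)[OF P]])
  show "(\<lambda>n. partition_entropy M (itinerary T (\<lambda>x. g (P x)) n) / real n)
      \<longlonglongrightarrow> entropy_rate M T (\<lambda>x. g (P x))"
    using simple_function_compose[OF P, of g] by (intro entropy_rate_limit) (simp add: comp_def)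
  have "itinerary T (\<lambda>x. g (P x)) n = (\<lambda>x. map g (itinerary T P n x))" for n
    by (simp add: itinerary_def fun_eq_iff)
  then show "\<forall>\<^sub>F n in sequentially. partition_entropy M (itinerary T (\<lambda>x. g (P x)) n) / real n
      \<le> partition_entropy M (itinerary T P n) / real n"
    using partition_entropy_compose_le[OF simple_function_itinerary[OF P]]
    by (intro always_eventually allI divide_right_mono) auto
qed

lemma itinerary_coordinate: "itinerary shift_map (\<lambda>x. x 0) n x = map (\<lambda>i. x (int i)) [0..<n]"
  by (simp add: itinerary_def shift_map_power)

lemma simple_function_coordinate:
  fixes \<mu> :: "(int \<Rightarrow> 'a::alphabet) measure"
  assumes "\<mu> \<in> prob_measures X"
  shows "simple_function \<mu> (\<lambda>x. x 0)"
  by (rule simple_function_agree[OF assms, of 0]) (auto simp: agree_def)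

text \<open>The name of length \<open>n\<close> under \<open>P\<close> depends on the coordinates
  from \<open>- N\<close> to \<open>n - 1 + N\<close>. Translating by \<open>N\<close> preserves its
  entropy by invariance and makes these coordinates nonnegative; \<open>G\<close> then decodes the
  name from the symbols read.\<close>

lemma partition_entropy_itinerary_agree_le:
  fixes P :: "(int \<Rightarrow> 'a::alphabet) \<Rightarrow> 'c"
  assumes X: "shift_space X" and \<mu>: "\<mu> \<in> invariant_measures X"
    and P: "\<And>x y. agree N x y \<Longrightarrow> P x = P y"
  shows "partition_entropy \<mu> (itinerary shift_map P n) \<le>
    partition_entropy \<mu> (itinerary shift_map (\<lambda>x. x 0) (n + (2 * N + 1)))"
proof -
  interpret measure_preserving \<mu> shift_map
    by (rule invariant_imp_measure_preserving[OF X \<mu>])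
  note sP = simple_function_agree[OF invariant_measuresD(1)[OF \<mu>] P]
  note sQ = simple_function_coordinate[OF invariant_measuresD(1)[OF \<mu>]]
  define G where "G L = map (\<lambda>i. P (\<lambda>j. L ! nat (j + int N + int i))) [0..<n]" for L
  have "itinerary shift_map P n ((shift_map ^^ N) x) =
      G (itinerary shift_map (\<lambda>x. x 0) (n + (2 * N + 1)) x)" for x
  proof -
    have "P (\<lambda>j. x (j + int i + int N)) = P (\<lambda>j. map (\<lambda>i. x (int i)) [0..<n + (2 * N + 1)] ! nat (j + int N + int i))"
      if "i < n" for i
    proof (rule P, unfold agree_def, intro allI impI)
      fix j assume j: "\<bar>j\<bar> \<le> int N"
      then have "nat (j + int N + int i) < n + (2 * N + 1)" "0 \<le> j + int N + int i"
        using that by linarith+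
      then show "x (j + int i + int N) = map (\<lambda>i. x (int i)) [0..<n + (2 * N + 1)] ! nat (j + int N + int i)"
        using j by (simp add: algebra_simps del: upt_Suc)
    qed
    then show ?thesis
      unfolding G_def itinerary_coordinate unfolding itinerary_def shift_map_power
      by (simp add: algebra_simps del: upt_Suc)
  qed
  then have "partition_entropy \<mu> (\<lambda>x. itinerary shift_map P n ((shift_map ^^ N) x)) \<le>
      partition_entropy \<mu> (itinerary shift_map (\<lambda>x. x 0) (n + (2 * N + 1)))"
    using partition_entropy_compose_le[OF simple_function_itinerary[OF sQ]] by simp
  then show ?thesis
    by (simp add: partition_entropy_power[OF simple_function_itinerary[OF sP]])
qed

text \<open>A partition \<^term>\<open>P\<close> is approximated by a partition \<^term>\<open>P'\<close>
  into cylinders, and is recovered from \<^term>\<open>P'\<close> and a partition \<^term>\<open>D\<close> of small entropy recording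
  the value of \<^term>\<open>P\<close> where the two differ.\<close>

lemma entropy_rate_le_coordinate:
  fixes P :: "(int \<Rightarrow> 'a::alphabet) \<Rightarrow> nat"
  assumes X: "shift_space X" and \<mu>: "\<mu> \<in> invariant_measures X" and P: "simple_function \<mu> P"
  shows "entropy_rate \<mu> shift_map P \<le> entropy_rate \<mu> shift_map (\<lambda>x. x 0)"
proof -
  interpret measure_preserving \<mu> shift_map
    by (rule invariant_imp_measure_preserving[OF X \<mu>])
  note p = invariant_measuresD[OF \<mu>]
  define R where "R = P ` X"
  have R: "finite R" using simple_functionD(1)[OF P] p(3) by (simp add: R_def)
  have Pk: "P -` {k} \<inter> X \<in> sets \<mu>" for k
    using simple_functionD(2)[OF P, of "{k}"] p(3) by simp
  have bound: "entropy_rate \<mu> shift_map P \<le>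
      entropy_rate \<mu> shift_map (\<lambda>x. x 0) + (e + real (card R) * (2 * sqrt e))" if e: "e > 0" for e
  proof -
    \<comment> \<open>The errors of the at most \<open>card R\<close> cells add up to at most
      \<open>e\<close>; \<open>Suc\<close> excludes division by zero.\<close>
    define d where "d = e / real (Suc (card R))"
    have d: "d > 0" "real (card R) * d \<le> e"
      using e by (auto simp: d_def field_simps)
    have "\<exists>C. clopen C \<and> measure \<mu> (sym_diff (P -` {k} \<inter> X) (C \<inter> X)) < d" for k
      using clopen_approximation[OF p(1) Pk d(1)] by blast
    then obtain C where C: "\<And>k. clopen (C k)"
        "\<And>k. measure \<mu> (sym_diff (P -` {k} \<inter> X) (C k \<inter> X)) < d"
      by metis
    have "\<exists>N. \<forall>x y. agree N x y \<longrightarrow> (x \<in> C k \<longleftrightarrow> y \<in> C k)" for k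
      using clopen_window[OF C(1)] by metis
    then obtain W where W: "\<And>k x y. agree (W k) x y \<Longrightarrow> x \<in> C k \<longleftrightarrow> y \<in> C k"
      by metis
    define N where "N = (\<Sum>k\<in>R. W k)"
    have N: "x \<in> C k \<longleftrightarrow> y \<in> C k" if "agree N x y" "k \<in> R" for k x y
      using W[OF agree_mono[OF that(1)], of k] member_le_sum[of k R W] R that(2) by (simp add: N_def)
    \<comment> \<open>Off the error sets \<open>P x\<close> is the only candidate, so that
      \<open>LEAST\<close> finds it. Elsewhere its value does not matter, because \<open>D\<close>
      records \<open>P x\<close> as \<open>Suc (P x)\<close>, with \<open>0\<close> for
      agreement.\<close>
    define P' where "P' x = (LEAST k. k \<in> R \<and> x \<in> C k)" for x
    define D where "D x = (if P x = P' x then 0 else Suc (P x))" for x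
    have P': "P' x = P' y" if "agree N x y" for x y
    proof -
      have "(\<lambda>k. k \<in> R \<and> x \<in> C k) = (\<lambda>k. k \<in> R \<and> y \<in> C k)"
        using N[OF that] by auto
      then show ?thesis by (simp add: P'_def)
    qed
    have sP': "simple_function \<mu> P'"
      by (rule simple_function_agree[OF p(1) P'])
    have sD: "simple_function \<mu> D"
      using simple_function_compose2[OF P sP', of "\<lambda>k k'. if k = k' then 0 else Suc k"]
      by (simp add: D_def[abs_def])
    have sym: "sym_diff (P -` {k} \<inter> X) (C k \<inter> X) \<in> sets \<mu>" for k
      using Pk borel_Int_in_prob_measures[OF p(1) clopen_borel[OF C(1)]] by auto
    have sub: "{x \<in> space \<mu>. D x \<noteq> 0} \<subseteq> (\<Union>k\<in>R. sym_diff (P -` {k} \<inter> X) (C k \<inter> X))"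
    proof
      fix x assume "x \<in> {x \<in> space \<mu>. D x \<noteq> 0}"
      then have x: "x \<in> X" "P x \<noteq> P' x" using p(3) by (auto simp: D_def split: if_splits)
      show "x \<in> (\<Union>k\<in>R. sym_diff (P -` {k} \<inter> X) (C k \<inter> X))"
      proof (rule ccontr)
        assume "x \<notin> (\<Union>k\<in>R. sym_diff (P -` {k} \<inter> X) (C k \<inter> X))"
        then have "x \<in> C k \<longleftrightarrow> P x = k" if "k \<in> R" for k
          using that x(1) by blast
        moreover have "P x \<in> R" using x(1) by (simp add: R_def)
        ultimately have "(k \<in> R \<and> x \<in> C k) = (k = P x)" for k
          by blast
        then have "P' x = P x"
          unfolding P'_def by (simp add: Least_equality)
        then show False using x(2) by simp
      qed
    qed
    have "measure \<mu> {x \<in> space \<mu>. D x \<noteq> 0} \<le> measure \<mu> (\<Union>k\<in>R. sym_diff (P -` {k} \<inter> X) (C k \<inter> X))"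
      using sub sym R by (intro finite_measure_mono sets.finite_UN) auto
    also have "\<dots> \<le> (\<Sum>k\<in>R. measure \<mu> (sym_diff (P -` {k} \<inter> X) (C k \<inter> X)))"
      using R sym by (intro measure_UNION_le) auto
    also have "\<dots> \<le> (\<Sum>k\<in>R. d)"
      using C(2) by (intro sum_mono less_imp_le)
    also have "\<dots> \<le> e" using d(2) by simp
    finally have "measure \<mu> {x \<in> space \<mu>. D x \<noteq> 0} \<le> e" .
    moreover have "D ` space \<mu> \<subseteq> insert 0 (Suc ` R)"
      using p(3) by (auto simp: D_def R_def)
    ultimately have "partition_entropy \<mu> D \<le> e + real (card (Suc ` R)) * (2 * sqrt e)"
      using R by (intro partition_entropy_small[OF sD]) auto
    moreover have "card (Suc ` R) = card R" by (simp add: card_image)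
    moreover have "entropy_rate \<mu> shift_map P \<le> entropy_rate \<mu> shift_map (\<lambda>x. x 0) + partition_entropy \<mu> D"
    proof (rule entropy_rate_le_approximation[OF P sP' sD simple_function_coordinate[OF p(1)]])
      show "P x = (\<lambda>(k', d). if d = 0 then k' else d - 1) (P' x, D x)" for x
        by (simp add: D_def)
    qed (rule partition_entropy_itinerary_agree_le[OF X \<mu> P'])
    ultimately show ?thesis by simp
  qed
  have "(\<lambda>n. entropy_rate \<mu> shift_map (\<lambda>x. x 0) +
      (inverse (real (Suc n)) + real (card R) * (2 * sqrt (inverse (real (Suc n))))))
      \<longlonglongrightarrow> entropy_rate \<mu> shift_map (\<lambda>x. x 0) + (0 + real (card R) * (2 * sqrt 0))"
    by (intro tendsto_intros LIMSEQ_inverse_real_of_nat)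
  then have "entropy_rate \<mu> shift_map P \<le>
      entropy_rate \<mu> shift_map (\<lambda>x. x 0) + (0 + real (card R) * (2 * sqrt 0))"
    by (rule LIMSEQ_le_const) (use bound in auto)
  then show ?thesis by simp
qed

text \<open>The Kolmogorov-Sinai theorem for the generating partition by the coordinate at time
  \<open>0\<close>. In particular the entropy is finite and is the limit of entropies of clopen
  partitions.\<close>

theorem ks_entropy_shift:
  fixes \<mu> :: "(int \<Rightarrow> 'a::alphabet) measure"
  assumes X: "shift_space X" and \<mu>: "\<mu> \<in> invariant_measures X"
  shows "ks_entropy \<mu> shift_map = ereal (entropy_rate \<mu> shift_map (\<lambda>x. x 0))"
proof (rule antisym)
  show "ks_entropy \<mu> shift_map \<le> ereal (entropy_rate \<mu> shift_map (\<lambda>x. x 0))"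
    unfolding ks_entropy_def using entropy_rate_le_coordinate[OF X \<mu>] by (intro SUP_least) auto
  interpret measure_preserving \<mu> shift_map
    by (rule invariant_imp_measure_preserving[OF X \<mu>])
  note s = simple_function_coordinate[OF invariant_measuresD(1)[OF \<mu>]]
  \<comment> \<open>The supremum runs over partitions with values in \<open>nat\<close>, so the
    symbols are coded as numbers.\<close>
  obtain c :: "'a \<Rightarrow> nat" where c: "inj c"
    using finite_imp_inj_to_nat_seg[OF finite[of "UNIV :: 'a set"]] by blast
  have sc: "simple_function \<mu> (\<lambda>x. c (x 0))"
    using simple_function_compose[OF s, of c] by (simp add: comp_def)
  have "entropy_rate \<mu> shift_map (\<lambda>x. x 0) \<le> entropy_rate \<mu> shift_map (\<lambda>x. c (x 0))"
    using entropy_rate_compose_le[OF sc, of "inv c"] c by simp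
  moreover have "ereal (entropy_rate \<mu> shift_map (\<lambda>x. c (x 0))) \<le> ks_entropy \<mu> shift_map"
    unfolding ks_entropy_def using sc by (intro SUP_upper) simp
  ultimately show "ereal (entropy_rate \<mu> shift_map (\<lambda>x. x 0)) \<le> ks_entropy \<mu> shift_map"
    using order_trans ereal_less_eq(3) by blast
qed

section \<open>Images and mixtures of measures\<close>

lemma measurable_prob_measures:
  assumes "\<rho> \<in> prob_measures Z" "continuous_on Z h" "h ` Z \<subseteq> Z'"
  shows "h \<in> measurable \<rho> (borel_on Z')"
proof -
  have "h \<in> measurable (borel_on Z) (borel_on Z')"
    using assms(3) borel_measurable_continuous_on_restrict[OF assms(2)]
    by (intro measurable_restrict_space2) (auto simp: space_restrict_space)
  then show ?thesis
    using prob_measuresD(2)[OF assms(1)] by (simp cong: measurable_cong_sets)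
qed

lemma distr_in_prob_measures:
  assumes "\<rho> \<in> prob_measures Z" "continuous_on Z h" "h ` Z \<subseteq> Z'"
  shows "distr \<rho> (borel_on Z') h \<in> prob_measures Z'"
  using prob_space.prob_space_distr[OF prob_measuresD(1)[OF assms(1)] measurable_prob_measures[OF assms]]
  by (simp add: prob_measures_def)

lemma integral_distr_prob_measures:
  fixes g :: "_ \<Rightarrow> real"
  assumes "\<rho> \<in> prob_measures Z" "continuous_on Z h" "h ` Z \<subseteq> Z'" "continuous_on Z' g"
  shows "(\<integral>x. g x \<partial>distr \<rho> (borel_on Z') h) = (\<integral>x. g (h x) \<partial>\<rho>)"
  using measurable_prob_measures[OF assms(1-3)] borel_measurable_continuous_on_restrict[OF assms(4)]
  by (rule integral_distr)

lemma continuous_map_weak_star_distr: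
  assumes h: "continuous_on Z h" "h ` Z \<subseteq> Z'"
  shows "continuous_map (weak_star Z) (weak_star Z') (\<lambda>\<rho>. distr \<rho> (borel_on Z') h)"
proof (rule continuous_map_into_weak_star)
  fix g :: "_ \<Rightarrow> real" assume g: "continuous_on Z' g"
  have "continuous_on Z (\<lambda>x. g (h x))"
    using continuous_on_compose2[OF g h] .
  then show "continuous_map (weak_star Z) euclideanreal (\<lambda>\<rho>. \<integral>x. g x \<partial>distr \<rho> (borel_on Z') h)"
    by (rule continuous_map_eq[OF continuous_map_weak_star_integral])
      (simp add: integral_distr_prob_measures[OF _ h g])
qed (use distr_in_prob_measures[OF _ h] in auto)

section \<open>Convex combinations of measures\<close>

lemma sets_mixture [simp]: "sets (mixture t \<mu> \<nu>) = sets \<mu>"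
  by (simp add: mixture_def)

lemma space_mixture [simp]: "space (mixture t \<mu> \<nu>) = space \<mu>"
  by (simp add: mixture_def)

lemma measure_mixture:
  assumes \<mu>: "\<mu> \<in> prob_measures X" and \<nu>: "\<nu> \<in> prob_measures X" and t: "t \<in> {0..1}"
    and A: "A \<in> sets \<mu>"
  shows "measure (mixture t \<mu> \<nu>) A = t * measure \<mu> A + (1 - t) * measure \<nu> A"
proof -
  interpret \<mu>: prob_space \<mu> by (rule prob_measuresD[OF \<mu>])
  interpret \<nu>: prob_space \<nu> by (rule prob_measuresD[OF \<nu>])
  have "sets \<nu> = sets \<mu>"
    using prob_measuresD(2)[OF \<mu>] prob_measuresD(2)[OF \<nu>] by simp
  then have "emeasure (mixture t \<mu> \<nu>) A = ennreal (t * measure \<mu> A + (1 - t) * measure \<nu> A)"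
    using t A by (simp add: emeasure_mixture \<mu>.emeasure_eq_measure \<nu>.emeasure_eq_measure ennreal_mult ennreal_plus)
  then show ?thesis
    using t by (simp add: measure_def[of "mixture t \<mu> \<nu>"] del: ennreal_plus)
qed

lemma mixture_in_prob_measures:
  assumes \<mu>: "\<mu> \<in> prob_measures X" and \<nu>: "\<nu> \<in> prob_measures X" and t: "t \<in> {0..1}"
  shows "mixture t \<mu> \<nu> \<in> prob_measures X"
proof -
  interpret \<mu>: prob_space \<mu> by (rule prob_measuresD[OF \<mu>])
  interpret \<nu>: prob_space \<nu> by (rule prob_measuresD[OF \<nu>])
  have "sets \<nu> = sets \<mu>" "space \<nu> = space \<mu>"
    using prob_measuresD[OF \<mu>] prob_measuresD[OF \<nu>] by simp_all
  then have "emeasure (mixture t \<mu> \<nu>) (space \<mu>) = ennreal t + ennreal (1 - t)"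
    using \<nu>.emeasure_space_1 by (simp add: emeasure_mixture \<mu>.emeasure_space_1)
  also have "\<dots> = 1"
    using t by (simp flip: ennreal_plus)
  finally show ?thesis
    using prob_measuresD[OF \<mu>] by (auto simp: prob_measures_def intro!: prob_spaceI)
qed

lemma mixture_same:
  assumes "\<mu> \<in> prob_measures X" "t \<in> {0..1}"
  shows "mixture t \<mu> \<mu> = \<mu>"
proof (rule measure_eqI)
  fix A assume "A \<in> sets (mixture t \<mu> \<mu>)"
  then have "emeasure (mixture t \<mu> \<mu>) A = (ennreal t + ennreal (1 - t)) * emeasure \<mu> A"
    by (simp add: emeasure_mixture distrib_right)
  also have "ennreal t + ennreal (1 - t) = 1"
    using assms(2) by (simp flip: ennreal_plus)
  finally show "emeasure (mixture t \<mu> \<mu>) A = emeasure \<mu> A" by simp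
qed simp

lemma distr_mixture:
  assumes \<mu>: "\<mu> \<in> prob_measures X" and \<nu>: "\<nu> \<in> prob_measures X" and h: "h \<in> measurable \<mu> N"
  shows "distr (mixture t \<mu> \<nu>) N h = mixture t (distr \<mu> N h) (distr \<nu> N h)"
proof (rule measure_eqI)
  fix A assume "A \<in> sets (distr (mixture t \<mu> \<nu>) N h)"
  then have A: "A \<in> sets N" by simp
  have eq: "sets \<nu> = sets \<mu>" "space \<nu> = space \<mu>"
    using prob_measuresD[OF \<mu>] prob_measuresD[OF \<nu>] by simp_all
  have "h \<in> measurable \<nu> N" "h \<in> measurable (mixture t \<mu> \<nu>) N"
    using h eq by (simp_all cong: measurable_cong_sets)
  then show "emeasure (distr (mixture t \<mu> \<nu>) N h) A = emeasure (mixture t (distr \<mu> N h) (distr \<nu> N h)) A"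
    using h A eq by (simp add: emeasure_distr emeasure_mixture measurable_sets)
qed simp

lemma mixture_invariant:
  assumes X: "shift_space X" and \<mu>: "\<mu> \<in> invariant_measures X" and \<nu>: "\<nu> \<in> invariant_measures X"
    and t: "t \<in> {0..1}"
  shows "mixture t \<mu> \<nu> \<in> invariant_measures X"
proof -
  note p = invariant_measuresD(1)[OF \<mu>] invariant_measuresD(1)[OF \<nu>]
  have "shift_map \<in> measurable \<mu> (borel_on X)"
    using shift_measurable[OF X] invariant_measuresD(2)[OF \<mu>] by (simp cong: measurable_cong_sets)
  then have "distr (mixture t \<mu> \<nu>) (borel_on X) shift_map = mixture t \<mu> \<nu>"
    using \<mu> \<nu> by (simp add: distr_mixture[OF p] invariant_measures_def)
  then show ?thesis
    using mixture_in_prob_measures[OF p t] by (simp add: invariant_measures_def)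
qed

text \<open>For clopen sets this is \<open>measure_mixture\<close>. The uniform approximation
  carries it over, with error \<open>e\<close> on each side.\<close>

lemma integral_mixture:
  fixes g :: "'x::stone_space \<Rightarrow> real"
  assumes X: "closed X" and \<mu>: "\<mu> \<in> prob_measures X" and \<nu>: "\<nu> \<in> prob_measures X" and t: "t \<in> {0..1}"
    and g: "continuous_on X g"
  shows "(\<integral>x. g x \<partial>mixture t \<mu> \<nu>) = t * (\<integral>x. g x \<partial>\<mu>) + (1 - t) * (\<integral>x. g x \<partial>\<nu>)"
proof -
  have bound: "\<bar>(\<integral>x. g x \<partial>mixture t \<mu> \<nu>) - (t * (\<integral>x. g x \<partial>\<mu>) + (1 - t) * (\<integral>x. g x \<partial>\<nu>))\<bar> \<le> 2 * e"
    if e: "e > 0" for e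
  proof -
    obtain n :: nat and c C where C: "\<And>i. clopen (C i)"
      and approx: "\<And>\<rho>. \<rho> \<in> prob_measures X \<Longrightarrow>
        \<bar>(\<integral>x. g x \<partial>\<rho>) - (\<Sum>i<n. c i * measure \<rho> (C i \<inter> X))\<bar> \<le> e"
      using integral_clopen_approximation[OF X g e] by metis
    note mm = measure_mixture[OF \<mu> \<nu> t borel_Int_in_prob_measures[OF \<mu> clopen_borel[OF C]]]
    have "(\<Sum>i<n. c i * measure (mixture t \<mu> \<nu>) (C i \<inter> X)) =
        (\<Sum>i<n. t * (c i * measure \<mu> (C i \<inter> X)) + (1 - t) * (c i * measure \<nu> (C i \<inter> X)))"
      by (intro sum.cong refl) (simp add: mm algebra_simps)
    also have "\<dots> = t * (\<Sum>i<n. c i * measure \<mu> (C i \<inter> X)) + (1 - t) * (\<Sum>i<n. c i * measure \<nu> (C i \<inter> X))"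
      by (simp add: sum.distrib sum_distrib_left)
    finally have eq: "(\<Sum>i<n. c i * measure (mixture t \<mu> \<nu>) (C i \<inter> X)) = \<dots>" .
    have "\<bar>t * ((\<integral>x. g x \<partial>\<mu>) - (\<Sum>i<n. c i * measure \<mu> (C i \<inter> X)))\<bar> \<le> t * e"
      using mult_left_mono[OF approx[OF \<mu>], of t] t by (simp add: abs_mult)
    moreover have "\<bar>(1 - t) * ((\<integral>x. g x \<partial>\<nu>) - (\<Sum>i<n. c i * measure \<nu> (C i \<inter> X)))\<bar> \<le> (1 - t) * e"
      using mult_left_mono[OF approx[OF \<nu>], of "1 - t"] t by (simp add: abs_mult)
    moreover have "t * e + (1 - t) * e = e" by (simp add: algebra_simps)
    ultimately show ?thesis
      using approx[OF mixture_in_prob_measures[OF \<mu> \<nu> t]] unfolding eq right_diff_distrib by linarith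
  qed
  have "\<bar>(\<integral>x. g x \<partial>mixture t \<mu> \<nu>) - (t * (\<integral>x. g x \<partial>\<mu>) + (1 - t) * (\<integral>x. g x \<partial>\<nu>))\<bar> \<le> 0"
  proof (rule field_le_epsilon)
    fix e :: real assume "e > 0"
    then show "\<bar>(\<integral>x. g x \<partial>mixture t \<mu> \<nu>) - (t * (\<integral>x. g x \<partial>\<mu>) + (1 - t) * (\<integral>x. g x \<partial>\<nu>))\<bar> \<le> 0 + e"
      using bound[of "e / 2"] by linarith
  qed
  then show ?thesis by simp
qed

text \<open>All three entropies are sums over the same cells, so concavity of
  \<open>- (x * ln x)\<close> applies term by term.\<close>

lemma partition_entropy_mixture:
  assumes \<mu>: "\<mu> \<in> prob_measures X" and \<nu>: "\<nu> \<in> prob_measures X" and t: "t \<in> {0..1}"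
    and P: "simple_function \<mu> P"
  shows "t * partition_entropy \<mu> P + (1 - t) * partition_entropy \<nu> P \<le>
    partition_entropy (mixture t \<mu> \<nu>) P"
proof -
  note m = mixture_in_prob_measures[OF \<mu> \<nu> t]
  have eq: "sets \<nu> = sets \<mu>" "space \<nu> = space \<mu>"
    using prob_measuresD[OF \<mu>] prob_measuresD[OF \<nu>] by simp_all
  let ?K = "P ` space \<mu>"
  let ?m = "\<lambda>\<rho> k. measure \<rho> (P -` {k} \<inter> space \<mu>)"
  have fin: "finite ?K" using simple_functionD(1)[OF P] .
  have H: "partition_entropy \<rho> P = (\<Sum>k\<in>?K. - (?m \<rho> k * ln (?m \<rho> k)))"
    if "\<rho> \<in> prob_measures X" "sets \<rho> = sets \<mu>" "space \<rho> = space \<mu>" for \<rho>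
    using partition_entropy_eq_superset[OF prob_measuresD(1)[OF that(1)] _ fin, of P] P that
    by (simp add: simple_function_def)
  have "?m (mixture t \<mu> \<nu>) k = t * ?m \<mu> k + (1 - t) * ?m \<nu> k" for k
    by (rule measure_mixture[OF \<mu> \<nu> t simple_functionD(2)[OF P]])
  then have "t * - (?m \<mu> k * ln (?m \<mu> k)) + (1 - t) * - (?m \<nu> k * ln (?m \<nu> k)) \<le>
      - (?m (mixture t \<mu> \<nu>) k * ln (?m (mixture t \<mu> \<nu>) k))" for k
    using neg_x_ln_x_concave[of "?m \<mu> k" "?m \<nu> k" t] t by simp
  then have "(\<Sum>k\<in>?K. t * - (?m \<mu> k * ln (?m \<mu> k)) + (1 - t) * - (?m \<nu> k * ln (?m \<nu> k))) \<le>
      (\<Sum>k\<in>?K. - (?m (mixture t \<mu> \<nu>) k * ln (?m (mixture t \<mu> \<nu>) k)))"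
    by (rule sum_mono)
  then show ?thesis
    unfolding H[OF \<mu> refl refl] H[OF \<nu> eq] H[OF m sets_mixture space_mixture]
    by (simp only: sum.distrib sum_distrib_left)
qed

lemma entropy_rate_mixture:
  fixes \<mu> \<nu> :: "(int \<Rightarrow> 'a::alphabet) measure"
  assumes X: "shift_space X" and \<mu>: "\<mu> \<in> invariant_measures X" and \<nu>: "\<nu> \<in> invariant_measures X"
    and t: "t \<in> {0..1}"
  shows "t * entropy_rate \<mu> shift_map (\<lambda>x. x 0) + (1 - t) * entropy_rate \<nu> shift_map (\<lambda>x. x 0) \<le>
    entropy_rate (mixture t \<mu> \<nu>) shift_map (\<lambda>x. x 0)"
proof (rule LIMSEQ_le)
  let ?H = "\<lambda>\<rho> n. partition_entropy \<rho> (itinerary shift_map (\<lambda>x. x 0) n)"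
  note m = mixture_invariant[OF X \<mu> \<nu> t]
  have lim: "(\<lambda>n. ?H \<rho> n / real n) \<longlonglongrightarrow> entropy_rate \<rho> shift_map (\<lambda>x. x 0)"
    if "\<rho> \<in> invariant_measures X" for \<rho>
    by (rule measure_preserving.entropy_rate_limit(1)[OF invariant_imp_measure_preserving[OF X that]
          simple_function_coordinate[OF invariant_measuresD(1)[OF that]]])
  show "(\<lambda>n. t * (?H \<mu> n / real n) + (1 - t) * (?H \<nu> n / real n)) \<longlonglongrightarrow>
      t * entropy_rate \<mu> shift_map (\<lambda>x. x 0) + (1 - t) * entropy_rate \<nu> shift_map (\<lambda>x. x 0)"
    by (intro tendsto_intros lim \<mu> \<nu>)
  show "(\<lambda>n. ?H (mixture t \<mu> \<nu>) n / real n) \<longlonglongrightarrow> entropy_rate (mixture t \<mu> \<nu>) shift_map (\<lambda>x. x 0)"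
    by (rule lim[OF m])
  have "simple_function \<mu> (itinerary shift_map (\<lambda>x. x 0) n)" for n
    by (rule measure_preserving.simple_function_itinerary[OF invariant_imp_measure_preserving[OF X \<mu>]
          simple_function_coordinate[OF invariant_measuresD(1)[OF \<mu>]]])
  from partition_entropy_mixture[OF invariant_measuresD(1)[OF \<mu>] invariant_measuresD(1)[OF \<nu>] t this]
  have "(t * ?H \<mu> n + (1 - t) * ?H \<nu> n) / real n \<le> ?H (mixture t \<mu> \<nu>) n / real n" for n
    by (intro divide_right_mono) auto
  then show "\<exists>N. \<forall>n\<ge>N. t * (?H \<mu> n / real n) + (1 - t) * (?H \<nu> n / real n) \<le> ?H (mixture t \<mu> \<nu>) n / real n"
    by (simp add: add_divide_distrib)
qed

section \<open>Continuity of partition entropy in the measure\<close>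

lemma continuous_on_x_ln_x: "continuous_on {0..} (\<lambda>x::real. x * ln x)"
  unfolding continuous_on_eq_continuous_within
proof
  fix x :: real assume x: "x \<in> {0..}"
  show "continuous (at x within {0..}) (\<lambda>x. x * ln x)"
  proof (cases "x = 0")
    case False
    then have "isCont (\<lambda>x. x * ln x) x" by (intro continuous_intros) auto
    then show ?thesis by (rule continuous_at_imp_continuous_at_within)
  next
    case True
    \<comment> \<open>At \<open>0\<close> the square root bound squeezes the function to its value
      \<open>0 * ln 0 = 0\<close>.\<close>
    have "((\<lambda>x. 2 * sqrt x) \<longlongrightarrow> 2 * sqrt 0) (at (0::real) within {0..})"
      by (intro tendsto_intros)
    then have "((\<lambda>x. 2 * sqrt x) \<longlongrightarrow> 0) (at (0::real) within {0..})"
      by simp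
    moreover have "\<forall>\<^sub>F x in at (0::real) within {0..}. norm (x * ln x) \<le> 2 * sqrt x"
    proof -
      have "\<forall>\<^sub>F x in at (0::real) within {0..}. x < 1"
        by (rule order_tendstoD(2)[OF tendsto_ident_at]) simp
      moreover have "\<forall>\<^sub>F x in at (0::real) within {0..}. x \<in> {0..}"
        by (simp add: eventually_at_filter)
      ultimately show ?thesis
      proof eventually_elim
        case (elim x)
        then have "x * ln x \<le> 0"
          by (cases "x = 0") (auto simp: mult_nonneg_nonpos)
        then show ?case using neg_x_ln_x_le_sqrt[of x] elim by simp
      qed
    qed
    ultimately have "((\<lambda>x. x * ln x) \<longlongrightarrow> 0) (at (0::real) within {0..})"
      by (rule Lim_null_comparison[rotated])
    then show ?thesis using True by (simp add: continuous_within)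
  qed
qed

lemma continuous_map_weak_star_partition_entropy:
  fixes P :: "(int \<Rightarrow> 'a::alphabet) \<Rightarrow> 'c"
  assumes P: "\<And>x y. agree N x y \<Longrightarrow> P x = P y"
  shows "continuous_map (weak_star X) euclideanreal (\<lambda>\<mu>. partition_entropy \<mu> P)"
proof -
  let ?m = "\<lambda>\<mu> k. measure \<mu> (P -` {k} \<inter> X)"
  have "finite (P ` X)" if "\<mu> \<in> prob_measures X" for \<mu>
    using simple_functionD(1)[OF simple_function_agree[OF that P]] prob_measuresD(3)[OF that] by simp
  then have "partition_entropy \<mu> P = (\<Sum>k\<in>P ` X. - (?m \<mu> k * ln (?m \<mu> k)))"
    if "\<mu> \<in> prob_measures X" for \<mu>
    using partition_entropy_eq_superset[OF prob_measuresD(1)[OF that] simple_function_agree[OF that P], where K="P ` X"]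
      prob_measuresD(3)[OF that] that by simp
  moreover have "continuous_map (weak_star X) euclideanreal (\<lambda>\<mu>. \<Sum>k\<in>P ` X. - (?m \<mu> k * ln (?m \<mu> k)))"
  \<comment> \<open>Finiteness was derived from the presence of a probability measure. In the other
    case the sum over an infinite set is \<open>0\<close> by convention, hence a constant.\<close>
  proof (cases "finite (P ` X)")
    case True
    have "continuous_map (weak_star X) euclideanreal (\<lambda>\<mu>. ?m \<mu> k * ln (?m \<mu> k))" for k
    proof -
      have "clopen (P -` {k})" by (rule clopen_agree[of N]) (auto dest: P)
      then have "continuous_map (weak_star X) (top_of_set {0..}) (\<lambda>\<mu>. ?m \<mu> k)"
        by (simp add: continuous_map_in_subtopology continuous_map_weak_star_measure_clopen image_subset_iff)
      from continuous_map_compose[OF this, of euclideanreal "\<lambda>x. x * ln x"] continuous_on_x_ln_x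
      show ?thesis by (simp add: comp_def)
    qed
    then show ?thesis
      using True by (intro continuous_map_sum continuous_map_minus) auto
  qed simp
  ultimately show ?thesis
    by (elim continuous_map_eq) simp
qed

lemma itinerary_coordinate_agree:
  "agree n x y \<Longrightarrow> itinerary shift_map (\<lambda>x. x 0) n x = itinerary shift_map (\<lambda>x. x 0) n y"
  by (auto simp: itinerary_coordinate agree_def)

section \<open>Gluing points of a shift of finite type\<close>

definition glue :: "int \<Rightarrow> (int \<Rightarrow> 'a) \<Rightarrow> (int \<Rightarrow> 'a) \<Rightarrow> (int \<Rightarrow> 'a)" where
  "glue k x z = (\<lambda>i. if i < k then x i else z i)"

text \<open>With \<open>m = 2 * R\<close> these blocks act as the vertices of a 1-step shift: two
  points with a common state can be glued there.\<close>

definition state :: "nat \<Rightarrow> int \<Rightarrow> (int \<Rightarrow> 'a) \<Rightarrow> 'a list" where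
  "state m k x = map (\<lambda>i. x (k + int i)) [0..<m]"

lemma state_eq_iff: "state m k x = state m l z \<longleftrightarrow> (\<forall>i. 0 \<le> i \<longrightarrow> i < int m \<longrightarrow> x (k + i) = z (l + i))"
proof -
  have "state m k x = state m l z \<longleftrightarrow> (\<forall>i<m. x (k + int i) = z (l + int i))"
    by (auto simp: state_def)
  also have "\<dots> \<longleftrightarrow> (\<forall>i. 0 \<le> i \<longrightarrow> i < int m \<longrightarrow> x (k + i) = z (l + i))"
    by (metis int_nat_eq nat_less_iff of_nat_0_le_iff of_nat_less_iff nat_0_le)
  finally show ?thesis .
qed

lemma state_eq_iff_window:
  "state m k x = state m k z \<longleftrightarrow> (\<forall>i. k \<le> i \<longrightarrow> i < k + int m \<longrightarrow> x i = z i)"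
proof -
  have "(\<forall>i. 0 \<le> i \<longrightarrow> i < int m \<longrightarrow> x (k + i) = z (k + i)) \<longleftrightarrow>
      (\<forall>i. k \<le> i \<longrightarrow> i < k + int m \<longrightarrow> x i = z i)"
  proof safe
    fix i assume "\<forall>i. 0 \<le> i \<longrightarrow> i < int m \<longrightarrow> x (k + i) = z (k + i)" "k \<le> i" "i < k + int m"
    then show "x i = z i"
      by (metis add_diff_cancel_left' diff_add_cancel diff_ge_0_iff_ge less_diff_eq add.commute diff_less_eq)
  qed auto
  then show ?thesis by (simp add: state_eq_iff)
qed

lemma shift_space_power: "shift_space X \<Longrightarrow> x \<in> X \<Longrightarrow> (shift_map ^^ n) x \<in> X"
  by (induction n) (auto intro: shift_space_shift)

lemma shift_space_translate:
  assumes X: "shift_space X" and x: "x \<in> X"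
  shows "(\<lambda>i. x (i + k)) \<in> X"
proof -
  \<comment> \<open>Negative translates come from surjectivity of the shift on \<open>X\<close>, one
    preimage at a time.\<close>
  have left: "(\<lambda>i. x (i - int n)) \<in> X" for n
  proof (induction n)
    case (Suc n)
    then obtain w where w: "w \<in> X" "(\<lambda>i. x (i - int n)) = shift_map w"
      using X by (auto simp: shift_space_def)
    have "w = (\<lambda>i. x (i - int (Suc n)))"
    proof
      fix i
      show "w i = x (i - int (Suc n))"
        using fun_cong[OF w(2), of "i - 1"] by (simp add: shift_map_def algebra_simps)
    qed
    then show ?case using w(1) by simp
  qed (simp add: x)
  show ?thesis
    using left[of "nat (- k)"] shift_space_power[OF X x, of "nat k"]
    by (cases "0 \<le> k") (auto simp: shift_map_power)
qed

text \<open>Every factor code on a shift of finite type satisfies this for large \<^term>\<open>R\<close>. Working with radius and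
  overlap directly avoids recoding to a 1-block code on a 1-step shift.\<close>

locale gluing_code =
  fixes X :: "(int \<Rightarrow> 'a::alphabet) set" and \<pi> :: "(int \<Rightarrow> 'a) \<Rightarrow> (int \<Rightarrow> 'b::alphabet)" and R :: nat
  assumes shift_space_X: "shift_space X"
    and continuous_code: "continuous_on X \<pi>"
    and code_shift: "\<And>x. x \<in> X \<Longrightarrow> \<pi> (shift_map x) = shift_map (\<pi> x)"
    and code_local: "\<And>x z j. x \<in> X \<Longrightarrow> z \<in> X \<Longrightarrow> (\<And>i. \<bar>i - j\<bar> \<le> int R \<Longrightarrow> x i = z i) \<Longrightarrow> \<pi> x j = \<pi> z j"
    and glue_in: "\<And>x z k. x \<in> X \<Longrightarrow> z \<in> X \<Longrightarrow> state (2 * R) k x = state (2 * R) k z \<Longrightarrow> glue k x z \<in> X"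

text \<open>The radius is that of Curtis, Hedlund and Lyndon: continuity on the compact set
  \<open>X\<close> makes the symbol at time \<open>0\<close> of the image depend on a bounded
  window, and commutation with the shift transfers this to all times.\<close>

lemma gluing_code_exists:
  fixes X :: "(int \<Rightarrow> 'a::alphabet) set" and \<pi> :: "(int \<Rightarrow> 'a) \<Rightarrow> (int \<Rightarrow> 'b::alphabet)"
  assumes sft: "SFT X" and code: "factor_code X Y \<pi>"
  obtains R where "gluing_code X \<pi> R"
proof -
  have X: "shift_space X" and cont: "continuous_on X \<pi>"
    and comm: "\<And>x. x \<in> X \<Longrightarrow> \<pi> (shift_map x) = shift_map (\<pi> x)"
    using code by (auto simp: factor_code_def)
  have comp: "compact X"
    using X by (intro closed_imp_compact) (simp add: shift_space_def)
  obtain r where r: "\<And>x z. x \<in> X \<Longrightarrow> z \<in> X \<Longrightarrow> agree r x z \<Longrightarrow> \<pi> x 0 = \<pi> z 0"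
  proof -
    have "\<exists>N. \<forall>y\<in>X. agree N x y \<longrightarrow> (\<forall>z\<in>X. agree N y z \<longrightarrow> \<pi> y 0 = \<pi> z 0)" if x: "x \<in> X" for x
    proof -
      have "continuous_on X (\<lambda>x. \<pi> x 0)"
        using cont by (rule continuous_on_product_then_coordinatewise)
      moreover have "open {\<pi> x 0}" by (rule discrete_topology_class.open_discrete)
      ultimately obtain A where A: "open A" "A \<inter> X = (\<lambda>x. \<pi> x 0) -` {\<pi> x 0} \<inter> X"
        using continuous_on_open_invariant[of X "\<lambda>x. \<pi> x 0"] by blast
      then have "x \<in> A" using x by auto
      then obtain N where N: "\<And>y. agree N x y \<Longrightarrow> y \<in> A"
        using open_contains_window[OF A(1)] by blast
      have eq: "\<pi> y 0 = \<pi> x 0" if "y \<in> X" "agree N x y" for y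
        using N[OF that(2)] that(1) A(2) by blast
      then have "\<pi> y 0 = \<pi> z 0" if "y \<in> X" "z \<in> X" "agree N x y" "agree N y z" for y z
        using that agree_trans[OF that(3,4)] by simp
      then show ?thesis by blast
    qed
    then obtain N where "\<And>y. y \<in> X \<Longrightarrow> \<forall>z\<in>X. agree N y z \<longrightarrow> \<pi> y 0 = \<pi> z 0"
      by (rule compact_uniform_window[OF comp]) (use agree_mono in blast)+
    then show thesis by (intro that[of N]) blast
  qed
  obtain F where F: "finite F" "X = {x. \<forall>w\<in>F. \<not> occurs_in w x}"
    using sft by (auto simp: SFT_def)
  \<comment> \<open>At least the coding radius, and so large that no forbidden word is longer than
    the overlap \<open>2 * R\<close>.\<close>
  define R where "R = r + (\<Sum>w\<in>F. length w)"
  have len: "length w \<le> 2 * R" if "w \<in> F" for w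
    using member_le_sum[of w F length] F(1) that by (simp add: R_def)
  have translate: "\<pi> (\<lambda>i. x (i + int n)) = (\<lambda>i. \<pi> x (i + int n))" if "x \<in> X" for x n
  proof (induction n)
    case (Suc n)
    have "\<pi> (\<lambda>i. x (i + int (Suc n))) = \<pi> (shift_map (\<lambda>i. x (i + int n)))"
      by (simp add: shift_map_def algebra_simps)
    also have "\<dots> = shift_map (\<pi> (\<lambda>i. x (i + int n)))"
      by (rule comm[OF shift_space_translate[OF X that]])
    also have "\<dots> = (\<lambda>i. \<pi> x (i + int (Suc n)))"
      by (simp add: Suc shift_map_def algebra_simps)
    finally show ?case .
  qed simp
  have translate': "\<pi> (\<lambda>i. x (i + k)) 0 = \<pi> x k" if x: "x \<in> X" for x k
  proof (cases "0 \<le> k")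
    case True
    then show ?thesis using fun_cong[OF translate[OF x, of "nat k"], of 0] by simp
  next
    case False
    then show ?thesis
      using fun_cong[OF translate[OF shift_space_translate[OF X x, of k], of "nat (- k)"], of k] by simp
  qed
  have "gluing_code X \<pi> R"
  proof
    fix x z :: "int \<Rightarrow> 'a" and j
    assume x: "x \<in> X" and z: "z \<in> X" and eq: "\<And>i. \<bar>i - j\<bar> \<le> int R \<Longrightarrow> x i = z i"
    have "r \<le> R" by (simp add: R_def)
    then have "agree r (\<lambda>i. x (i + j)) (\<lambda>i. z (i + j))"
      unfolding agree_def by (auto intro!: eq)
    from r[OF shift_space_translate[OF X x] shift_space_translate[OF X z] this]
    show "\<pi> x j = \<pi> z j"
      by (simp add: translate' x z)
  next
    fix x z :: "int \<Rightarrow> 'a" and k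
    assume x: "x \<in> X" and z: "z \<in> X" and "state (2 * R) k x = state (2 * R) k z"
    then have eq: "x i = z i" if "k \<le> i" "i < k + 2 * int R" for i
      using that by (simp add: state_eq_iff_window)
    have "\<not> occurs_in w (glue k x z)" if w: "w \<in> F" for w
    proof
      assume "occurs_in w (glue k x z)"
      then obtain i where i: "\<And>l. l < length w \<Longrightarrow> glue k x z (i + int l) = w ! l"
        by (auto simp: occurs_in_def)
      show False
      \<comment> \<open>A forbidden word that starts before \<open>k\<close> ends before
        \<open>k + 2 * R\<close> and so occurs in \<open>x\<close>; any other lies entirely in the
        part taken from \<open>z\<close>.\<close>
      proof (cases "i < k")
        case True
        have "x (i + int l) = w ! l" if "l < length w" for l
        proof (cases "i + int l < k")
          case True
          then show ?thesis using i[OF that] by (simp add: glue_def)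
        next
          case False
          moreover have "i + int l < k + 2 * int R"
            using len[OF w] that \<open>i < k\<close> by linarith
          ultimately show ?thesis using i[OF that] eq[of "i + int l"] by (simp add: glue_def)
        qed
        then have "occurs_in w x" by (auto simp: occurs_in_def)
        then show False using x w F(2) by blast
      next
        case False
        then have "z (i + int l) = w ! l" if "l < length w" for l
          using i[OF that] by (simp add: glue_def)
        then have "occurs_in w z" by (auto simp: occurs_in_def)
        then show False using z w F(2) by blast
      qed
    qed
    then show "glue k x z \<in> X" using F(2) by blast
  qed (use X cont comm in auto)
  then show thesis by (rule that)
qed

section \<open>Transition classes\<close>

context gluing_code
begin

lemma closed_X: "closed X"
  using shift_space_X by (simp add: shift_space_def)

lemma code_power: "x \<in> X \<Longrightarrow> \<pi> ((shift_map ^^ n) x) = (shift_map ^^ n) (\<pi> x)"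
  by (induction n) (auto simp: code_shift shift_space_power[OF shift_space_X])

text \<open>This explains the overlap \<open>2 * R\<close>: before time \<open>k + R\<close> the
  code reads only coordinates below \<open>k + 2 * R\<close>, where the glued point is still
  \<open>x\<close>, and afterwards only coordinates from \<open>k\<close> on, where it is
  \<open>z\<close>.\<close>

lemma code_glue:
  assumes x: "x \<in> X" and z: "z \<in> X" and eq: "state (2 * R) k x = state (2 * R) k z"
  shows "\<pi> (glue k x z) = glue (k + int R) (\<pi> x) (\<pi> z)"
proof
  fix j
  note eq' = eq[unfolded state_eq_iff_window]
  show "\<pi> (glue k x z) j = glue (k + int R) (\<pi> x) (\<pi> z) j"
  proof (cases "j < k + int R")
    case True
    have "\<pi> (glue k x z) j = \<pi> x j"
      using True eq' by (intro code_local glue_in x z eq) (auto simp: glue_def)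
    then show ?thesis using True by (simp add: glue_def)
  next
    case False
    have "\<pi> (glue k x z) j = \<pi> z j"
      using False by (intro code_local glue_in x z eq) (auto simp: glue_def)
    then show ?thesis using False by (simp add: glue_def)
  qed
qed

lemma glue_same [simp]: "glue k y y = y"
  by (simp add: glue_def)

lemma fibre_glue:
  assumes "x \<in> X" "z \<in> X" "\<pi> x = y" "\<pi> z = y" "state (2 * R) k x = state (2 * R) k z"
  shows "glue k x z \<in> X" "\<pi> (glue k x z) = y"
  using glue_in[OF assms(1,2,5)] code_glue[OF assms(1,2,5)] assms(3,4) by simp_all

definition equivalent :: "(int \<Rightarrow> 'a) \<Rightarrow> (int \<Rightarrow> 'a) \<Rightarrow> bool" where
  "equivalent x x' \<longleftrightarrow> transition X \<pi> x x' \<and> transition X \<pi> x' x"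

lemma class_pairs_iff:
  "(x, x') \<in> class_pairs X \<pi> \<longleftrightarrow> x \<in> X \<and> x' \<in> X \<and> \<pi> x = \<pi> x' \<and> equivalent x x'"
  by (auto simp: class_pairs_def equivalent_def)

lemma transition_refl: "x \<in> X \<Longrightarrow> transition X \<pi> x x"
  unfolding transition_def by blast

lemma transition_trans:
  assumes "\<pi> x = y" "\<pi> x' = y" and xx': "transition X \<pi> x x'" and x'x'': "transition X \<pi> x' x''"
  shows "transition X \<pi> x x''"
  unfolding transition_def
proof
  fix n :: int
  obtain z N where z: "z \<in> X" "\<pi> z = y" "\<And>i. i \<le> n \<Longrightarrow> z i = x i" "\<And>i. i \<ge> N \<Longrightarrow> z i = x' i"
    using xx' assms(1) unfolding transition_def by metis
  \<comment> \<open>At time \<open>k\<close> the first path has reached \<open>x'\<close>. The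
    second follows \<open>x'\<close> through time \<open>k + 2 * R\<close>, so the two share the
    state at \<open>k\<close>.\<close>
  define k where "k = max N (n + 1)"
  obtain z' N' where z': "z' \<in> X" "\<pi> z' = y" "\<And>i. i \<le> k + 2 * int R \<Longrightarrow> z' i = x' i"
      "\<And>i. i \<ge> N' \<Longrightarrow> z' i = x'' i"
    using x'x'' assms(2) unfolding transition_def by metis
  have st: "state (2 * R) k z = state (2 * R) k z'"
    using z(4) z'(3) by (auto simp: state_eq_iff_window k_def)
  have "\<forall>i\<le>n. glue k z z' i = x i" "\<forall>i\<ge>max k N'. glue k z z' i = x'' i"
    using z(3) z'(4) by (auto simp: glue_def k_def)
  then show "\<exists>z\<in>X. \<pi> z = \<pi> x \<and> (\<forall>i\<le>n. z i = x i) \<and> (\<exists>N. \<forall>i\<ge>N. z i = x'' i)"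
    using fibre_glue[OF z(1) z'(1) z(2) z'(2) st] unfolding assms(1) by blast
qed

lemma equivalent_refl: "x \<in> X \<Longrightarrow> equivalent x x"
  by (simp add: equivalent_def transition_refl)

lemma equivalent_sym: "equivalent x x' \<Longrightarrow> equivalent x' x"
  by (simp add: equivalent_def)

lemma equivalent_trans:
  "\<pi> x = y \<Longrightarrow> \<pi> x' = y \<Longrightarrow> \<pi> x'' = y \<Longrightarrow> equivalent x x' \<Longrightarrow> equivalent x' x'' \<Longrightarrow> equivalent x x''"
  unfolding equivalent_def using transition_trans by metis

text \<open>The states \<^term>\<open>s\<close> play the role of the symbols at the distinguished time of a transition block. Agreement up
  to time \<^term>\<open>2 * int R\<close>, and not just \<^term>\<open>0\<close>, makes this a condition on finitely many coordinates.\<close>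

definition routable :: "nat \<Rightarrow> nat \<Rightarrow> 'a list \<Rightarrow> (int \<Rightarrow> 'a) \<Rightarrow> bool" where
  "routable N b s x \<longleftrightarrow> (\<exists>z\<in>X. \<pi> z = \<pi> x \<and> (\<forall>i < 2 * int R. z i = x i) \<and> (\<forall>i \<ge> int b. z i = x i) \<and>
     state (2 * R) (int N) z = s)"

lemma routable_own_state: "x \<in> X \<Longrightarrow> routable N b (state (2 * R) (int N) x) x"
  unfolding routable_def by blast

lemma routable_mono: "routable N b s x \<Longrightarrow> b \<le> b' \<Longrightarrow> routable N b' s x"
  unfolding routable_def by (meson order_trans of_nat_le_iff)

text \<open>The detour is transplanted from \<open>x\<close> to \<open>x'\<close>, entered at time
  \<open>0\<close> and left at time \<open>b\<close>; the window contains both overlaps and the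
  state at time \<open>N\<close>. The image is correct because \<open>x\<close> and
  \<open>x'\<close> have the same image on the times from \<open>R\<close> to \<open>b + R\<close>
  (exclusive) that are taken from the detour.\<close>

lemma routable_agree:
  assumes x: "x \<in> X" "x' \<in> X" and ag: "agree (b + N + 4 * R) x x'" and rt: "routable N b s x"
  shows "routable N b s x'"
proof -
  obtain z where z: "z \<in> X" "\<pi> z = \<pi> x" "\<And>i. i < 2 * int R \<Longrightarrow> z i = x i" "\<And>i. i \<ge> int b \<Longrightarrow> z i = x i"
      "state (2 * R) (int N) z = s"
    using rt unfolding routable_def by blast
  have xx': "x i = x' i" if "- int R \<le> i" "i \<le> int b + int N + 4 * int R" for i
    using ag that by (auto simp: agree_def)
  have s0: "state (2 * R) 0 x' = state (2 * R) 0 z"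
    using z(3) xx' by (auto simp: state_eq_iff_window)
  note w = glue_in[OF x(2) z(1) s0] code_glue[OF x(2) z(1) s0]
  have s1: "state (2 * R) (int b) (glue 0 x' z) = state (2 * R) (int b) x'"
    using z(4) xx' by (auto simp: state_eq_iff_window glue_def)
  note v = glue_in[OF w(1) x(2) s1] code_glue[OF w(1) x(2) s1]
  let ?v = "glue (int b) (glue 0 x' z) x'"
  have "\<pi> x j = \<pi> x' j" if "int R \<le> j" "j < int b + int R" for j
    using that by (intro code_local x xx') auto
  then have "\<pi> ?v = \<pi> x'"
    unfolding v(2) w(2) z(2) by (auto simp: glue_def fun_eq_iff)
  moreover have "?v i = z i" if "0 \<le> i" "i \<le> int b + int N + 4 * int R" for i
    using that z(4) xx' by (auto simp: glue_def)
  then have "state (2 * R) (int N) ?v = s"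
    unfolding z(5)[symmetric] by (auto simp: state_eq_iff_window)
  moreover have "?v i = x' i" if "i < 2 * int R" for i
    using that z(3)[of i] xx'[of i] by (auto simp: glue_def)
  moreover have "?v i = x' i" if "i \<ge> int b" for i
    using that by (auto simp: glue_def)
  ultimately show ?thesis
    using v(1) unfolding routable_def by blast
qed

lemma routable_clopen:
  obtains C where "clopen C" "\<And>x. x \<in> X \<Longrightarrow> x \<in> C \<longleftrightarrow> routable N b s x"
proof -
  \<comment> \<open>Saturating under agreement on the window makes the condition meaningful on the
    full shift without altering it on \<open>X\<close>.\<close>
  define C where "C = {w. \<exists>x\<in>X. agree (b + N + 4 * R) x w \<and> routable N b s x}"
  have "clopen C"
    by (rule clopen_agree[of "b + N + 4 * R"]) (unfold C_def, blast intro: agree_trans agree_sym)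
  moreover have "x \<in> C \<longleftrightarrow> routable N b s x" if "x \<in> X" for x
    using that routable_agree[OF _ that] unfolding C_def by (auto intro: agree_refl)
  ultimately show thesis by (rule that)
qed

lemma routable_shift:
  assumes x: "x \<in> X" and rt: "routable N b s ((shift_map ^^ n) x)"
  obtains z where "z \<in> X" "\<pi> z = \<pi> x" "\<And>i. i < int n + 2 * int R \<Longrightarrow> z i = x i"
    "\<And>i. i \<ge> int n + int b \<Longrightarrow> z i = x i" "state (2 * R) (int n + int N) z = s"
proof -
  obtain w where w: "w \<in> X" "\<pi> w = \<pi> ((shift_map ^^ n) x)" "\<And>i. i < 2 * int R \<Longrightarrow> w i = x (i + int n)"
      "\<And>i. i \<ge> int b \<Longrightarrow> w i = x (i + int n)" "state (2 * R) (int N) w = s"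
    using rt unfolding routable_def shift_map_power by metis
  define z where "z = (\<lambda>i. w (i - int n))"
  have zX: "z \<in> X"
    using shift_space_translate[OF shift_space_X w(1), of "- int n"] by (simp add: z_def)
  have "(shift_map ^^ n) z = w"
    by (simp add: shift_map_power z_def)
  then have "(shift_map ^^ n) (\<pi> z) = (shift_map ^^ n) (\<pi> x)"
    using w(2) code_power[OF zX, of n] code_power[OF x, of n] by simp
  then have "\<pi> z (i - int n + int n) = \<pi> x (i - int n + int n)" for i
    unfolding shift_map_power by (rule fun_cong)
  then have "\<pi> z = \<pi> x" by (simp add: fun_eq_iff)
  moreover have "state (2 * R) (int n + int N) z = s"
    using w(5) by (auto simp: state_def z_def algebra_simps)
  ultimately show thesis
    using zX w(3,4) by (intro that[of z]) (auto simp: z_def)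
qed

text \<open>At a common state one can leave the detour of \<open>x\<close> and enter that of
  \<open>x'\<close>. Since such times are unbounded, the switch can be delayed beyond any
  \<open>m\<close>.\<close>

lemma transition_if_common_routes:
  assumes x: "x \<in> X" "x' \<in> X" "\<pi> x = \<pi> x'"
    and inf: "\<And>m. \<exists>n\<ge>m. \<exists>s. routable N b s ((shift_map ^^ n) x) \<and> routable N b s ((shift_map ^^ n) x')"
  shows "transition X \<pi> x x'"
  unfolding transition_def
proof
  fix m :: int
  obtain n s where n: "n \<ge> nat (m + 1)" and s: "routable N b s ((shift_map ^^ n) x)" "routable N b s ((shift_map ^^ n) x')"
    using inf by blast
  obtain z where z: "z \<in> X" "\<pi> z = \<pi> x" "\<And>i. i < int n + 2 * int R \<Longrightarrow> z i = x i"
      "state (2 * R) (int n + int N) z = s"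
    using routable_shift[OF x(1) s(1)] by metis
  obtain z' where z': "z' \<in> X" "\<pi> z' = \<pi> x'" "\<And>i. i \<ge> int n + int b \<Longrightarrow> z' i = x' i"
      "state (2 * R) (int n + int N) z' = s"
    using routable_shift[OF x(2) s(2)] by metis
  let ?k = "int n + int N"
  have "\<pi> z' = \<pi> x" "state (2 * R) ?k z = state (2 * R) ?k z'"
    using z(4) z'(2,4) x(3) by simp_all
  note sp = fibre_glue[OF z(1) z'(1) z(2) this]
  have "\<forall>i\<le>m. glue ?k z z' i = x i"
    using z(3) n by (auto simp: glue_def)
  moreover have "\<forall>i\<ge>max ?k (int n + int b). glue ?k z z' i = x' i"
    using z'(3) by (auto simp: glue_def)
  ultimately show "\<exists>z\<in>X. \<pi> z = \<pi> x \<and> (\<forall>i\<le>m. z i = x i) \<and> (\<exists>N. \<forall>i\<ge>N. z i = x' i)"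
    using sp by blast
qed

lemma equivalent_if_common_routes:
  assumes x: "x \<in> X" "x' \<in> X" "\<pi> x = \<pi> x'"
    and inf: "\<And>m. \<exists>n\<ge>m. \<exists>s. routable N b s ((shift_map ^^ n) x) \<and> routable N b s ((shift_map ^^ n) x')"
  shows "equivalent x x'"
  unfolding equivalent_def
proof
  show "transition X \<pi> x x'" by (rule transition_if_common_routes[OF x inf])
  show "transition X \<pi> x' x"
    by (rule transition_if_common_routes[OF x(2,1) x(3)[symmetric]]) (use inf in blast)
qed

text \<open>The set plays the role of the cylinder of a transition block: it is the preimage of a relatively open set of
  image points.\<close>

definition funnel :: "nat \<Rightarrow> nat \<Rightarrow> 'a list set \<Rightarrow> (int \<Rightarrow> 'a) set" where
  "funnel N b M = {x\<in>X. \<forall>z\<in>X. \<pi> z = \<pi> x \<longrightarrow> (\<exists>s\<in>M. routable N b s z)}"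

lemma closed_fibre_pairs: "closed {p \<in> X \<times> X. \<pi> (fst p) = \<pi> (snd p)}"
proof -
  have "continuous_on (X \<times> X) (\<lambda>p. \<pi> (fst p))" "continuous_on (X \<times> X) (\<lambda>p. \<pi> (snd p))"
    by (rule continuous_on_compose2[OF continuous_code continuous_on_fst[OF continuous_on_id]], force,
        rule continuous_on_compose2[OF continuous_code continuous_on_snd[OF continuous_on_id]], force)
  then have "continuous_on (X \<times> X) (\<lambda>p. (\<pi> (fst p), \<pi> (snd p)))"
    by (rule continuous_on_Pair)
  from continuous_closed_preimage[OF this closed_Times[OF closed_X closed_X] closed_diagonal]
  show ?thesis
    by (rule back_subst[of closed]) auto
qed

text \<open>Quantifying over the fibre preserves openness: the complement is the projection of a
  compact set, namely the pairs in a common fibre whose second point cannot be routed.\<close>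

lemma open_funnel:
  assumes "finite M"
  obtains U where "open U" "funnel N b M = U \<inter> X"
proof -
  have "\<exists>C. clopen C \<and> (\<forall>x\<in>X. x \<in> C \<longleftrightarrow> routable N b s x)" for s
    using routable_clopen by metis
  then obtain C where C: "\<And>s. clopen (C s)" "\<And>s x. x \<in> X \<Longrightarrow> x \<in> C s \<longleftrightarrow> routable N b s x"
    by metis
  let ?P = "{p \<in> X \<times> X. \<pi> (fst p) = \<pi> (snd p)} \<inter> (UNIV \<times> - (\<Union>s\<in>M. C s))"
  have "open (\<Union>s\<in>M. C s)"
    using clopen_UN[OF assms, of C] C(1) unfolding clopen_def by blast
  then have "closed (- (\<Union>s\<in>M. C s))"
    by (rule closed_Compl)
  then have "closed ?P"
    by (intro closed_Int closed_fibre_pairs closed_Times closed_UNIV)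
  define Q where "Q = fst ` ?P"
  have "compact Q"
    unfolding Q_def using \<open>closed ?P\<close> by (intro compact_continuous_image continuous_on_fst continuous_on_id closed_imp_compact)
  then have "open (- Q)"
    by (intro open_Compl compact_imp_closed)
  moreover have Q: "x \<in> Q \<longleftrightarrow> (\<exists>z\<in>X. \<pi> z = \<pi> x \<and> \<not> (\<exists>s\<in>M. routable N b s z))" if x: "x \<in> X" for x
  proof
    assume "x \<in> Q"
    then obtain z where "z \<in> X" "\<pi> x = \<pi> z" "z \<notin> (\<Union>s\<in>M. C s)"
      by (auto simp: Q_def)
    then show "\<exists>z\<in>X. \<pi> z = \<pi> x \<and> \<not> (\<exists>s\<in>M. routable N b s z)"
      using C(2)[of z] by (intro bexI[of _ z]) auto
  next
    assume "\<exists>z\<in>X. \<pi> z = \<pi> x \<and> \<not> (\<exists>s\<in>M. routable N b s z)"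
    then obtain z where "z \<in> X" "\<pi> z = \<pi> x" "\<not> (\<exists>s\<in>M. routable N b s z)"
      by blast
    then have "(x, z) \<in> ?P" using C(2)[of z] x by auto
    then show "x \<in> Q" unfolding Q_def by (rule image_eqI[rotated]) simp
  qed
  then have "funnel N b M = - Q \<inter> X"
    unfolding funnel_def by blast
  ultimately show thesis by (rule that)
qed

text \<open>The starting point for the minimization over \<open>M\<close>: without any detour, a
  point passes through its own state.\<close>

lemma funnel_all_states: "funnel N b {s. length s = 2 * R} = X"
  unfolding funnel_def using routable_own_state by (fastforce simp: state_def)

text \<open>A maximal set of inequivalent points in a fibre yields a set of states through which the whole fibre
  can be routed, the required times being uniform by compactness.\<close>

lemma funnel_if_representatives:
  assumes T: "finite T" "T \<subseteq> X" "\<And>t. t \<in> T \<Longrightarrow> \<pi> t = y"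
    and rep: "\<And>z. z \<in> X \<Longrightarrow> \<pi> z = y \<Longrightarrow> \<exists>t\<in>T. equivalent z t"
  obtains N b where "\<And>x. x \<in> X \<Longrightarrow> \<pi> x = y \<Longrightarrow> x \<in> funnel N b (state (2 * R) (int N) ` T)"
proof -
  define K where "K = {z \<in> X. \<pi> z = y}"
  have "closed K"
    using continuous_closed_preimage[OF continuous_code closed_X closed_singleton[of y]]
    by (simp add: K_def vimage_def Int_def)
  then have K: "compact K" by (rule closed_imp_compact)
  \<comment> \<open>A single transition from \<open>z\<close> to \<open>t\<close> with a bound
    \<open>n\<close> on its arrival time.\<close>
  define reach where "reach n z t \<longleftrightarrow>
    (\<exists>p\<in>X. \<pi> p = y \<and> (\<forall>i < 2 * int R. p i = z i) \<and> (\<forall>i \<ge> int n. p i = t i))" for n z t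
  have reach_mono: "reach n z t \<Longrightarrow> n \<le> m \<Longrightarrow> reach m z t" for n m z t
    unfolding reach_def by (meson order_trans of_nat_le_iff)
  \<comment> \<open>The bound depends on \<open>z\<close> only through its state at time
    \<open>0\<close>, hence is locally constant; this is where compactness gets its grip.\<close>
  have reach_state: "reach n z' t"
    if "reach n z t" "z' \<in> K" "state (2 * R) 0 z' = state (2 * R) 0 z" for n z z' t
  proof -
    obtain p where p: "p \<in> X" "\<pi> p = y" "\<And>i. i < 2 * int R \<Longrightarrow> p i = z i" "\<And>i. i \<ge> int n \<Longrightarrow> p i = t i"
      using \<open>reach n z t\<close> unfolding reach_def by blast
    have z': "z' \<in> X" "\<pi> z' = y" using that(2) by (auto simp: K_def)
    have zz: "z' i = z i" if "0 \<le> i" "i < 2 * int R" for i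
      using \<open>state (2 * R) 0 z' = _\<close> that by (simp add: state_eq_iff_window)
    have st: "state (2 * R) 0 z' = state (2 * R) 0 p"
      using zz p(3) by (simp add: state_eq_iff_window)
    have "\<forall>i < 2 * int R. glue 0 z' p i = z' i" "\<forall>i \<ge> int n. glue 0 z' p i = t i"
      using zz p(3,4) by (auto simp: glue_def)
    then show ?thesis
      using fibre_glue[OF z'(1) p(1) z'(2) p(2) st] unfolding reach_def by blast
  qed
  have ex_reach: "\<exists>n. reach n z t" if "z \<in> K" "equivalent z t" for z t
  proof -
    have zy: "\<pi> z = y" using that(1) by (simp add: K_def)
    have "\<exists>p\<in>X. \<pi> p = y \<and> (\<forall>i \<le> 2 * int R. p i = z i) \<and> (\<exists>N. \<forall>i\<ge>N. p i = t i)"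
      using that(2) unfolding equivalent_def transition_def zy by blast
    then obtain p N where "p \<in> X" "\<pi> p = y" "\<forall>i \<le> 2 * int R. p i = z i" "\<forall>i\<ge>N. p i = t i"
      by blast
    then have "reach (nat N) z t" unfolding reach_def by (intro bexI[of _ p]) auto
    then show ?thesis by blast
  qed
  \<comment> \<open>\<open>N\<close> is a common arrival time for the fibre. The condition
    \<open>2 * R \<le> N\<close> puts the prescribed initial part before the later switch at time
    \<open>N\<close>.\<close>
  obtain N where N: "\<And>z. z \<in> K \<Longrightarrow> 2 * R \<le> N \<and> (\<forall>t\<in>T. (\<exists>n. reach n z t) \<longrightarrow> reach N z t)"
  proof (rule compact_uniform_window[OF K, of "\<lambda>N z. 2 * R \<le> N \<and> (\<forall>t\<in>T. (\<exists>n. reach n z t) \<longrightarrow> reach N z t)"])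
    fix x assume x: "x \<in> K"
    \<comment> \<open>An arrival time if there is one, and an arbitrary number otherwise.\<close>
    define m where "m t = (SOME n. reach n x t)" for t
    have m: "reach (m t) x t" if "reach n x t" for n t
      unfolding m_def using that by (rule someI)
    define N where "N = 2 * R + (\<Sum>t\<in>T. m t)"
    have mN: "m t \<le> N" if "t \<in> T" for t
      using member_le_sum[OF that, of m] T(1) by (simp add: N_def)
    have "reach N z t" if z: "z \<in> K" "agree N x z" and t: "t \<in> T" "reach n z t" for z t n
    proof -
      have st: "state (2 * R) 0 x = state (2 * R) 0 z"
        using agree_mono[OF z(2), of "2 * R"] by (auto simp: state_eq_iff_window agree_def N_def)
      have "reach n x t" using reach_state[OF t(2) x st] .
      then have "reach N x t" using m reach_mono mN[OF t(1)] by blast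
      then show ?thesis using reach_state[OF _ z(1) st[symmetric]] by blast
    qed
    then show "\<exists>N. \<forall>z\<in>K. agree N x z \<longrightarrow> 2 * R \<le> N \<and> (\<forall>t\<in>T. (\<exists>n. reach n z t) \<longrightarrow> reach N z t)"
      by (intro exI[of _ N]) (auto simp: N_def)
  next
    show "2 * R \<le> N \<and> (\<forall>t\<in>T. (\<exists>n. reach n z t) \<longrightarrow> reach N z t)"
      if "M \<le> N" "2 * R \<le> M \<and> (\<forall>t\<in>T. (\<exists>n. reach n z t) \<longrightarrow> reach M z t)" for M N z
      using that reach_mono order_trans by blast
  qed blast
  \<comment> \<open>Go from \<open>z\<close> to \<open>t\<close> by time \<open>N\<close>, follow
    \<open>t\<close> through its state there, and return to \<open>z\<close>. Both halves of the
    equivalence are used.\<close>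
  have route: "\<exists>b. \<exists>t\<in>T. routable N b (state (2 * R) (int N) t) z" if z: "z \<in> K" for z
  proof -
    obtain t where t: "t \<in> T" "equivalent z t"
      using rep z by (auto simp: K_def)
    have "reach N z t" using N[OF z] t ex_reach[OF z t(2)] by blast
    then obtain p where p: "p \<in> X" "\<pi> p = y" "\<And>i. i < 2 * int R \<Longrightarrow> p i = z i" "\<And>i. i \<ge> int N \<Longrightarrow> p i = t i"
      unfolding reach_def by blast
    have "\<exists>q\<in>X. \<pi> q = y \<and> (\<forall>i \<le> int N + 2 * int R. q i = t i) \<and> (\<exists>b. \<forall>i\<ge>b. q i = z i)"
      using t(2) unfolding equivalent_def transition_def T(3)[OF t(1)] by blast
    then obtain q b where q: "q \<in> X" "\<pi> q = y" "\<And>i. i \<le> int N + 2 * int R \<Longrightarrow> q i = t i" "\<And>i. i \<ge> b \<Longrightarrow> q i = z i"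
      by blast
    have st: "state (2 * R) (int N) p = state (2 * R) (int N) q"
      using p(4) q(3) by (simp add: state_eq_iff_window)
    let ?w = "glue (int N) p q"
    have "2 * int R \<le> int N" using N[OF z] by linarith
    then have "\<forall>i < 2 * int R. ?w i = z i" "\<forall>i \<ge> int (nat (max b (int N))). ?w i = z i"
      using p(3) q(4) by (auto simp: glue_def)
    moreover have "state (2 * R) (int N) ?w = state (2 * R) (int N) t"
      using q(3) by (simp add: state_eq_iff_window glue_def)
    ultimately have "routable N (nat (max b (int N))) (state (2 * R) (int N) t) z"
      using fibre_glue[OF p(1) q(1) p(2) q(2) st] z unfolding routable_def K_def by auto
    then show ?thesis using t(1) by blast
  qed
  obtain b where b: "\<And>z. z \<in> K \<Longrightarrow> \<exists>t\<in>T. routable N b (state (2 * R) (int N) t) z"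
  proof (rule compact_uniform_window[OF K, of "\<lambda>b z. \<exists>t\<in>T. routable N b (state (2 * R) (int N) t) z"])
    fix x assume x: "x \<in> K"
    then obtain b t where b: "t \<in> T" "routable N b (state (2 * R) (int N) t) x"
      using route by blast
    \<comment> \<open>The time bound is enlarged to the size of the window, since a single parameter
      must control both.\<close>
    have "routable N (b + N + 4 * R) (state (2 * R) (int N) t) z" if "z \<in> K" "agree (b + N + 4 * R) x z" for z
      using routable_agree[OF _ _ that(2) b(2)] x that(1) by (auto simp: K_def intro: routable_mono)
    then show "\<exists>b. \<forall>z\<in>K. agree b x z \<longrightarrow> (\<exists>t\<in>T. routable N b (state (2 * R) (int N) t) z)"
      using b(1) by blast
  qed (use routable_mono in blast)+
  show thesis
    using b by (intro that[of N b]) (auto simp: funnel_def K_def)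
qed

end

section \<open>Measurability of equivalence and inequivalent points in a fibre\<close>

context gluing_code
begin

text \<open>For fixed departure time \<open>n\<close> and arrival time \<open>N\<close> the pairs
  joined by some \<open>z\<close> form a closed set, as the projection of a compact set of triples.
  A transition is a countable intersection of countable unions of such sets.\<close>

lemma borel_class_pairs: "class_pairs X \<pi> \<in> sets borel"
proof -
  define L where "L n N = {p. fst p \<in> X \<and> snd p \<in> X \<and>
    (\<exists>z\<in>X. \<pi> z = \<pi> (fst p) \<and> (\<forall>i\<le>n. z i = fst p i) \<and> (\<forall>i\<ge>N. z i = snd p i))}" for n N :: int
  have "closed (L n N)" for n N
  proof -
    define Q where "Q = (\<lambda>q. (fst q, fst (snd q))) -` {p \<in> X \<times> X. \<pi> (fst p) = \<pi> (snd p)} \<inter>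
      (UNIV \<times> (UNIV \<times> X)) \<inter> (\<Inter>i\<in>{..n}. {q. fst q i = fst (snd q) i}) \<inter> (\<Inter>i\<in>{N..}. {q. fst q i = snd (snd q) i})"
    have "continuous_on UNIV (\<lambda>q. fst q i)" "continuous_on UNIV (\<lambda>q. fst (snd q) i)"
        "continuous_on UNIV (\<lambda>q. snd (snd q) i)"
      for i and q :: "(int \<Rightarrow> 'a) \<times> (int \<Rightarrow> 'a) \<times> (int \<Rightarrow> 'a)"
      by (rule continuous_on_product_then_coordinatewise, intro continuous_intros)+
    then have "closed Q"
      unfolding Q_def
      by (intro closed_Int closed_INT ballI closed_Collect_eq closed_vimage closed_fibre_pairs closed_Times closed_UNIV
          closed_X continuous_on_Pair continuous_on_fst continuous_on_snd continuous_on_id)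
    then have "compact (snd ` Q)"
      by (intro compact_continuous_image continuous_on_snd continuous_on_id closed_imp_compact)
    moreover have "L n N = snd ` Q"
    proof (intro set_eqI iffI)
      fix p assume "p \<in> L n N"
      then obtain z where "fst p \<in> X" "snd p \<in> X" "z \<in> X" "\<pi> z = \<pi> (fst p)"
          "\<forall>i\<le>n. z i = fst p i" "\<forall>i\<ge>N. z i = snd p i"
        unfolding L_def by blast
      then have "(z, p) \<in> Q" by (auto simp: Q_def mem_Times_iff)
      then show "p \<in> snd ` Q" by (rule image_eqI[rotated]) simp
    next
      fix p assume "p \<in> snd ` Q"
      then obtain z where "(z, p) \<in> Q" by auto
      then show "p \<in> L n N" by (auto simp: Q_def L_def mem_Times_iff)
    qed
    ultimately show ?thesis by (simp add: compact_imp_closed)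
  qed
  moreover have "closed (prod.swap -` L n N)" if "closed (L n N)" for n N
    unfolding prod.swap_def
    by (intro closed_vimage that continuous_on_Pair continuous_on_fst continuous_on_snd continuous_on_id)
  ultimately have "(\<Inter>n. \<Union>N. L n N) \<in> sets borel" "(\<Inter>n. \<Union>N. prod.swap -` L n N) \<in> sets borel"
    by (auto intro!: sets.countable_INT'' sets.countable_UN'')
  moreover have "class_pairs X \<pi> = {p \<in> X \<times> X. \<pi> (fst p) = \<pi> (snd p)} \<inter> (\<Inter>n. \<Union>N. L n N) \<inter>
      (\<Inter>n. \<Union>N. prod.swap -` L n N)"
  proof (intro set_eqI)
    fix p
    have "transition X \<pi> (fst p) (snd p) \<longleftrightarrow> p \<in> (\<Inter>n. \<Union>N. L n N)"
        "transition X \<pi> (snd p) (fst p) \<longleftrightarrow> p \<in> (\<Inter>n. \<Union>N. prod.swap -` L n N)"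
      if "fst p \<in> X" "snd p \<in> X"
      using that by (auto simp: transition_def L_def) blast+
    then show "p \<in> class_pairs X \<pi> \<longleftrightarrow> p \<in> {p \<in> X \<times> X. \<pi> (fst p) = \<pi> (snd p)} \<inter> (\<Inter>n. \<Union>N. L n N) \<inter>
      (\<Inter>n. \<Union>N. prod.swap -` L n N)"
      by (auto simp: class_pairs_def)
  qed
  ultimately show ?thesis
    using closed_fibre_pairs by auto
qed

lemma code_fibre_power:
  "x \<in> X \<Longrightarrow> z \<in> X \<Longrightarrow> \<pi> x = \<pi> z \<Longrightarrow> \<pi> ((shift_map ^^ n) x) = \<pi> ((shift_map ^^ n) z)"
  by (simp add: code_power)

text \<open>The point \<open>x\<close> itself is put into \<open>T\<close> so that an additional
  point equivalent to \<open>x\<close> can later be compared with it.\<close>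

definition inequivalent_in_fibre :: "(int \<Rightarrow> 'a) \<Rightarrow> (int \<Rightarrow> 'a) set \<Rightarrow> bool" where
  "inequivalent_in_fibre x T \<longleftrightarrow> finite T \<and> x \<in> T \<and> T \<subseteq> {z \<in> X. \<pi> z = \<pi> x} \<and>
     (\<forall>p\<in>T. \<forall>q\<in>T. p \<noteq> q \<longrightarrow> \<not> equivalent p q)"

text \<open>If all such sets had fewer than \<open>d\<close> points, one of maximal size would
  represent every class of the fibre, and its states would define a funnel with fewer than
  \<open>d\<close> states containing \<open>x\<close>.\<close>

lemma inequivalent_set_exists:
  assumes x: "x \<in> X"
    and avoid: "\<And>N b M. M \<subseteq> {s. length s = 2 * R} \<Longrightarrow> card M < d \<Longrightarrow> x \<notin> funnel N b M"
  obtains T where "inequivalent_in_fibre x T" "d \<le> card T"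
proof (rule ccontr)
  assume "\<not> thesis"
  then have small: "inequivalent_in_fibre x T \<Longrightarrow> card T < d" for T
    using that not_less by blast
  have "inequivalent_in_fibre x {x}"
    using x by (simp add: inequivalent_in_fibre_def)
  then obtain T where T: "inequivalent_in_fibre x T" and max: "\<And>T'. inequivalent_in_fibre x T' \<Longrightarrow> card T' \<le> card T"
    using ex_has_greatest_nat[of "inequivalent_in_fibre x" "{x}" card d] small less_imp_le by metis
  note T' = T[unfolded inequivalent_in_fibre_def]
  have rep: "\<exists>t\<in>T. equivalent z t" if z: "z \<in> X" "\<pi> z = \<pi> x" for z
  proof (rule ccontr)
    assume no: "\<not> (\<exists>t\<in>T. equivalent z t)"
    then have "z \<notin> T" using equivalent_refl[OF z(1)] by blast
    have "inequivalent_in_fibre x (insert z T)"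
      using T' z no equivalent_sym unfolding inequivalent_in_fibre_def by blast
    from max[OF this] show False
      using \<open>z \<notin> T\<close> T' by simp
  qed
  obtain N b where "\<And>z. z \<in> X \<Longrightarrow> \<pi> z = \<pi> x \<Longrightarrow> z \<in> funnel N b (state (2 * R) (int N) ` T)"
    using funnel_if_representatives[of T "\<pi> x"] T' rep by blast
  then have "x \<in> funnel N b (state (2 * R) (int N) ` T)" using x by blast
  moreover have "card (state (2 * R) (int N) ` T) < d"
    using card_image_le[of T "state (2 * R) (int N)"] T' small[OF T] by simp
  moreover have "state (2 * R) (int N) ` T \<subseteq> {s. length s = 2 * R}"
    by (auto simp: state_def)
  ultimately show False using avoid by blast
qed

end

section \<open>Minimal funnels and generic points\<close>

text \<open>Minimality is required for all times \<open>N'\<close> and \<open>b'\<close>, because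
  the times obtained from a set of representatives are not under control.\<close>

locale minimal_funnel = gluing_code X \<pi> R
  for X :: "(int \<Rightarrow> 'a::alphabet) set" and \<pi> :: "(int \<Rightarrow> 'a) \<Rightarrow> (int \<Rightarrow> 'b::alphabet)" and R :: nat +
  fixes \<mu> :: "(int \<Rightarrow> 'a) measure" and N b :: nat and M :: "'a list set"
  assumes ergodic: "\<mu> \<in> ergodic_measures X"
    and states: "M \<subseteq> {s. length s = 2 * R}"
    and funnel_pos: "0 < measure \<mu> (funnel N b M)"
    and minimal: "\<And>N' b' M'. M' \<subseteq> {s. length s = 2 * R} \<Longrightarrow> card M' < card M \<Longrightarrow> measure \<mu> (funnel N' b' M') = 0"

lemma finite_states: "finite {s :: 'a::finite list. length s = m}"
  using finite_lists_length_eq[of "UNIV :: 'a set" m] by simp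

lemma (in gluing_code) minimal_funnel_exists:
  assumes \<mu>: "\<mu> \<in> ergodic_measures X"
  obtains N b M where "minimal_funnel X \<pi> R \<mu> N b M"
proof -
  have p: "\<mu> \<in> prob_measures X"
    using \<mu> by (auto simp: ergodic_measures_def invariant_measures_def)
  define P where "P q \<longleftrightarrow> (case q of (N, b, M) \<Rightarrow> M \<subseteq> {s. length s = 2 * R} \<and> 0 < measure \<mu> (funnel N b M))"
    for q :: "nat \<times> nat \<times> 'a list set"
  have "measure \<mu> X = 1"
    using prob_space.prob_space[OF prob_measuresD(1)[OF p]] prob_measuresD(3)[OF p] by simp
  then have "P (0, 0, {s. length s = 2 * R})"
    by (simp add: P_def funnel_all_states)
  then obtain q where q: "P q" "\<And>q'. P q' \<Longrightarrow> card (snd (snd q)) \<le> card (snd (snd q'))"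
    using ex_has_least_nat[of P _ "\<lambda>q. card (snd (snd q))"] by blast
  obtain N b M where [simp]: "q = (N, b, M)" by (cases q) auto
  have "minimal_funnel X \<pi> R \<mu> N b M"
  proof
    fix N' b' M' assume "M' \<subseteq> {s :: 'a list. length s = 2 * R}" "card M' < card M"
    then show "measure \<mu> (funnel N' b' M') = 0"
      using q(2)[of "(N', b', M')"] measure_nonneg[of \<mu> "funnel N' b' M'"]
      by (auto simp: P_def order.order_iff_strict)
  qed (use \<mu> q(1) in \<open>auto simp: P_def\<close>)
  then show thesis by (rule that)
qed

context minimal_funnel
begin

lemma invariant_\<mu>: "\<mu> \<in> invariant_measures X"
  using ergodic by (simp add: ergodic_measures_def)

lemma prob_\<mu>: "\<mu> \<in> prob_measures X"
  using invariant_\<mu> by (simp add: invariant_measures_def)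

sublocale \<mu>: measure_preserving \<mu> shift_map
  by (rule invariant_imp_measure_preserving[OF shift_space_X invariant_\<mu>])

lemma space_\<mu> [simp]: "space \<mu> = X"
  by (rule prob_measuresD(3)[OF prob_\<mu>])

lemma sets_funnel:
  assumes "M' \<subseteq> {s. length s = 2 * R}"
  shows "funnel N' b' M' \<in> sets \<mu>"
proof -
  obtain U where "open U" "funnel N' b' M' = U \<inter> X"
    using open_funnel[OF finite_subset[OF assms finite_states]] by metis
  then show ?thesis
    using borel_Int_in_prob_measures[OF prob_\<mu>, of U] by simp
qed

definition generic :: "(int \<Rightarrow> 'a) \<Rightarrow> bool" where
  "generic x \<longleftrightarrow> x \<in> X \<and> (\<forall>m. \<exists>n\<ge>m. (shift_map ^^ n) x \<in> funnel N b M) \<and>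
     (\<forall>N' b' M'. M' \<subseteq> {s. length s = 2 * R} \<longrightarrow> card M' < card M \<longrightarrow> x \<notin> funnel N' b' M')"

text \<open>The infinitely recurrent points have at least the measure of the funnel, hence measure
  one by ergodicity. The funnels to be avoided are null and countably many: two natural numbers and
  a finite choice of states.\<close>

lemma AE_generic: "AE x in \<mu>. generic x"
proof -
  let ?A = "{x \<in> X. \<forall>m. \<exists>n\<ge>m. (shift_map ^^ n) x \<in> funnel N b M}"
  note G = sets_funnel[OF states, of N b]
  have A: "?A \<in> sets \<mu>"
    using \<mu>.infinitely_often_sets[OF G] unfolding space_\<mu> .
  \<comment> \<open>Ergodicity is formulated for sets that equal their preimage, so the recurrent
    points must form a strictly invariant set.\<close>
  have "(\<forall>m. \<exists>n\<ge>m. (shift_map ^^ n) (shift_map x) \<in> B) \<longleftrightarrow> (\<forall>m. \<exists>n\<ge>m. (shift_map ^^ n) x \<in> B)"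
    for x and B :: "(int \<Rightarrow> 'a) set"
  proof -
    have eq: "(shift_map ^^ n) (shift_map x) = (shift_map ^^ Suc n) x" for n
      by (simp only: funpow_Suc_right comp_apply)
    show ?thesis
      unfolding eq
    proof (intro iffI allI)
      fix m
      assume "\<forall>m. \<exists>n\<ge>m. (shift_map ^^ Suc n) x \<in> B"
      then obtain n where "n \<ge> m" "(shift_map ^^ Suc n) x \<in> B" by blast
      then show "\<exists>n\<ge>m. (shift_map ^^ n) x \<in> B" by (intro exI[of _ "Suc n"]) auto
    next
      fix m
      assume "\<forall>m. \<exists>n\<ge>m. (shift_map ^^ n) x \<in> B"
      then obtain n where n: "n \<ge> Suc m" "(shift_map ^^ n) x \<in> B" by blast
      then obtain k where "n = Suc k" using Suc_le_D by blast
      then show "\<exists>n\<ge>m. (shift_map ^^ Suc n) x \<in> B" using n by blast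
    qed
  qed
  then have "shift_map -` ?A \<inter> X = ?A"
    using shift_space_shift[OF shift_space_X] by auto
  then have "measure \<mu> ?A = 0 \<or> measure \<mu> ?A = 1"
    using ergodic A unfolding ergodic_measures_def by blast
  moreover have "measure \<mu> (funnel N b M) \<le> measure \<mu> ?A"
    using \<mu>.measure_infinitely_often_ge[OF G] unfolding space_\<mu> .
  ultimately have "measure \<mu> ?A = 1"
    using funnel_pos by linarith
  then have 1: "AE x in \<mu>. x \<in> ?A"
    using \<mu>.prob_eq_1[OF A] by simp
  have "AE x in \<mu>. \<forall>M'\<in>{M'. M' \<subseteq> {s. length s = 2 * R} \<and> card M' < card M}. x \<notin> funnel N' b' M'" for N' b'
  proof (rule AE_finite_allI)
    show "finite {M' :: 'a list set. M' \<subseteq> {s. length s = 2 * R} \<and> card M' < card M}"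
      by (rule finite_subset[OF _ finite_Pow_iff[THEN iffD2, OF finite_states[of "2 * R"]]]) auto
    fix M' :: "'a list set" assume M': "M' \<in> {M'. M' \<subseteq> {s. length s = 2 * R} \<and> card M' < card M}"
    then have "funnel N' b' M' \<in> null_sets \<mu>"
      using sets_funnel[of M' N' b'] minimal[of M' N' b'] by (auto simp: null_sets_def \<mu>.emeasure_eq_measure)
    then show "AE x in \<mu>. x \<notin> funnel N' b' M'" by (rule AE_not_in)
  qed
  then have 2: "AE x in \<mu>. \<forall>N' b'. \<forall>M'\<in>{M'. M' \<subseteq> {s. length s = 2 * R} \<and> card M' < card M}. x \<notin> funnel N' b' M'"
    by (simp add: AE_all_countable)
  show ?thesis
    using 1 2 by eventually_elim (auto simp: generic_def)
qed

text \<open>Within a fibre it suffices to ask \<open>x\<close> to be in the funnel, as membership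
  depends only on the image: \<open>x'\<close> can then be routed through \<open>M\<close>
  too.\<close>

definition bad :: "((int \<Rightarrow> 'a) \<times> (int \<Rightarrow> 'a)) set" where
  "bad = {(x, x') \<in> X \<times> X. x \<in> funnel N b M \<and> \<not> (\<exists>s\<in>M. routable N b s x \<and> routable N b s x')}"

lemma open_bad:
  obtains U where "open U" "bad = U \<inter> (X \<times> X)"
proof -
  have fin: "finite M" by (rule finite_subset[OF states finite_states])
  obtain V where V: "open V" "funnel N b M = V \<inter> X"
    using open_funnel[OF fin] by metis
  have "\<exists>C. clopen C \<and> (\<forall>x\<in>X. x \<in> C \<longleftrightarrow> routable N b s x)" for s
    using routable_clopen by metis
  then obtain C where C: "\<And>s. clopen (C s)" "\<And>s x. x \<in> X \<Longrightarrow> x \<in> C s \<longleftrightarrow> routable N b s x"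
    by metis
  let ?U = "(V \<times> UNIV) \<inter> - (\<Union>s\<in>M. C s \<times> C s)"
  have "closed (\<Union>s\<in>M. C s \<times> C s)"
    using fin C(1) by (intro closed_UN ballI closed_Times) (simp_all add: clopen_def)
  then have "open ?U"
    using V(1) by (intro open_Int open_Times open_Compl open_UNIV)
  moreover have "bad = ?U \<inter> (X \<times> X)"
    using V(2) C(2) by (auto simp: bad_def)
  ultimately show thesis by (rule that)
qed

text \<open>A generic point returns to the funnel infinitely often, and each return without a bad
  pair provides a common state.\<close>

lemma class_pairs_if_not_bad:
  assumes x: "generic x" "x' \<in> X" "\<pi> x = \<pi> x'"
    and nb: "\<And>n. ((shift_map ^^ n) x, (shift_map ^^ n) x') \<notin> bad"
  shows "(x, x') \<in> class_pairs X \<pi>"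
proof -
  have xX: "x \<in> X" using x(1) by (simp add: generic_def)
  have "\<exists>n\<ge>m. \<exists>s. routable N b s ((shift_map ^^ n) x) \<and> routable N b s ((shift_map ^^ n) x')" for m
  proof -
    obtain n where n: "n \<ge> m" "(shift_map ^^ n) x \<in> funnel N b M"
      using x(1) unfolding generic_def by blast
    then show ?thesis
      using nb[of n] shift_space_power[OF shift_space_X] xX x(2) by (auto simp: bad_def)
  qed
  then have "equivalent x x'"
    by (rule equivalent_if_common_routes[OF xX x(2,3)])
  then show ?thesis
    using xX x by (simp add: class_pairs_iff)
qed

text \<open>By minimality there are at least \<^term>\<open>card M\<close> classes over a generic point. If equivalent points \<^term>\<open>x\<close>
  and \<^term>\<open>x'\<close> failed infinitely often to share a state of \<^term>\<open>M\<close>, then adding \<^term>\<open>x'\<close> to representatives of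
  the classes, including \<^term>\<open>x\<close>, gives more points than states, and by the pigeonhole principle two inequivalent
  points share a state infinitely often.\<close>

lemma not_bad_if_class_pairs:
  assumes x: "generic x" and eqv: "(x, x') \<in> class_pairs X \<pi>"
  shows "\<exists>m. \<forall>n\<ge>m. ((shift_map ^^ n) x, (shift_map ^^ n) x') \<notin> bad"
proof (rule ccontr)
  assume "\<not> ?thesis"
  then have inf: "\<exists>n\<ge>m. ((shift_map ^^ n) x, (shift_map ^^ n) x') \<in> bad" for m by blast
  define share where "share n p q \<longleftrightarrow>
    (\<exists>s\<in>M. routable N b s ((shift_map ^^ n) p) \<and> routable N b s ((shift_map ^^ n) q))" for n p q
  have fin: "finite M" by (rule finite_subset[OF states finite_states])
  have xx': "x \<in> X" "x' \<in> X" "\<pi> x' = \<pi> x" "equivalent x x'"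
    using eqv by (simp_all add: class_pairs_iff)
  obtain T where T: "inequivalent_in_fibre x T" "card M \<le> card T"
    using inequivalent_set_exists[OF xx'(1), of "card M"] x unfolding generic_def by blast
  have T': "finite T" "x \<in> T" "\<And>p. p \<in> T \<Longrightarrow> p \<in> X" "\<And>p. p \<in> T \<Longrightarrow> \<pi> p = \<pi> x"
      "\<And>p q. p \<in> T \<Longrightarrow> q \<in> T \<Longrightarrow> p \<noteq> q \<Longrightarrow> \<not> equivalent p q"
    using T(1) by (auto simp: inequivalent_in_fibre_def)
  have bad: "\<exists>s\<in>M. routable N b s ((shift_map ^^ n) p)" "\<not> share n x x'"
    if "((shift_map ^^ n) x, (shift_map ^^ n) x') \<in> bad" "p \<in> X" "\<pi> p = \<pi> x" for n p
    using that code_fibre_power[OF that(2) xx'(1) that(3), of n] shift_space_power[OF shift_space_X that(2), of n]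
    by (auto simp: bad_def funnel_def share_def)
  \<comment> \<open>At a bad time \<open>x\<close> is routed through a state of \<open>M\<close>,
    which it certainly shares with itself.\<close>
  have neq: "x' \<noteq> x"
    using inf[of 0] bad(1)[OF _ xx'(1) refl] bad(2)[OF _ xx'(1) refl] unfolding share_def by blast
  then have x'T: "x' \<notin> T"
    using T'(5)[OF T'(2), of x'] xx'(4) neq by blast
  let ?T = "insert x' T"
  have cardT: "card M < card ?T" and finT: "finite ?T"
    using T(2) T'(1) x'T by simp_all
  have in_fibre: "p \<in> X" "\<pi> p = \<pi> x" if "p \<in> ?T" for p
    using that T'(3,4) xx'(2,3) by blast+
  \<comment> \<open>At a bad time the two points found by the pigeonhole principle cannot be
    \<open>x\<close> and \<open>x'\<close>, which then share no state.\<close>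
  define P where "P = {(p, q) \<in> ?T \<times> ?T. p \<noteq> q \<and> (p, q) \<noteq> (x, x') \<and> (p, q) \<noteq> (x', x)}"
  have ex: "\<exists>n\<ge>m. \<exists>r\<in>P. share n (fst r) (snd r)" for m
  proof -
    obtain n where n: "n \<ge> m" "((shift_map ^^ n) x, (shift_map ^^ n) x') \<in> bad"
      using inf by blast
    have "\<exists>s\<in>M. routable N b s ((shift_map ^^ n) p)" if "p \<in> ?T" for p
      using bad(1)[OF n(2) in_fibre[OF that]] .
    then obtain c where c: "\<And>p. p \<in> ?T \<Longrightarrow> c p \<in> M"
        "\<And>p. p \<in> ?T \<Longrightarrow> routable N b (c p) ((shift_map ^^ n) p)"
      by metis
    have "card (c ` ?T) \<le> card M"
      using c(1) fin by (intro card_mono) auto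
    then have "\<not> inj_on c ?T"
      using cardT by (intro pigeonhole) simp
    then obtain p q where pq: "p \<in> ?T" "q \<in> ?T" "p \<noteq> q" "c p = c q"
      unfolding inj_on_def by blast
    then have sh: "share n p q" "share n q p"
      unfolding share_def using c by metis+
    then have "(p, q) \<in> P"
      using pq bad(2)[OF n(2) xx'(1) refl] by (auto simp: P_def)
    then show ?thesis using n(1) sh(1) by (intro exI[of _ n] conjI bexI[of _ "(p, q)"]) auto
  qed
  \<comment> \<open>Finitely many pairs and unboundedly many times: some pair recurs.\<close>
  have "\<exists>r\<in>P. \<forall>m. \<exists>n\<ge>m. share n (fst r) (snd r)"
  proof (rule ccontr)
    assume "\<not> ?thesis"
    then have "\<forall>r\<in>P. \<exists>m. \<forall>n\<ge>m. \<not> share n (fst r) (snd r)" by blast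
    from bchoice[OF this] obtain m where m: "\<And>r n. r \<in> P \<Longrightarrow> n \<ge> m r \<Longrightarrow> \<not> share n (fst r) (snd r)"
      by blast
    have finP: "finite P"
      by (rule finite_subset[of _ "?T \<times> ?T"]) (use finT in \<open>auto simp: P_def\<close>)
    obtain n r where nr: "n \<ge> (\<Sum>r\<in>P. m r)" "r \<in> P" "share n (fst r) (snd r)"
      using ex by blast
    have "m r \<le> (\<Sum>r\<in>P. m r)"
      by (rule member_le_sum[OF nr(2) _ finP]) simp
    then show False using m[OF nr(2), of n] nr by linarith
  qed
  then obtain p q where pq: "(p, q) \<in> P" "\<And>m. \<exists>n\<ge>m. share n p q"
    by auto
  have pqT: "p \<in> ?T" "q \<in> ?T" "p \<noteq> q" "(p, q) \<noteq> (x, x')" "(p, q) \<noteq> (x', x)"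
    using pq(1) by (auto simp: P_def)
  note pF = in_fibre[OF pqT(1)] and qF = in_fibre[OF pqT(2)]
  have "equivalent p q"
  proof (rule equivalent_if_common_routes[where N = N and b = b])
    show "\<exists>n\<ge>m. \<exists>s. routable N b s ((shift_map ^^ n) p) \<and> routable N b s ((shift_map ^^ n) q)" for m
      using pq(2)[of m] unfolding share_def by blast
  qed (use pF qF in auto)
  \<comment> \<open>If the recurring pair contains \<open>x'\<close>, replace it by the equivalent
    point \<open>x\<close>. The other point is not \<open>x\<close> by the definition of
    \<open>P\<close>, so two distinct points of \<open>T\<close> become equivalent.\<close>
  moreover have "equivalent x q" if "p = x'"
    using that \<open>equivalent p q\<close> equivalent_trans[OF refl xx'(3) qF(2) xx'(4)] by simp
  moreover have "equivalent x p" if "q = x'"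
    using that \<open>equivalent p q\<close> equivalent_trans[OF refl xx'(3) pF(2) xx'(4)] equivalent_sym by blast
  ultimately show False
    using pqT T'(2) T'(5)[of p q] T'(5)[of x q] T'(5)[of x p] by blast
qed

end

section \<open>Closed sets and maxima in the weak-* topology\<close>

text \<open>Equality is tested on clopen sets, whose measures depend continuously on the
  parameter.\<close>

lemma closedin_weak_star_eq:
  fixes Z :: "'x::stone_space set"
  assumes h: "continuous_map T (weak_star Z) h" and k: "continuous_map T (weak_star Z) k"
  shows "closedin T {t \<in> topspace T. h t = k t}"
proof -
  have in_prob: "h t \<in> prob_measures Z" "k t \<in> prob_measures Z" if "t \<in> topspace T" for t
    using that h k by (auto simp: continuous_map_def)
  let ?d = "\<lambda>C t. measure (h t) (C \<inter> Z) - measure (k t) (C \<inter> Z)"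
  have closed: "closedin T {t \<in> topspace T. ?d C t \<in> {0}}" if "clopen C" for C
  proof (rule closedin_continuous_map_preimage)
    show "continuous_map T euclideanreal (?d C)"
      using continuous_map_compose[OF h continuous_map_weak_star_measure_clopen[OF that, of Z]]
        continuous_map_compose[OF k continuous_map_weak_star_measure_clopen[OF that, of Z]]
      by (intro continuous_map_diff) (simp_all add: comp_def)
  qed simp
  have "{t \<in> topspace T. h t = k t} = (\<Inter>C\<in>{C. clopen C}. {t \<in> topspace T. ?d C t \<in> {0}})"
  proof (intro set_eqI iffI)
    fix t assume t: "t \<in> (\<Inter>C\<in>{C. clopen C}. {t \<in> topspace T. ?d C t \<in> {0}})"
    then have "t \<in> topspace T" using clopen_simps(1) by blast
    moreover from this have "h t = k t"
      using t in_prob by (intro prob_measures_eqI[of _ Z]) auto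
    ultimately show "t \<in> {t \<in> topspace T. h t = k t}" by simp
  qed auto
  also have "closedin T \<dots>"
    using closed by (intro closedin_INT) (auto intro: exI[of _ "{}"])
  finally show ?thesis .
qed

text \<open>Finitely many superlevel sets at attained values have the best of these finitely many
  points in common, so by compactness all of them have a common point.\<close>

lemma upper_semicontinuous_attains_max:
  fixes g :: "'t \<Rightarrow> real"
  assumes J: "compactin T J" "J \<noteq> {}" and closed: "\<And>c. closedin T {x \<in> J. c \<le> g x}"
  obtains x where "x \<in> J" "\<And>y. y \<in> J \<Longrightarrow> g y \<le> g x"
proof -
  let ?C = "\<lambda>y. {x \<in> J. g y \<le> g x}"
  have "J \<inter> \<Inter>(?C ` J) \<noteq> {}"
  proof (rule compactin_fip[THEN iffD1, OF J(1), THEN conjunct2, rule_format], intro conjI ballI allI impI)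
    fix F assume F: "finite F \<and> F \<subseteq> ?C ` J"
    then obtain K where K: "finite K" "K \<subseteq> J" "F = ?C ` K"
      using finite_subset_image[of F ?C J] by blast
    show "J \<inter> \<Inter>F \<noteq> {}"
    proof (cases "K = {}")
      case False
      then have "Max (g ` K) \<in> g ` K" using Max_in K(1) by simp
      then obtain k where k: "k \<in> K" "Max (g ` K) = g k" by auto
      have "g l \<le> g k" if "l \<in> K" for l
        unfolding k(2)[symmetric] using that K(1) by (intro Max_ge) auto
      then have "k \<in> J \<inter> \<Inter>F" using K k(1) by auto
      then show ?thesis by blast
    qed (use K J(2) in auto)
  qed (use closed in auto)
  then show thesis using that by blast
qed

lemma map_prod_power:
  fixes f :: "'x \<Rightarrow> 'x" and g :: "'y \<Rightarrow> 'y"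
  shows "(map_prod f g ^^ n) p = ((f ^^ n) (fst p), (g ^^ n) (snd p))"
  by (induction n) simp_all

section \<open>Joinings supported on pairs of equivalent points\<close>

context minimal_funnel
begin

abbreviation "shift2 \<equiv> map_prod shift_map (shift_map :: (int \<Rightarrow> 'a) \<Rightarrow> _)"

abbreviation "margin2 \<rho> \<equiv> distr \<rho> (borel_on X) snd"

text \<open>The second margin is left free, which gathers the joinings with all class parallel
  measures into one compact convex set.\<close>

definition class_joinings :: "((int \<Rightarrow> 'a) \<times> (int \<Rightarrow> 'a)) measure set" where
  "class_joinings = {\<rho>. \<rho> \<in> relative_joinings X \<pi> \<mu> (margin2 \<rho>) \<and> emeasure \<rho> (class_pairs X \<pi>) = 1}"

lemma closed_XX: "closed (X \<times> X)"
  by (intro closed_Times closed_X)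

lemma continuous_XX:
  "continuous_on (X \<times> X) fst" "continuous_on (X \<times> X) snd" "continuous_on (X \<times> X) shift2"
  "fst ` (X \<times> X) \<subseteq> X" "snd ` (X \<times> X) \<subseteq> X" "shift2 ` (X \<times> X) \<subseteq> X \<times> X"
proof -
  show "continuous_on (X \<times> X) shift2"
    unfolding map_prod_def split_beta
    by (intro continuous_on_Pair continuous_on_compose2[OF continuous_on_shift_map[of UNIV]]
        continuous_on_fst continuous_on_snd continuous_on_id) auto
qed (use shift_space_shift[OF shift_space_X] in \<open>auto intro!: continuous_on_fst continuous_on_snd continuous_on_id\<close>)

text \<open>Gives the fibre condition the same shape as the condition on \<open>bad\<close>: a
  relatively open set must be null.\<close>

definition separated :: "((int \<Rightarrow> 'a) \<times> (int \<Rightarrow> 'a)) set" where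
  "separated = {p \<in> X \<times> X. \<pi> (fst p) \<noteq> \<pi> (snd p)}"

lemma open_separated:
  obtains U where "open U" "separated = U \<inter> (X \<times> X)"
  by (rule that[of "- {p \<in> X \<times> X. \<pi> (fst p) = \<pi> (snd p)}"])
    (use closed_fibre_pairs in \<open>auto simp: separated_def\<close>)

lemma sets_bad_separated:
  assumes "\<rho> \<in> prob_measures (X \<times> X)"
  shows "bad \<in> sets \<rho>" "separated \<in> sets \<rho>"
proof -
  show "bad \<in> sets \<rho>"
    using open_bad borel_Int_in_prob_measures[OF assms] borel_open by metis
  show "separated \<in> sets \<rho>"
    using open_separated borel_Int_in_prob_measures[OF assms] borel_open by metis
qed

lemma AE_same_fibre_iff:
  assumes \<rho>: "\<rho> \<in> prob_measures (X \<times> X)"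
  shows "(AE p in \<rho>. \<pi> (fst p) = \<pi> (snd p)) \<longleftrightarrow> measure \<rho> separated = 0"
proof -
  interpret prob_space \<rho> by (rule prob_measuresD[OF \<rho>])
  have "(AE p in \<rho>. \<pi> (fst p) = \<pi> (snd p)) \<longleftrightarrow> (AE p in \<rho>. p \<notin> separated)"
    using prob_measuresD(3)[OF \<rho>] by (intro AE_cong) (auto simp: separated_def)
  then show ?thesis
    using prob_eq_0[OF sets_bad_separated(2)[OF \<rho>]] by simp
qed

text \<open>Equivalent pairs over generic points are bad only finitely often, so recurrence makes
  \<open>bad\<close> null. Conversely, if \<open>bad\<close> is null, so are its preimages under all
  iterates, and almost every pair avoids it along its whole forward orbit.\<close>

lemma class_pairs_full_iff:
  assumes \<rho>: "\<rho> \<in> prob_measures (X \<times> X)" and inv: "distr \<rho> (borel_on (X \<times> X)) shift2 = \<rho>"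
    and marg: "distr \<rho> (borel_on X) fst = \<mu>" and fibre: "measure \<rho> separated = 0"
  shows "emeasure \<rho> (class_pairs X \<pi>) = 1 \<longleftrightarrow> measure \<rho> bad = 0"
proof -
  note p = prob_measuresD[OF \<rho>]
  interpret prob_space \<rho> by (rule p)
  have "shift2 \<in> measurable \<rho> \<rho>"
    using measurable_prob_measures[OF \<rho> continuous_XX(3,6)] p(2) by (simp cong: measurable_cong_sets)
  moreover have "distr \<rho> \<rho> shift2 = \<rho>"
    using inv p(2) distr_cong[of \<rho> \<rho> \<rho> "borel_on (X \<times> X)" shift2 shift2] by simp
  ultimately interpret measure_preserving \<rho> shift2
    by unfold_locales
  have "AE x in distr \<rho> (borel_on X) fst. generic x"
    unfolding marg by (rule AE_generic)
  then have gen: "AE q in \<rho>. generic (fst q)"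
    by (rule AE_distrD[OF measurable_prob_measures[OF \<rho> continuous_XX(1,4)]])
  note bad_sets = sets_bad_separated(1)[OF \<rho>]
  have "class_pairs X \<pi> \<inter> (X \<times> X) = class_pairs X \<pi>"
    by (auto simp: class_pairs_def)
  then have C: "class_pairs X \<pi> \<in> sets \<rho>"
    using borel_Int_in_prob_measures[OF \<rho> borel_class_pairs] by simp
  then have full: "emeasure \<rho> (class_pairs X \<pi>) = 1 \<longleftrightarrow> (AE q in \<rho>. q \<in> class_pairs X \<pi>)"
    using prob_eq_1[OF C] by (simp add: emeasure_eq_measure)
  show ?thesis
    unfolding full
  proof
    assume "AE q in \<rho>. q \<in> class_pairs X \<pi>"
    with gen have "AE q in \<rho>. q \<notin> {q \<in> space \<rho>. \<forall>m. \<exists>n\<ge>m. (shift2 ^^ n) q \<in> bad}"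
    proof eventually_elim
      case (elim q)
      then show ?case
        using not_bad_if_class_pairs[of "fst q" "snd q"] by (auto simp: map_prod_power)
    qed
    then have "measure \<rho> {q \<in> space \<rho>. \<forall>m. \<exists>n\<ge>m. (shift2 ^^ n) q \<in> bad} = 0"
      using prob_eq_0[OF infinitely_often_sets[OF bad_sets]] by simp
    then show "measure \<rho> bad = 0"
      using measure_infinitely_often_ge[OF bad_sets] measure_nonneg[of \<rho> bad] by linarith
  next
    assume "measure \<rho> bad = 0"
    then have "AE q in \<rho>. q \<notin> (shift2 ^^ n) -` bad \<inter> space \<rho>" for n
      using prob_eq_0[OF measurable_sets[OF T_power_measurable bad_sets]] measure_vimage_T_power[OF bad_sets]
      by simp
    then have "AE q in \<rho>. \<forall>n. q \<notin> (shift2 ^^ n) -` bad \<inter> space \<rho>"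
      by (intro AE_all_countable[THEN iffD2] allI)
    moreover have "AE q in \<rho>. \<pi> (fst q) = \<pi> (snd q)"
      using AE_same_fibre_iff[OF \<rho>] fibre by simp
    ultimately show "AE q in \<rho>. q \<in> class_pairs X \<pi>"
      using gen AE_space
    proof eventually_elim
      case (elim q)
      have "(shift2 ^^ n) q \<notin> bad" for n
        using elim(1,4) by blast
      moreover have "snd q \<in> X"
        using elim(4) unfolding p(3) by auto
      ultimately have "(fst q, snd q) \<in> class_pairs X \<pi>"
        using elim(2,3) unfolding map_prod_power by (intro class_pairs_if_not_bad)
      then show ?case by simp
    qed
  qed
qed

text \<open>In this form every condition is weak-* closed and preserved by mixtures.\<close>

lemma class_joinings_iff:
  "\<rho> \<in> class_joinings \<longleftrightarrow> \<rho> \<in> prob_measures (X \<times> X) \<and> distr \<rho> (borel_on (X \<times> X)) shift2 = \<rho> \<and>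
     distr \<rho> (borel_on X) fst = \<mu> \<and> measure \<rho> separated = 0 \<and> measure \<rho> bad = 0"
  unfolding class_joinings_def relative_joinings_def
  using AE_same_fibre_iff class_pairs_full_iff by blast

lemma margin2_invariant:
  assumes "\<rho> \<in> class_joinings"
  shows "margin2 \<rho> \<in> invariant_measures X"
proof -
  have \<rho>: "\<rho> \<in> prob_measures (X \<times> X)" and inv: "distr \<rho> (borel_on (X \<times> X)) shift2 = \<rho>"
    using assms by (auto simp: class_joinings_iff)
  note snd = measurable_prob_measures[OF \<rho> continuous_XX(2,5)]
  have s2: "shift2 \<in> measurable \<rho> (borel_on (X \<times> X))"
    by (rule measurable_prob_measures[OF \<rho> continuous_XX(3,6)])
  have snd': "snd \<in> measurable (borel_on (X \<times> X)) (borel_on X)"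
    using snd prob_measuresD(2)[OF \<rho>] by (simp cong: measurable_cong_sets)
  have "distr (margin2 \<rho>) (borel_on X) shift_map = distr \<rho> (borel_on X) (shift_map \<circ> snd)"
    by (rule distr_distr[OF shift_measurable[OF shift_space_X] snd])
  also have "shift_map \<circ> snd = snd \<circ> shift2"
    by (auto simp: fun_eq_iff)
  also have "distr \<rho> (borel_on X) (snd \<circ> shift2) = distr (distr \<rho> (borel_on (X \<times> X)) shift2) (borel_on X) snd"
    by (rule distr_distr[OF snd' s2, symmetric])
  finally show ?thesis
    using distr_in_prob_measures[OF \<rho> continuous_XX(2,5)] inv by (simp add: invariant_measures_def)
qed

lemma class_parallel_measures_eq: "class_parallel_measures X \<pi> \<mu> = margin2 ` class_joinings"
proof (intro set_eqI iffI)
  fix \<mu>' assume "\<mu>' \<in> class_parallel_measures X \<pi> \<mu>"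
  then obtain \<rho> where \<rho>: "\<rho> \<in> relative_joinings X \<pi> \<mu> \<mu>'" "emeasure \<rho> (class_pairs X \<pi>) = 1"
    by (auto simp: class_parallel_measures_def class_parallel_def)
  moreover from \<rho>(1) have "\<mu>' = margin2 \<rho>"
    by (auto simp: relative_joinings_def)
  ultimately show "\<mu>' \<in> margin2 ` class_joinings"
    by (auto simp: class_joinings_def)
next
  fix \<mu>' assume "\<mu>' \<in> margin2 ` class_joinings"
  then obtain \<rho> where \<rho>: "\<rho> \<in> class_joinings" "\<mu>' = margin2 \<rho>" by blast
  then show "\<mu>' \<in> class_parallel_measures X \<pi> \<mu>"
    using margin2_invariant[OF \<rho>(1)]
    by (auto simp: class_parallel_measures_def class_parallel_def class_joinings_def)
qed

lemma closedin_class_joinings: "closedin (weak_star (X \<times> X)) class_joinings"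
proof -
  let ?W = "weak_star (X \<times> X)"
  have id: "continuous_map ?W ?W (\<lambda>\<rho>. \<rho>)"
    using continuous_map_id[of ?W] by (simp add: id_def)
  have const: "continuous_map ?W (weak_star X) (\<lambda>\<rho>. \<mu>)"
    by (simp add: continuous_map_const prob_\<mu>)
  obtain U where U: "open U" "separated = U \<inter> (X \<times> X)" by (rule open_separated)
  obtain V where V: "open V" "bad = V \<inter> (X \<times> X)" by (rule open_bad)
  have c1: "closedin ?W {\<rho> \<in> topspace ?W. distr \<rho> (borel_on (X \<times> X)) shift2 = \<rho>}"
    by (rule closedin_weak_star_eq[OF continuous_map_weak_star_distr[OF continuous_XX(3,6)] id])
  have c2: "closedin ?W {\<rho> \<in> topspace ?W. distr \<rho> (borel_on X) fst = \<mu>}"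
    by (rule closedin_weak_star_eq[OF continuous_map_weak_star_distr[OF continuous_XX(1,4)] const])
  have "closedin ?W ({\<rho> \<in> topspace ?W. distr \<rho> (borel_on (X \<times> X)) shift2 = \<rho>} \<inter>
      {\<rho> \<in> topspace ?W. distr \<rho> (borel_on X) fst = \<mu>} \<inter>
      {\<rho> \<in> prob_measures (X \<times> X). measure \<rho> separated = 0} \<inter> {\<rho> \<in> prob_measures (X \<times> X). measure \<rho> bad = 0})"
    unfolding U(2) V(2)
    by (intro closedin_Int c1 c2 closedin_weak_star_null_open U V)
  also have "\<dots> = class_joinings"
    unfolding set_eq_iff Int_iff mem_Collect_eq class_joinings_iff topspace_weak_star by blast
  finally show ?thesis .
qed

lemma compactin_class_joinings: "compactin (weak_star (X \<times> X)) class_joinings"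
proof (rule closed_compactin[OF compactin_prob_measures[OF closed_XX] _ closedin_class_joinings])
  show "class_joinings \<subseteq> prob_measures (X \<times> X)"
    by (auto simp: class_joinings_iff)
qed

text \<open>The diagonal joining of \<mu> with itself works: a point of the funnel is routed through
  some state of \<open>M\<close>, so \<open>bad\<close> misses the diagonal, as does
  \<open>separated\<close>.\<close>

lemma class_joinings_nonempty: "class_joinings \<noteq> {}"
proof -
  let ?d = "\<lambda>x :: int \<Rightarrow> 'a. (x, x)"
  define \<rho> where "\<rho> = distr \<mu> (borel_on (X \<times> X)) ?d"
  have cont: "continuous_on X ?d" "?d ` X \<subseteq> X \<times> X"
    by (auto intro!: continuous_on_Pair continuous_on_id)
  note d = measurable_prob_measures[OF prob_\<mu> cont]
  have \<rho>: "\<rho> \<in> prob_measures (X \<times> X)"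
    unfolding \<rho>_def by (rule distr_in_prob_measures[OF prob_\<mu> cont])
  have fst: "fst \<in> measurable (borel_on (X \<times> X)) (borel_on X)"
    and s2: "shift2 \<in> measurable (borel_on (X \<times> X)) (borel_on (X \<times> X))"
    using measurable_prob_measures[OF \<rho> continuous_XX(1,4)] measurable_prob_measures[OF \<rho> continuous_XX(3,6)]
      prob_measuresD(2)[OF \<rho>] by (simp_all cong: measurable_cong_sets)
  have shift: "shift_map \<in> measurable \<mu> (borel_on X)" and d': "?d \<in> measurable (borel_on X) (borel_on (X \<times> X))"
    using shift_measurable[OF shift_space_X] d prob_measuresD(2)[OF prob_\<mu>]
    by (simp_all cong: measurable_cong_sets)
  have "distr \<rho> (borel_on (X \<times> X)) shift2 = distr \<mu> (borel_on (X \<times> X)) (shift2 \<circ> ?d)"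
    unfolding \<rho>_def by (rule distr_distr[OF s2 d])
  also have "shift2 \<circ> ?d = ?d \<circ> shift_map" by (auto simp: fun_eq_iff)
  also have "distr \<mu> (borel_on (X \<times> X)) (?d \<circ> shift_map) = distr (distr \<mu> (borel_on X) shift_map) (borel_on (X \<times> X)) ?d"
    by (rule distr_distr[OF d' shift, symmetric])
  also have "distr \<mu> (borel_on X) shift_map = \<mu>"
    using invariant_\<mu> by (simp add: invariant_measures_def)
  finally have "distr \<rho> (borel_on (X \<times> X)) shift2 = \<rho>" by (simp add: \<rho>_def)
  moreover have "distr \<rho> (borel_on X) fst = \<mu>"
  proof -
    have "distr \<rho> (borel_on X) fst = distr \<mu> (borel_on X) (fst \<circ> ?d)"
      unfolding \<rho>_def by (rule distr_distr[OF fst d])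
    also have "\<dots> = distr \<mu> \<mu> (\<lambda>x. x)"
      using prob_measuresD(2)[OF prob_\<mu>] by (intro distr_cong) (auto simp: comp_def)
    finally show ?thesis by (simp add: distr_id)
  qed
  moreover have "measure \<rho> A = 0" if A: "A \<in> sets \<rho>" "\<And>x. (x, x) \<notin> A" for A
  proof -
    have "?d -` A \<inter> space \<mu> = {}" using A(2) by auto
    then show ?thesis
      using measure_distr[OF d, of A] A(1) unfolding \<rho>_def by simp
  qed
  note null = this
  have "measure \<rho> separated = 0"
    by (rule null[OF sets_bad_separated(2)[OF \<rho>]]) (auto simp: separated_def)
  moreover have "measure \<rho> bad = 0"
    by (rule null[OF sets_bad_separated(1)[OF \<rho>]]) (auto simp: bad_def funnel_def)
  ultimately have "\<rho> \<in> class_joinings"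
    using \<rho> by (simp add: class_joinings_iff)
  then show ?thesis by blast
qed

lemma mixture_class_joinings:
  assumes "\<rho> \<in> class_joinings" "\<rho>' \<in> class_joinings" "t \<in> {0..1}"
  shows "mixture t \<rho> \<rho>' \<in> class_joinings" "margin2 (mixture t \<rho> \<rho>') = mixture t (margin2 \<rho>) (margin2 \<rho>')"
proof -
  note j = assms(1,2)[unfolded class_joinings_iff]
  have \<rho>: "\<rho> \<in> prob_measures (X \<times> X)" and \<rho>': "\<rho>' \<in> prob_measures (X \<times> X)"
    using j by auto
  note distr = distr_mixture[OF \<rho> \<rho>' measurable_prob_measures[OF \<rho>]]
  have "measure (mixture t \<rho> \<rho>') separated = 0" "measure (mixture t \<rho> \<rho>') bad = 0"
    using j by (simp_all add: measure_mixture[OF \<rho> \<rho>' assms(3)] sets_bad_separated[OF \<rho>])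
  then show "mixture t \<rho> \<rho>' \<in> class_joinings"
    using j mixture_in_prob_measures[OF \<rho> \<rho>' assms(3)]
    by (simp add: class_joinings_iff distr continuous_XX mixture_same[OF prob_\<mu> assms(3)])
  show "margin2 (mixture t \<rho> \<rho>') = mixture t (margin2 \<rho>) (margin2 \<rho>')"
    by (rule distr[OF continuous_XX(2,5)])
qed

section \<open>Equilibrium measures\<close>

context
  fixes f :: "(int \<Rightarrow> 'a) \<Rightarrow> real"
  assumes f: "continuous_on X f"
begin

definition free_energy :: "(int \<Rightarrow> 'a) measure \<Rightarrow> real" where
  "free_energy \<mu>' = entropy_rate \<mu>' shift_map (\<lambda>x. x 0) + (\<integral>x. f x \<partial>\<mu>')"

lemma pressure_eq: "\<mu>' \<in> invariant_measures X \<Longrightarrow> pressure f \<mu>' = ereal (free_energy \<mu>')"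
  by (simp add: pressure_def free_energy_def ks_entropy_shift[OF shift_space_X])

text \<open>Upper semicontinuity. The entropy rate is the infimum over \<open>n\<close> of the
  continuous functions \<open>?H (margin2 \<rho>) n / real n\<close>, so a superlevel set is an
  intersection of closed sets.\<close>

lemma closedin_free_energy_ge:
  "closedin (weak_star (X \<times> X)) {\<rho> \<in> class_joinings. c \<le> free_energy (margin2 \<rho>)}"
proof -
  let ?W = "weak_star (X \<times> X)"
  let ?H = "\<lambda>\<mu>' n. partition_entropy \<mu>' (itinerary shift_map (\<lambda>x. x 0) n)"
  note marg = continuous_map_weak_star_distr[OF continuous_XX(2,5)]
  have closed: "closedin ?W {\<rho> \<in> topspace ?W. ?H (margin2 \<rho>) n / real n + (\<integral>x. f x \<partial>margin2 \<rho>) \<in> {c..}}" for n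
  proof (rule closedin_continuous_map_preimage)
    have "continuous_map ?W euclideanreal (\<lambda>\<rho>. ?H (margin2 \<rho>) n)"
      using continuous_map_compose[OF marg continuous_map_weak_star_partition_entropy[OF itinerary_coordinate_agree]]
      by (simp add: comp_def)
    moreover have "continuous_map ?W euclideanreal (\<lambda>\<rho>. \<integral>x. f x \<partial>margin2 \<rho>)"
      using continuous_map_compose[OF marg continuous_map_weak_star_integral[OF f]] by (simp add: comp_def)
    ultimately show "continuous_map ?W euclideanreal (\<lambda>\<rho>. ?H (margin2 \<rho>) n / real n + (\<integral>x. f x \<partial>margin2 \<rho>))"
      unfolding divide_inverse by (intro continuous_map_add continuous_map_real_mult_right)
  qed simp
  have "c \<le> free_energy (margin2 \<rho>) \<longleftrightarrow> (\<forall>n\<in>{1..}. c \<le> ?H (margin2 \<rho>) n / real n + (\<integral>x. f x \<partial>margin2 \<rho>))"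
    if "\<rho> \<in> class_joinings" for \<rho>
  proof -
    note inv = margin2_invariant[OF that]
    interpret \<mu>': measure_preserving "margin2 \<rho>" shift_map
      by (rule invariant_imp_measure_preserving[OF shift_space_X inv])
    note s = simple_function_coordinate[OF invariant_measuresD(1)[OF inv]]
    have bdd: "bdd_below ((\<lambda>n. ?H (margin2 \<rho>) n / real n) ` {1..})"
      using \<mu>'.partition_entropy_nonneg[OF \<mu>'.simple_function_itinerary[OF s]]
      by (intro bdd_belowI[of _ 0]) auto
    have "c - (\<integral>x. f x \<partial>margin2 \<rho>) \<le> entropy_rate (margin2 \<rho>) shift_map (\<lambda>x. x 0) \<longleftrightarrow>
        (\<forall>n\<in>{1..}. c - (\<integral>x. f x \<partial>margin2 \<rho>) \<le> ?H (margin2 \<rho>) n / real n)"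
      unfolding \<mu>'.entropy_rate_limit(2)[OF s] by (rule le_cINF_iff[OF _ bdd]) auto
    then show ?thesis
      by (simp add: free_energy_def diff_le_eq)
  qed
  then have "{\<rho> \<in> class_joinings. c \<le> free_energy (margin2 \<rho>)} = class_joinings \<inter>
      (\<Inter>n\<in>{1..}. {\<rho> \<in> topspace ?W. ?H (margin2 \<rho>) n / real n + (\<integral>x. f x \<partial>margin2 \<rho>) \<in> {c..}})"
    using closedin_subset[OF closedin_class_joinings] by auto
  also have "closedin ?W \<dots>"
    by (intro closedin_Int closedin_INT closed closedin_class_joinings) auto
  finally show ?thesis .
qed

text \<open>As a superlevel set at the maximum \<open>c\<close>, the set of maximizing joinings is
  closed by semicontinuity and convex by concavity.\<close>

lemma equilibrium_eq:
  obtains c where "class_equilibrium_measures X \<pi> \<mu> f = margin2 ` {\<rho> \<in> class_joinings. c \<le> free_energy (margin2 \<rho>)}"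
    "\<And>\<rho>. \<rho> \<in> class_joinings \<Longrightarrow> free_energy (margin2 \<rho>) \<le> c"
    "{\<rho> \<in> class_joinings. c \<le> free_energy (margin2 \<rho>)} \<noteq> {}"
proof -
  obtain \<rho>0 where \<rho>0: "\<rho>0 \<in> class_joinings"
      "\<And>\<rho>. \<rho> \<in> class_joinings \<Longrightarrow> free_energy (margin2 \<rho>) \<le> free_energy (margin2 \<rho>0)"
    using upper_semicontinuous_attains_max[OF compactin_class_joinings class_joinings_nonempty closedin_free_energy_ge]
    by metis
  let ?c = "free_energy (margin2 \<rho>0)"
  have "(\<forall>\<rho>'\<in>class_joinings. pressure f (margin2 \<rho>') \<le> pressure f (margin2 \<rho>)) \<longleftrightarrow> ?c \<le> free_energy (margin2 \<rho>)"
    if \<rho>: "\<rho> \<in> class_joinings" for \<rho>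
  proof -
    have "(\<forall>\<rho>'\<in>class_joinings. pressure f (margin2 \<rho>') \<le> pressure f (margin2 \<rho>)) \<longleftrightarrow>
        (\<forall>\<rho>'\<in>class_joinings. free_energy (margin2 \<rho>') \<le> free_energy (margin2 \<rho>))"
      using pressure_eq[OF margin2_invariant] \<rho> by simp
    also have "\<dots> \<longleftrightarrow> ?c \<le> free_energy (margin2 \<rho>)"
      using \<rho>0(1) order_trans[OF \<rho>0(2)] by blast
    finally show ?thesis .
  qed
  then have "class_equilibrium_measures X \<pi> \<mu> f = margin2 ` {\<rho> \<in> class_joinings. ?c \<le> free_energy (margin2 \<rho>)}"
    unfolding class_equilibrium_measures_def class_parallel_measures_eq by auto
  then show thesis
    using that[of ?c] \<rho>0 by blast
qed

lemma equilibrium_measures: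
  "class_equilibrium_measures X \<pi> \<mu> f \<noteq> {}"
  "convex_measures (class_equilibrium_measures X \<pi> \<mu> f)"
  "compactin (weak_star X) (class_equilibrium_measures X \<pi> \<mu> f)"
proof -
  obtain c where eq: "class_equilibrium_measures X \<pi> \<mu> f = margin2 ` {\<rho> \<in> class_joinings. c \<le> free_energy (margin2 \<rho>)}"
    and max: "\<And>\<rho>. \<rho> \<in> class_joinings \<Longrightarrow> free_energy (margin2 \<rho>) \<le> c"
    and ne: "{\<rho> \<in> class_joinings. c \<le> free_energy (margin2 \<rho>)} \<noteq> {}"
    using equilibrium_eq by blast
  show "class_equilibrium_measures X \<pi> \<mu> f \<noteq> {}"
    using ne unfolding eq by blast
  have "compactin (weak_star (X \<times> X)) {\<rho> \<in> class_joinings. c \<le> free_energy (margin2 \<rho>)}"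
    by (rule closed_compactin[OF compactin_class_joinings _ closedin_free_energy_ge]) auto
  then show "compactin (weak_star X) (class_equilibrium_measures X \<pi> \<mu> f)"
    unfolding eq by (rule image_compactin[OF _ continuous_map_weak_star_distr[OF continuous_XX(2,5)]])
  show "convex_measures (class_equilibrium_measures X \<pi> \<mu> f)"
    unfolding convex_measures_def
  proof (intro ballI)
    fix \<mu>1 \<mu>2 and t :: real
    assume "\<mu>1 \<in> class_equilibrium_measures X \<pi> \<mu> f" "\<mu>2 \<in> class_equilibrium_measures X \<pi> \<mu> f"
    then obtain \<rho>1 \<rho>2 where \<rho>1: "\<rho>1 \<in> class_joinings" "c \<le> free_energy (margin2 \<rho>1)" "\<mu>1 = margin2 \<rho>1"
      and \<rho>2: "\<rho>2 \<in> class_joinings" "c \<le> free_energy (margin2 \<rho>2)" "\<mu>2 = margin2 \<rho>2"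
      unfolding eq by blast
    assume t: "t \<in> {0..1}"
    note inv = margin2_invariant[OF \<rho>1(1)] margin2_invariant[OF \<rho>2(1)]
    note mix = mixture_class_joinings[OF \<rho>1(1) \<rho>2(1) t]
    \<comment> \<open>Both free energies are at least the maximum \<open>c\<close>, so by concavity
      the mixture reaches it too.\<close>
    have "c = t * c + (1 - t) * c" by (simp add: algebra_simps)
    also have "\<dots> \<le> t * free_energy \<mu>1 + (1 - t) * free_energy \<mu>2"
      using t \<rho>1(2,3) \<rho>2(2,3) by (intro add_mono mult_left_mono) auto
    also have "\<dots> \<le> free_energy (mixture t \<mu>1 \<mu>2)"
      using entropy_rate_mixture[OF shift_space_X inv t]
        integral_mixture[OF closed_X invariant_measuresD(1)[OF inv(1)] invariant_measuresD(1)[OF inv(2)] t f]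
      by (simp add: free_energy_def \<rho>1(3) \<rho>2(3) distrib_left)
    finally have "mixture t \<rho>1 \<rho>2 \<in> {\<rho> \<in> class_joinings. c \<le> free_energy (margin2 \<rho>)}"
      using mix \<rho>1(3) \<rho>2(3) by simp
    then show "mixture t \<mu>1 \<mu>2 \<in> class_equilibrium_measures X \<pi> \<mu> f"
      unfolding eq using mix(2) \<rho>1(3) \<rho>2(3) by (metis (no_types, lifting) image_eqI)
  qed
qed

end

end

theorem theorem11p2:
  fixes X :: "(int \<Rightarrow> 'a::alphabet) set"
    and Y :: "(int \<Rightarrow> 'b::alphabet) set"
    and \<pi> :: "(int \<Rightarrow> 'a) \<Rightarrow> (int \<Rightarrow> 'b)"
    and \<mu> :: "(int \<Rightarrow> 'a) measure"
    and f :: "(int \<Rightarrow> 'a) \<Rightarrow> real"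
  assumes "SFT X"
    and "factor_code X Y \<pi>"
    and "\<mu> \<in> ergodic_measures X"
    and "continuous_on X f"
  shows "class_equilibrium_measures X \<pi> \<mu> f \<noteq> {} \<and>
         convex_measures (class_equilibrium_measures X \<pi> \<mu> f) \<and>
         compactin (weak_star X) (class_equilibrium_measures X \<pi> \<mu> f)"
proof -
  obtain R where "gluing_code X \<pi> R"
    using gluing_code_exists[OF assms(1,2)] .
  then interpret gluing_code X \<pi> R .
  obtain N b M where "minimal_funnel X \<pi> R \<mu> N b M"
    using minimal_funnel_exists[OF assms(3)] .
  then interpret minimal_funnel X \<pi> R \<mu> N b M .
  show ?thesis
    using equilibrium_measures[OF assms(4)] by blast
qed

end
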